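(* Let $n\ge2$ and let $(\mathcal V_1,\dots,\mathcal V_n)$ be an $n$-isometric semigroup on a Hilbert space $\mathcal H$. Then $\mathcal H$ decomposes uniquely as $\mathcal H=\mathcal H_p\oplus\mathcal H_u$ with $\mathcal H_p,\mathcal H_u$ jointly reducing for $(\mathcal V_1,\dots,\mathcal V_n)$ such that (1) $(\mathcal V_1|_{\mathcal H_p},\dots,\mathcal V_n|_{\mathcal H_p})$ is a c.n.u. $n$-isometric semigroup, and (2) $(\mathcal V_1|_{\mathcal H_u},\dots,\mathcal V_n|_{\mathcal H_u})$ is an $n$-unitary semigroup. Moreover, every c.n.u. $n$-isometric semigroup is unitarily equivalent to a model $n$-isometric semigroup.
   Context: All Hilbert spaces are separable. A semigroup means a strongly continuous one-parameter semigroup $(V_t)_{t\ge0}$ of contractions. Two semigroups $(T_{1,t})$, $(T_{2,t})$ commute if $T_{1,t}T_{2,t}=T_{2,t}T_{1,t}$ for all $t\ge0$. An $n$-tuple of pairwise commuting semigroups is an $n$-isometric (resp. $n$-unitary) semigroup if each member consists of isometries (resp. unitaries). A subspace is jointly reducing if it reduces every operator of every semigroup in the tuple; $\mathcal V|_{\mathcal H_0}=(V_t|_{\mathcal H_0})_{t\ge0}$. An $n$-isometric semigroup is c.n.u. (completely non-unitary) if there is no non-zero jointly reducing subspace $\mathcal H_0$ on which each restricted semigroup is a unitary semigroup. Two tuples of semigroups are unitarily equivalent if a single unitary $\Lambda$ satisfies $V_{j,t}=\Lambda^*W_{j,t}\Lambda$ for all $j,t$. A B-C-L triple $\{\mathcal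 E,(P_1,\dots,P_n),(U_1,\dots,U_n)\}$ consists of a Hilbert space $\mathcal E$, orthogonal projections $P_j$ and unitaries $U_j$ on $\mathcal E$ such that: the $U_j$ commute and $U_1\cdots U_n=I_{\mathcal E}$; $P_j+U_j^*P_iU_j=P_i+U_i^*P_jU_i\le I_{\mathcal E}$ for $i\ne j$; and $P_1+U_1^*P_2U_1+U_1^*U_2^*P_3U_2U_1+\cdots+U_1^*\cdots U_{n-1}^*P_nU_{n-1}\cdots U_1=I_{\mathcal E}$. Given such a triple in which, for each $j$, $U_j$ fixes no non-zero vector of $\operatorname{ran}(P_j^\perp)$, let $\pi_j(z)=U_j(P_j^\perp+zP_j)$ for $z\in\mathbb D$, and $\varphi_t(\lambda)=e^{t\frac{\lambda+1}{\lambda-1}}$. The tuple $((M_{\varphi_t\circ\pi_1})_{t\ge0},\dots,(M_{\varphi_t\circ\pi_n})_{t\ge0})$ of multiplication semigroups on the Hardy space $H^2_{\mathbb D}(\mathcal E)$ is called a model $n$-isometric semigroup (it is an $n$-isometric semigroup). *)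

theory Defs
  imports "HOL-Analysis.Analysis"
begin

text \<open>A (separable) complex Hilbert space is modelled as a real Hilbert space
  (type of class real_inner + polish_space, i.e. complete and separable) together with an
  orthogonal complex structure J (multiplication by i).  Complex scalar multiplication is
  c x = Re c x + Im c (J x); the complex inner product is x.y + i (x.(J y)).\<close>

definition complex_structure :: "('a::real_inner \<Rightarrow> 'a) \<Rightarrow> bool" where
  "complex_structure J \<longleftrightarrow> bounded_linear J \<and> (\<forall>x. J (J x) = - x) \<and> (\<forall>x. norm (J x) = norm x)"

definition cscale :: "('a::real_vector \<Rightarrow> 'a) \<Rightarrow> complex \<Rightarrow> 'a \<Rightarrow> 'a" where
  "cscale J c x = Re c *\<^sub>R x + Im c *\<^sub>R J x"

definition cinner :: "('a::real_inner \<Rightarrow> 'a) \<Rightarrow> 'a \<Rightarrow> 'a \<Rightarrow> complex" where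
  "cinner J x y = Complex (x \<bullet> y) (x \<bullet> J y)"

definition csubspace :: "('a::real_inner \<Rightarrow> 'a) \<Rightarrow> 'a set \<Rightarrow> bool" where
  "csubspace J M \<longleftrightarrow> subspace M \<and> closed M \<and> (\<forall>x\<in>M. J x \<in> M)"

definition ocompl :: "('a::real_inner \<Rightarrow> 'a) \<Rightarrow> 'a set \<Rightarrow> 'a set \<Rightarrow> 'a set" where
  "ocompl J K M = {x\<in>K. \<forall>y\<in>M. cinner J x y = 0}"

definition clinear_on :: "('a::real_inner \<Rightarrow> 'a) \<Rightarrow> 'a set \<Rightarrow> ('a \<Rightarrow> 'a) \<Rightarrow> bool" where
  "clinear_on J K T \<longleftrightarrow> (\<forall>x\<in>K. T x \<in> K) \<and>
     (\<forall>x\<in>K. \<forall>y\<in>K. T (x + y) = T x + T y) \<and>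
     (\<forall>x\<in>K. \<forall>c. T (cscale J c x) = cscale J c (T x))"

definition isometry_on :: "('a::real_inner \<Rightarrow> 'a) \<Rightarrow> 'a set \<Rightarrow> ('a \<Rightarrow> 'a) \<Rightarrow> bool" where
  "isometry_on J K T \<longleftrightarrow> clinear_on J K T \<and> (\<forall>x\<in>K. norm (T x) = norm x)"

definition unitary_on :: "('a::real_inner \<Rightarrow> 'a) \<Rightarrow> 'a set \<Rightarrow> ('a \<Rightarrow> 'a) \<Rightarrow> bool" where
  "unitary_on J K T \<longleftrightarrow> isometry_on J K T \<and> T ` K = K"

definition orth_proj_on :: "('a::real_inner \<Rightarrow> 'a) \<Rightarrow> 'a set \<Rightarrow> ('a \<Rightarrow> 'a) \<Rightarrow> bool" where
  "orth_proj_on J K P \<longleftrightarrow> clinear_on J K P \<and> (\<forall>x\<in>K. P (P x) = P x) \<and>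
     (\<forall>x\<in>K. \<forall>y\<in>K. cinner J (P x) y = cinner J x (P y))"

definition semigroup_on :: "('a::real_inner \<Rightarrow> 'a) \<Rightarrow> 'a set \<Rightarrow> (real \<Rightarrow> 'a \<Rightarrow> 'a) \<Rightarrow> bool" where
  "semigroup_on J K V \<longleftrightarrow>
     (\<forall>t\<ge>0. clinear_on J K (V t) \<and> (\<forall>x\<in>K. norm (V t x) \<le> norm x)) \<and>
     (\<forall>x\<in>K. V 0 x = x) \<and>
     (\<forall>s\<ge>0. \<forall>t\<ge>0. \<forall>x\<in>K. V (s + t) x = V s (V t x)) \<and>
     (\<forall>x\<in>K. continuous_on {0..} (\<lambda>t. V t x))"

definition n_isometric_semigroup ::
  "('a::real_inner \<Rightarrow> 'a) \<Rightarrow> 'a set \<Rightarrow> nat \<Rightarrow> (nat \<Rightarrow> real \<Rightarrow> 'a \<Rightarrow> 'a) \<Rightarrow> bool" where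
  "n_isometric_semigroup J K n V \<longleftrightarrow>
     (\<forall>j<n. semigroup_on J K (V j) \<and> (\<forall>t\<ge>0. isometry_on J K (V j t))) \<and>
     (\<forall>i<n. \<forall>j<n. \<forall>t\<ge>0. \<forall>x\<in>K. V i t (V j t x) = V j t (V i t x))"

definition n_unitary_semigroup ::
  "('a::real_inner \<Rightarrow> 'a) \<Rightarrow> 'a set \<Rightarrow> nat \<Rightarrow> (nat \<Rightarrow> real \<Rightarrow> 'a \<Rightarrow> 'a) \<Rightarrow> bool" where
  "n_unitary_semigroup J K n V \<longleftrightarrow>
     n_isometric_semigroup J K n V \<and> (\<forall>j<n. \<forall>t\<ge>0. unitary_on J K (V j t))"

text \<open>M (a closed complex subspace of K) reduces T (an operator on K) iff both M and
  K \<ominus> M are invariant under T (Halmos' definition).\<close>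
definition reduces :: "('a::real_inner \<Rightarrow> 'a) \<Rightarrow> 'a set \<Rightarrow> 'a set \<Rightarrow> ('a \<Rightarrow> 'a) \<Rightarrow> bool" where
  "reduces J K M T \<longleftrightarrow> T ` M \<subseteq> M \<and> T ` (ocompl J K M) \<subseteq> ocompl J K M"

definition jointly_reducing ::
  "('a::real_inner \<Rightarrow> 'a) \<Rightarrow> 'a set \<Rightarrow> nat \<Rightarrow> (nat \<Rightarrow> real \<Rightarrow> 'a \<Rightarrow> 'a) \<Rightarrow> 'a set \<Rightarrow> bool" where
  "jointly_reducing J K n V M \<longleftrightarrow> csubspace J M \<and> M \<subseteq> K \<and>
     (\<forall>j<n. \<forall>t\<ge>0. reduces J K M (V j t))"

text \<open>Completely non-unitary n-isometric semigroup on K.  Restriction to M is expressed by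
  regarding the same maps as operators on M.\<close>
definition cnu ::
  "('a::real_inner \<Rightarrow> 'a) \<Rightarrow> 'a set \<Rightarrow> nat \<Rightarrow> (nat \<Rightarrow> real \<Rightarrow> 'a \<Rightarrow> 'a) \<Rightarrow> bool" where
  "cnu J K n V \<longleftrightarrow> n_isometric_semigroup J K n V \<and>
     \<not> (\<exists>M. M \<noteq> {0} \<and> jointly_reducing J K n V M \<and>
            (\<forall>j<n. semigroup_on J M (V j) \<and> (\<forall>t\<ge>0. unitary_on J M (V j t))))"

primrec Uprod :: "(nat \<Rightarrow> 'a \<Rightarrow> 'a) \<Rightarrow> nat \<Rightarrow> 'a \<Rightarrow> 'a" where
  "Uprod U 0 = id"
| "Uprod U (Suc k) = U k \<circ> Uprod U k"

text \<open>Adjoint of a unitary on E = its inverse on E.\<close>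
definition uadj :: "'a set \<Rightarrow> ('a \<Rightarrow> 'a) \<Rightarrow> 'a \<Rightarrow> 'a" where
  "uadj E U = inv_into E U"

definition BCL_triple ::
  "('a::real_inner \<Rightarrow> 'a) \<Rightarrow> nat \<Rightarrow> 'a set \<Rightarrow> (nat \<Rightarrow> 'a \<Rightarrow> 'a) \<Rightarrow> (nat \<Rightarrow> 'a \<Rightarrow> 'a) \<Rightarrow> bool" where
  "BCL_triple J n E P U \<longleftrightarrow> csubspace J E \<and>
     (\<forall>j<n. orth_proj_on J E (P j)) \<and> (\<forall>j<n. unitary_on J E (U j)) \<and>
     (\<forall>i<n. \<forall>j<n. \<forall>x\<in>E. U i (U j x) = U j (U i x)) \<and>
     (\<forall>x\<in>E. Uprod U n x = x) \<and>
     (\<forall>i<n. \<forall>j<n. i \<noteq> j \<longrightarrow>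
        (\<forall>x\<in>E. P j x + uadj E (U j) (P i (U j x)) = P i x + uadj E (U i) (P j (U i x))) \<and>
        (\<forall>x\<in>E. Re (cinner J (P j x + uadj E (U j) (P i (U j x))) x) \<le> Re (cinner J x x))) \<and>
     (\<forall>x\<in>E. (\<Sum>j<n. uadj E (Uprod U j) (P j (Uprod U j x))) = x)"

definition BCL_no_fixed ::
  "nat \<Rightarrow> 'a::real_vector set \<Rightarrow> (nat \<Rightarrow> 'a \<Rightarrow> 'a) \<Rightarrow> (nat \<Rightarrow> 'a \<Rightarrow> 'a) \<Rightarrow> bool" where
  "BCL_no_fixed n E P U \<longleftrightarrow> (\<forall>j<n. \<forall>x\<in>E. P j x = 0 \<and> U j x = x \<longrightarrow> x = 0)"

definition cholo_on :: "('a::real_normed_vector \<Rightarrow> 'a) \<Rightarrow> (complex \<Rightarrow> 'a) \<Rightarrow> complex set \<Rightarrow> bool" where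
  "cholo_on J f S \<longleftrightarrow> (\<forall>z\<in>S. \<exists>v. (f has_derivative (\<lambda>h. cscale J h v)) (at z))"

definition h2mean :: "(complex \<Rightarrow> 'a::real_normed_vector) \<Rightarrow> real \<Rightarrow> real" where
  "h2mean f r = integral {0..2*pi} (\<lambda>\<theta>. (norm (f (complex_of_real r * cis \<theta>)))\<^sup>2) / (2*pi)"

text \<open>H^2_D(E): E-valued holomorphic functions on the unit disc with bounded integral means;
  elements are normalised to be 0 outside the open disc.\<close>
definition H2 :: "('a::real_inner \<Rightarrow> 'a) \<Rightarrow> 'a set \<Rightarrow> (complex \<Rightarrow> 'a) set" where
  "H2 J E = {f. (\<forall>z. 1 \<le> cmod z \<longrightarrow> f z = 0) \<and> (\<forall>z. cmod z < 1 \<longrightarrow> f z \<in> E) \<and>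
               cholo_on J f (ball 0 1) \<and> bdd_above (h2mean f ` {0<..<1})}"

definition H2norm :: "(complex \<Rightarrow> 'a::real_normed_vector) \<Rightarrow> real" where
  "H2norm f = sqrt (Sup (h2mean f ` {0<..<1}))"

definition phi :: "real \<Rightarrow> complex \<Rightarrow> complex" where
  "phi t w = exp (complex_of_real t * ((w + 1) / (w - 1)))"

definition phi_coeff :: "real \<Rightarrow> nat \<Rightarrow> complex" where
  "phi_coeff t k = (deriv ^^ k) (phi t) 0 / fact k"

text \<open>H^\<infinity> functional calculus phi_t(T) for a contraction T:
  the strong limit as r \<rightarrow> 1- of phi_t(rT) = \<Sum>_k c_k r^k T^k.\<close>
definition phi_calc :: "('a::real_normed_vector \<Rightarrow> 'a) \<Rightarrow> real \<Rightarrow> ('a \<Rightarrow> 'a) \<Rightarrow> 'a \<Rightarrow> 'a" where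
  "phi_calc J t T x =
     Lim (at_left (1::real)) (\<lambda>r. \<Sum>k. cscale J (phi_coeff t k * complex_of_real r ^ k) ((T ^^ k) x))"

definition pi_op :: "('a::real_vector \<Rightarrow> 'a) \<Rightarrow> ('a \<Rightarrow> 'a) \<Rightarrow> ('a \<Rightarrow> 'a) \<Rightarrow> complex \<Rightarrow> 'a \<Rightarrow> 'a" where
  "pi_op J P U z x = U ((x - P x) + cscale J z (P x))"

definition model_op ::
  "('a::real_normed_vector \<Rightarrow> 'a) \<Rightarrow> ('a \<Rightarrow> 'a) \<Rightarrow> ('a \<Rightarrow> 'a) \<Rightarrow> real \<Rightarrow> (complex \<Rightarrow> 'a) \<Rightarrow> complex \<Rightarrow> 'a" where
  "model_op J P U t f z = (if cmod z < 1 then phi_calc J t (pi_op J P U z) (f z) else 0)"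

definition unitary_onto_H2 :: "('a::real_inner \<Rightarrow> 'a) \<Rightarrow> 'a set \<Rightarrow> ('a \<Rightarrow> complex \<Rightarrow> 'a) \<Rightarrow> bool" where
  "unitary_onto_H2 J E \<Lambda> \<longleftrightarrow> bij_betw \<Lambda> UNIV (H2 J E) \<and>
     (\<forall>x y z. \<Lambda> (x + y) z = \<Lambda> x z + \<Lambda> y z) \<and>
     (\<forall>c x z. \<Lambda> (cscale J c x) z = cscale J c (\<Lambda> x z)) \<and>
     (\<forall>x. H2norm (\<Lambda> x) = norm x)"

definition unitarily_equiv_model ::
  "('a::real_inner \<Rightarrow> 'a) \<Rightarrow> nat \<Rightarrow> (nat \<Rightarrow> real \<Rightarrow> 'a \<Rightarrow> 'a) \<Rightarrow> bool" where
  "unitarily_equiv_model J n V \<longleftrightarrow>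
     (\<exists>E P U \<Lambda>. BCL_triple J n E P U \<and> BCL_no_fixed n E P U \<and> unitary_onto_H2 J E \<Lambda> \<and>
        (\<forall>j<n. \<forall>t\<ge>0. \<forall>x. \<Lambda> (V j t x) = model_op J (P j) (U j) t (\<Lambda> x)))"

end

theory Submission
  imports Defs "HOL-Complex_Analysis.Complex_Analysis" "HOL-Real_Asymp.Real_Asymp"
begin

text \<open>
  The product of the semigroups is again an isometric semigroup \<open>T\<^sub>t\<close>, and the intersection of the
  ranges of the \<open>T\<^sub>t\<close> is the largest subspace that every \<open>V\<^sub>j\<^sub>,\<^sub>t\<close> maps onto itself; this gives the
  decomposition.  For the model, each \<open>V\<^sub>j\<close> has an isometric cogenerator \<open>W\<^sub>j\<close> without eigenvalue 1, and
  \<open>V\<^sub>j\<^sub>,\<^sub>t\<close> is the strong limit of \<open>phi t (r W\<^sub>j)\<close> as \<open>r\<close> tends to 1 from below, by an energy estimate for the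
  differential equation satisfied by \<open>phi t (r W\<^sub>j)\<close>.  The intersection of the ranges of the powers of
  \<open>W = W\<^sub>1 \<dots> W\<^sub>n\<close> reduces the tuple to a unitary one, so \<open>W\<close> is pure in the c.n.u. case.  Hence \<open>W\<close> is
  unitarily equivalent to multiplication by \<open>z\<close> on the Hardy space over the wandering space \<open>E\<close> of \<open>W\<close>, and
  every factor \<open>X\<close> of \<open>W\<close> becomes multiplication by a linear pencil \<open>A + z B\<close>, from which the
  B-C-L triple is read off.
\<close>

section \<open>Hilbert space preliminaries\<close>

text \<open>In general \<open>W\<close> is not the cogenerator of the product semigroup, so the
  ranges of its powers must be tied to the \<open>V j t\<close> separately: if every cogenerator
  maps a closed subspace K onto itself, so does every \<open>V j t\<close>. Surjectivity is not
  stable under strong limits; what helps is that the approximants are normal on K, so that their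
  adjoints converge strongly too.

  The pencil of a factor \<open>X\<close> with \<open>W = X X'\<close> is linear because
  \<open>hadj W\<close> after \<open>X\<close> equals \<open>hadj X'\<close>, which preserves the
  kernel E of \<open>hadj W\<close>; so \<open>X\<close> maps E into E + W E. The B-C-L identities
  come from multiplying pencils: as long as the product operator still divides \<open>W\<close>, the
  product pencil is again linear, so its quadratic coefficient vanishes. The values at z = 1 give
  multiplicative unitaries, and the slopes give a cocycle identity for the projections whose
  telescoped sum ends at the projection of \<open>W\<close> itself, the identity of E. A fixed
  vector of U_j orthogonal to the range of P_j would be a fixed vector of the cogenerator, which has
  none.\<close>

lemma norm_diff_scaleR_sq:
  fixes u y :: "'a::real_inner"
  shows "(norm (u - s *\<^sub>R y))\<^sup>2 = (norm u)\<^sup>2 - 2 * (s * (u \<bullet> y)) + s\<^sup>2 * (y \<bullet> y)"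
proof -
  have "(u - s *\<^sub>R y) \<bullet> (u - s *\<^sub>R y) = u \<bullet> u - s * (u \<bullet> y) - (s * (u \<bullet> y) - s * (s * (y \<bullet> y)))"
    by (simp only: inner_diff_left inner_diff_right inner_scaleR_left inner_scaleR_right inner_commute[of y u] right_diff_distrib)
  then show ?thesis
    unfolding power2_norm_eq_inner by (simp add: power2_eq_square mult.assoc)
qed

text \<open>The parallelogram law, applied to the midpoint of two members of a minimising sequence,
  makes the sequence Cauchy. Moving its limit along a direction \<open>y\<close> of the subspace
  cannot decrease the distance, which forces orthogonality.\<close>

lemma orthogonal_projection_exists:
  fixes M :: "'a::{real_inner,complete_space} set"
  assumes "subspace M" "closed M"
  obtains p where "p \<in> M" "\<And>m. m \<in> M \<Longrightarrow> (x - p) \<bullet> m = 0"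
proof -
  define D where "D = (\<lambda>m. (norm (x - m))\<^sup>2) ` M"
  define d where "d = Inf D"
  have ne: "D \<noteq> {}" using subspace_0[OF assms(1)] by (auto simp: D_def)
  have bdd: "bdd_below D" by (auto simp: D_def intro!: bdd_belowI[of _ 0])
  have low: "d \<le> (norm (x - m))\<^sup>2" if "m \<in> M" for m
    unfolding d_def using bdd that by (intro cInf_lower) (auto simp: D_def)
  have "\<exists>m\<in>M. (norm (x - m))\<^sup>2 < d + 1 / Suc n" for n
  proof -
    have "Inf D < d + 1 / Suc n" by (simp add: d_def)
    then show ?thesis using cInf_lessD[OF ne] by (auto simp: D_def)
  qed
  then obtain m where m: "\<And>n. m n \<in> M" and md: "\<And>n. (norm (x - m n))\<^sup>2 < d + 1 / Suc n"
    by metis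
  have par: "(norm (m i - m k))\<^sup>2 \<le> 2 / Suc i + 2 / Suc k" for i k
  proof -
    have "(1/2) *\<^sub>R (m i + m k) \<in> M"
      using m assms(1) by (intro subspace_scale subspace_add)
    then have "d \<le> (norm (x - (1/2) *\<^sub>R (m i + m k)))\<^sup>2" by (rule low)
    moreover have "(norm (m i - m k))\<^sup>2 + 4 * (norm (x - (1/2) *\<^sub>R (m i + m k)))\<^sup>2
        = 2 * (norm (x - m i))\<^sup>2 + 2 * (norm (x - m k))\<^sup>2"
      unfolding power2_norm_eq_inner by (simp add: inner_simps inner_commute field_simps)
    ultimately show ?thesis using md[of i] md[of k] by simp
  qed
  have "Cauchy m"
  proof (rule metric_CauchyI)
    fix e :: real assume e: "e > 0"
    obtain N where N: "4 / e\<^sup>2 < real N" using reals_Archimedean2 by blast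
    have "dist (m i) (m k) < e" if "i \<ge> N" "k \<ge> N" for i k
    proof -
      have N0: "real N > 0" using less_trans[OF _ N, of 0] e by simp
      have "2 / Suc i \<le> 2 / N" "2 / Suc k \<le> 2 / N"
        using that N0 by (auto intro!: divide_left_mono)
      then have "(norm (m i - m k))\<^sup>2 \<le> 4 / N" using par[of i k] by simp
      also have "\<dots> < e\<^sup>2" using N N0 e by (simp add: field_simps)
      finally show ?thesis using e by (simp add: dist_norm power2_less_imp_less)
    qed
    then show "\<exists>N. \<forall>i\<ge>N. \<forall>k\<ge>N. dist (m i) (m k) < e" by blast
  qed
  then obtain p where p: "m \<longlonglongrightarrow> p" using Cauchy_convergent convergent_def by blast
  have pM: "p \<in> M" using closed_sequentially[OF assms(2) _ p] m by blast
  have "(\<lambda>n. (norm (x - m n))\<^sup>2) \<longlonglongrightarrow> (norm (x - p))\<^sup>2" by (intro tendsto_intros p)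
  moreover have "(\<lambda>n. d + 1 / Suc n) \<longlonglongrightarrow> d + 0"
    by (intro tendsto_intros LIMSEQ_inverse_real_of_nat[unfolded inverse_eq_divide])
  ultimately have pd: "(norm (x - p))\<^sup>2 \<le> d"
    using md by (intro LIMSEQ_le[of "\<lambda>n. (norm (x - m n))\<^sup>2" _ "\<lambda>n. d + 1 / Suc n"]) (auto intro: less_imp_le)
  have "(x - p) \<bullet> y = 0" if y: "y \<in> M" for y
  proof (cases "y = 0")
    case False
    \<comment> \<open>The minimiser in \<open>s\<close> of
      \<open>(norm ((x - p) - s *\<^sub>R y))\<^sup>2\<close>; its value there lies below
      \<open>(norm (x - p))\<^sup>2\<close> unless the inner product vanishes.\<close>
    define s where "s = ((x - p) \<bullet> y) / (y \<bullet> y)"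
    have "p + s *\<^sub>R y \<in> M" using y pM assms(1) by (intro subspace_add subspace_scale)
    then have "(norm (x - p))\<^sup>2 \<le> (norm (x - (p + s *\<^sub>R y)))\<^sup>2"
      using low[of "p + s *\<^sub>R y"] pd by linarith
    also have "x - (p + s *\<^sub>R y) = (x - p) - s *\<^sub>R y" by simp
    also have "(norm ((x - p) - s *\<^sub>R y))\<^sup>2 = (norm (x - p))\<^sup>2 - 2 * (s * ((x - p) \<bullet> y)) + s\<^sup>2 * (y \<bullet> y)"
      by (rule norm_diff_scaleR_sq)
    also have "\<dots> = (norm (x - p))\<^sup>2 - ((x - p) \<bullet> y)\<^sup>2 / (y \<bullet> y)"
      using False by (simp add: s_def power2_eq_square)
    finally have "((x - p) \<bullet> y)\<^sup>2 / (y \<bullet> y) \<le> 0" by simp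
    moreover have "y \<bullet> y > 0" using False by simp
    ultimately have "((x - p) \<bullet> y)\<^sup>2 \<le> 0" by (simp add: divide_le_0_iff)
    then show ?thesis by simp
  qed simp
  with pM show ?thesis using that by blast
qed

lemma riesz_representation:
  fixes f :: "'a::{real_inner,complete_space} \<Rightarrow> real"
  assumes "bounded_linear f"
  obtains v where "\<And>x. f x = v \<bullet> x"
proof (cases "\<forall>x. f x = 0")
  case True
  then show ?thesis using that[of 0] by simp
next
  case False
  interpret f: bounded_linear f by fact
  define M where "M = {x. f x = 0}"
  have sM: "subspace M" by (auto simp: M_def subspace_def f.add f.scaleR f.zero)
  have cM: "closed M" unfolding M_def
    by (intro closed_Collect_eq continuous_intros f.continuous_on)
  obtain x0 where x0: "f x0 \<noteq> 0" using False by blast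
  obtain p where p: "p \<in> M" "\<And>m. m \<in> M \<Longrightarrow> (x0 - p) \<bullet> m = 0"
    using orthogonal_projection_exists[OF sM cM] by metis
  define z where "z = x0 - p"
  have fz: "f z \<noteq> 0" using x0 p(1) by (simp add: z_def f.diff M_def)
  then have zz: "z \<bullet> z \<noteq> 0" using f.zero by force
  have "f x = ((f z / (z \<bullet> z)) *\<^sub>R z) \<bullet> x" for x
  proof -
    have "x - (f x / f z) *\<^sub>R z \<in> M" using fz by (simp add: M_def f.diff f.scaleR)
    then have "z \<bullet> (x - (f x / f z) *\<^sub>R z) = 0" using p(2) by (simp add: z_def)
    then have "z \<bullet> x = (f x / f z) * (z \<bullet> z)" by (simp add: inner_simps)
    then show ?thesis using fz zz by (simp add: field_simps)
  qed
  then show ?thesis using that by blast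
qed

text \<open>The adjoint for the real inner product. For an operator commuting with \<open>J\<close>
  it is also the adjoint for \<open>cinner\<close>, because it commutes with \<open>J\<close> again
  (\<open>clin_hadj\<close>).\<close>

definition hadj :: "('a::real_inner \<Rightarrow> 'a) \<Rightarrow> 'a \<Rightarrow> 'a" where
  "hadj T y = (SOME z. \<forall>x. T x \<bullet> y = x \<bullet> z)"

lemma hadj_inner:
  fixes T :: "'a::{real_inner,complete_space} \<Rightarrow> 'a"
  assumes "bounded_linear T"
  shows "x \<bullet> hadj T y = T x \<bullet> y"
proof -
  have "bounded_linear (\<lambda>x. T x \<bullet> y)"
    using bounded_linear_compose[OF bounded_linear_inner_left assms] by simp
  then obtain v where "\<And>x. T x \<bullet> y = v \<bullet> x" by (rule riesz_representation) blast
  then have "\<exists>z. \<forall>x. T x \<bullet> y = x \<bullet> z" by (metis inner_commute)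
  from someI_ex[OF this] show ?thesis unfolding hadj_def by metis
qed

lemma hadj_inner':
  fixes T :: "'a::{real_inner,complete_space} \<Rightarrow> 'a"
  assumes "bounded_linear T"
  shows "hadj T y \<bullet> x = y \<bullet> T x"
  using hadj_inner[OF assms, of x y] by (simp add: inner_commute)

lemma inner_ext:
  assumes "\<And>v. v \<bullet> x = v \<bullet> (y::'a::real_inner)"
  shows "x = y"
proof -
  have "(x - y) \<bullet> (x - y) = 0" using assms[of "x - y"] by (simp add: inner_diff_right)
  then show ?thesis by simp
qed

lemma hadj_unique:
  fixes T :: "'a::{real_inner,complete_space} \<Rightarrow> 'a"
  assumes "bounded_linear T" "\<And>x. T x \<bullet> y = x \<bullet> z"
  shows "hadj T y = z"
  by (rule inner_ext) (simp add: hadj_inner assms)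

lemma hadj_bounded_linear:
  fixes T :: "'a::{real_inner,complete_space} \<Rightarrow> 'a"
  assumes "bounded_linear T"
  shows "bounded_linear (hadj T)"
proof -
  obtain K where K: "\<And>x. norm (T x) \<le> norm x * K" "K \<ge> 0"
    using bounded_linear.nonneg_bounded[OF assms] by blast
  show ?thesis
  proof (rule bounded_linear_intro)
    show "hadj T (x + y) = hadj T x + hadj T y" for x y
      by (intro hadj_unique assms) (simp add: inner_simps hadj_inner assms)
    show "hadj T (c *\<^sub>R x) = c *\<^sub>R hadj T x" for c x
      by (intro hadj_unique assms) (simp add: inner_simps hadj_inner assms)
    show "norm (hadj T y) \<le> norm y * K" for y
    proof (cases "hadj T y = 0")
      case False
      have "norm (hadj T y) * norm (hadj T y) = T (hadj T y) \<bullet> y"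
        using hadj_inner[OF assms, of "hadj T y" y] by (simp add: power2_norm_eq_inner flip: power2_eq_square)
      also have "\<dots> \<le> norm (hadj T y) * K * norm y"
        using norm_cauchy_schwarz[of "T (hadj T y)" y] K(1)[of "hadj T y"]
        by (meson mult_right_mono norm_ge_zero order_trans)
      finally show ?thesis using False by (simp add: mult.commute mult.left_commute)
    qed (use K in auto)
  qed
qed

lemma isometry_inner:
  fixes T :: "'a::real_inner \<Rightarrow> 'b::real_inner"
  assumes "linear T" "\<And>x. norm (T x) = norm x"
  shows "T x \<bullet> T y = x \<bullet> y"
proof -
  have "(norm (T (x + y)))\<^sup>2 = (norm (x + y))\<^sup>2" using assms(2) by simp
  moreover have "T x \<bullet> T x = x \<bullet> x" "T y \<bullet> T y = y \<bullet> y"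
    using assms(2) by (metis power2_norm_eq_inner)+
  ultimately show ?thesis
    unfolding power2_norm_eq_inner linear_add[OF assms(1)] by (simp add: inner_simps inner_commute)
qed

section \<open>Absolutely convergent series and termwise differentiation\<close>

lemma summable_norm_cancel_complete:
  fixes f :: "nat \<Rightarrow> 'a::{real_normed_vector,complete_space}"
  assumes "summable (\<lambda>n. norm (f n))"
  shows "summable f"
proof -
  have "Cauchy (\<lambda>n. sum f {..<n})"
  proof (rule CauchyI')
    fix e :: real assume "e > 0"
    then obtain N where N: "\<And>m n. m \<ge> N \<Longrightarrow> norm (sum (\<lambda>n. norm (f n)) {m..<n}) < e"
      using assms unfolding summable_Cauchy by blast
    have "dist (sum f {..<m}) (sum f {..<n}) < e" if "N \<le> m" "m < n" for m n
    proof -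
      have "sum f {..<n} - sum f {..<m} = sum f {m..<n}"
        using that by (simp add: sum_diff_nat_ivl lessThan_atLeast0)
      then have "dist (sum f {..<n}) (sum f {..<m}) \<le> (\<Sum>k\<in>{m..<n}. norm (f k))"
        by (simp add: dist_norm norm_sum)
      also have "\<dots> < e" using N[OF that(1), of n] by (simp add: sum_nonneg)
      finally show ?thesis by (simp only: dist_commute)
    qed
    then show "\<exists>N. \<forall>m\<ge>N. \<forall>n>m. dist (sum f {..<m}) (sum f {..<n}) < e" by blast
  qed
  then show ?thesis by (simp add: Cauchy_convergent summable_iff_convergent)
qed

lemma norm_suminf_le_complete:
  fixes f :: "nat \<Rightarrow> 'a::{real_normed_vector,complete_space}"
  assumes "\<And>n. norm (f n) \<le> g n" "summable g"
  shows "summable f" "norm (suminf f) \<le> suminf g"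
proof -
  have "summable (\<lambda>n. norm (f n))"
    by (rule summable_comparison_test[OF _ assms(2)]) (use assms(1) in auto)
  then show s: "summable f" by (rule summable_norm_cancel_complete)
  have "(\<lambda>n. norm (sum f {..<n})) \<longlonglongrightarrow> norm (suminf f)"
    by (intro tendsto_norm summable_LIMSEQ s)
  moreover have "norm (sum f {..<n}) \<le> sum g {..<n}" for n
    using assms(1) by (intro order_trans[OF norm_sum] sum_mono)
  ultimately show "norm (suminf f) \<le> suminf g"
    by (intro LIMSEQ_le[OF _ summable_LIMSEQ[OF assms(2)]]) auto
qed

text \<open>A summable quadratic remainder takes the place of uniform convergence of the
  derivatives: the sum differs from its linear part by at most \<open>suminf M\<close> times the
  squared increment. It serves both for \<open>phi_op\<close> as a function of time and for power
  series as functions on the disc.\<close>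

lemma series_has_derivative_quadratic:
  fixes f :: "nat \<Rightarrow> 'b::real_normed_vector \<Rightarrow> 'a::{real_normed_vector,complete_space}"
  assumes xS: "x \<in> S" and sf: "\<And>y. y \<in> S \<Longrightarrow> dist y x < \<delta> \<Longrightarrow> summable (\<lambda>k. f k y)" and \<delta>: "\<delta> > 0"
    and sf': "\<And>h. summable (\<lambda>k. f' k h)" and bl: "bounded_linear (\<lambda>h. \<Sum>k. f' k h)"
    and rem: "\<And>k y. y \<in> S \<Longrightarrow> dist y x < \<delta> \<Longrightarrow> norm (f k y - f k x - f' k (y - x)) \<le> M k * (norm (y - x))\<^sup>2"
    and M: "summable M" and Mnn: "\<And>k. M k \<ge> 0"
  shows "((\<lambda>y. \<Sum>k. f k y) has_derivative (\<lambda>h. \<Sum>k. f' k h)) (at x within S)"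
proof -
  have key: "norm ((\<Sum>k. f k y) - (\<Sum>k. f k x) - (\<Sum>k. f' k (y - x))) \<le> suminf M * (norm (y - x))\<^sup>2"
    if y: "y \<in> S" "dist y x < \<delta>" for y
  proof -
    have "(\<Sum>k. f k y) - (\<Sum>k. f k x) - (\<Sum>k. f' k (y - x)) = (\<Sum>k. f k y - f k x - f' k (y - x))"
      using sf[OF y] sf[OF xS] \<delta> sf' by (simp add: suminf_diff summable_diff)
    also have "norm \<dots> \<le> (\<Sum>k. M k * (norm (y - x))\<^sup>2)"
      using rem[OF y] M by (intro norm_suminf_le_complete(2) summable_mult2)
    finally show ?thesis using suminf_mult2[OF M, of "(norm (y - x))\<^sup>2"] by simp
  qed
  have M0: "suminf M \<ge> 0" using M Mnn by (rule suminf_nonneg)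
  show ?thesis
    unfolding has_derivative_within_alt
  proof (intro conjI allI impI bl)
    fix e :: real assume e: "e > 0"
    define d where "d = min \<delta> (e / (suminf M + 1))"
    have "norm ((\<Sum>k. f k y) - (\<Sum>k. f k x) - (\<Sum>k. f' k (y - x))) \<le> e * norm (y - x)"
      if yS: "y \<in> S" and y: "norm (y - x) < d" for y
    proof -
      have "norm (y - x) * (suminf M + 1) \<le> e" using y M0 by (simp add: d_def field_simps)
      then have "norm (y - x) + suminf M * norm (y - x) \<le> e" by (simp add: algebra_simps)
      then have "suminf M * norm (y - x) \<le> e" using norm_ge_zero[of "y - x"] by linarith
      then have "suminf M * norm (y - x) * norm (y - x) \<le> e * norm (y - x)"
        by (rule mult_right_mono) simp
      then show ?thesis using key[OF yS] y by (simp add: d_def dist_norm power2_eq_square mult.assoc)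
    qed
    moreover have "d > 0" using \<delta> e M0 by (simp add: d_def add_nonneg_pos)
    ultimately show "\<exists>d>0. \<forall>y\<in>S. norm (y - x) < d \<longrightarrow>
        norm ((\<Sum>k. f k y) - (\<Sum>k. f k x) - (\<Sum>k. f' k (y - x))) \<le> e * norm (y - x)" by blast
  qed
qed

section \<open>Complex structures and isometries\<close>

locale chilbert =
  fixes J :: "'a::{real_inner,complete_space} \<Rightarrow> 'a"
  assumes complex_J: "complex_structure J"
begin

lemma J_bounded_linear: "bounded_linear J" and J_J [simp]: "J (J x) = - x"
  and norm_J [simp]: "norm (J x) = norm x"
  using complex_J by (auto simp: complex_structure_def)

lemma J_linear: "linear J" by (rule bounded_linear.linear[OF J_bounded_linear])

lemmas J_add = linear_add[OF J_linear] and J_diff = linear_diff[OF J_linear]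
  and J_neg = linear_neg[OF J_linear] and J_scaleR = linear_scale[OF J_linear]
  and J_0 [simp] = linear_0[OF J_linear] and J_sum = linear_sum[OF J_linear]

lemma J_inner_J [simp]: "J x \<bullet> J y = x \<bullet> y"
  by (rule isometry_inner[OF J_linear norm_J])

lemma J_inner: "J x \<bullet> y = - (x \<bullet> J y)"
  using J_inner_J[of x "J y"] by simp

lemma cscale_add_right: "cscale J c (x + y) = cscale J c x + cscale J c y"
  by (simp add: cscale_def J_add algebra_simps)

lemma cscale_add_left: "cscale J (a + b) x = cscale J a x + cscale J b x"
  by (simp add: cscale_def algebra_simps)

lemma cscale_cscale: "cscale J a (cscale J b x) = cscale J (a * b) x"
  by (simp add: cscale_def J_add J_scaleR algebra_simps)

lemma cscale_of_real: "cscale J (of_real r) x = r *\<^sub>R x"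
  by (simp add: cscale_def)

lemma cscale_1 [simp]: "cscale J 1 x = x" and cscale_0 [simp]: "cscale J 0 x = 0"
  and cscale_0_right [simp]: "cscale J c 0 = 0"
  by (simp_all add: cscale_def)

lemma cscale_i: "cscale J \<i> x = J x"
  by (simp add: cscale_def)

lemma norm_cscale: "norm (cscale J c x) = cmod c * norm x"
proof -
  have "(norm (cscale J c x))\<^sup>2 = ((Re c)\<^sup>2 + (Im c)\<^sup>2) * (x \<bullet> x)"
    unfolding power2_norm_eq_inner cscale_def
    by (simp add: inner_add_left inner_add_right J_inner power2_eq_square algebra_simps)
  also have "\<dots> = (cmod c * norm x)\<^sup>2"
    by (simp add: cmod_power2 power_mult_distrib power2_norm_eq_inner)
  finally show ?thesis by (simp add: power2_eq_iff_nonneg)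
qed

lemma cscale_bounded_linear: "bounded_linear (cscale J c)"
  by (rule bounded_linear_intro[of _ "cmod c"])
    (auto simp: cscale_add_right norm_cscale mult.commute, simp add: cscale_def J_scaleR algebra_simps)

lemma cscale_bounded_linear_left: "bounded_linear (\<lambda>c. cscale J c x)"
  by (rule bounded_linear_intro[of _ "norm x"])
    (auto simp: cscale_add_left norm_cscale, simp add: cscale_def algebra_simps)

lemma cscale_diff_left: "cscale J (a - b) x = cscale J a x - cscale J b x"
  by (rule linear_diff[OF bounded_linear.linear[OF cscale_bounded_linear_left]])

definition clin :: "('a \<Rightarrow> 'a) \<Rightarrow> bool" where
  "clin T \<longleftrightarrow> bounded_linear T \<and> (\<forall>x. T (J x) = J (T x))"

definition isom :: "('a \<Rightarrow> 'a) \<Rightarrow> bool" where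
  "isom T \<longleftrightarrow> clin T \<and> (\<forall>x. norm (T x) = norm x)"

lemma clin_bl: "clin T \<Longrightarrow> bounded_linear T" by (simp add: clin_def)
lemma clin_linear: "clin T \<Longrightarrow> linear T" by (simp add: clin_def bounded_linear.linear)
lemma clin_J: "clin T \<Longrightarrow> T (J x) = J (T x)" by (simp add: clin_def)
lemma clin_add: "clin T \<Longrightarrow> T (x + y) = T x + T y" by (rule linear_add[OF clin_linear])
lemma clin_diff: "clin T \<Longrightarrow> T (x - y) = T x - T y" by (rule linear_diff[OF clin_linear])
lemma clin_scaleR: "clin T \<Longrightarrow> T (c *\<^sub>R x) = c *\<^sub>R T x" by (rule linear_scale[OF clin_linear])
lemma clin_0: "clin T \<Longrightarrow> T 0 = 0" by (rule linear_0[OF clin_linear])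
lemma clin_sum: "clin T \<Longrightarrow> T (sum f A) = (\<Sum>i\<in>A. T (f i))" by (rule linear_sum[OF clin_linear])
lemma clin_cscale: "clin T \<Longrightarrow> T (cscale J c x) = cscale J c (T x)"
  by (simp add: cscale_def clin_add clin_scaleR clin_J)

lemma clin_id: "clin (\<lambda>x. x)" by (simp add: clin_def bounded_linear_ident)
lemma clin_compose: "clin S \<Longrightarrow> clin T \<Longrightarrow> clin (\<lambda>x. S (T x))"
  by (simp add: clin_def bounded_linear_compose)
lemma clin_plus: "clin S \<Longrightarrow> clin T \<Longrightarrow> clin (\<lambda>x. S x + T x)"
  by (simp add: clin_def bounded_linear_add J_add)
lemma clin_minus: "clin S \<Longrightarrow> clin T \<Longrightarrow> clin (\<lambda>x. S x - T x)"
  by (simp add: clin_def bounded_linear_sub J_diff)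
lemma clin_cscale_fun: "clin (cscale J c)"
  by (simp add: clin_def cscale_bounded_linear)
     (simp add: cscale_cscale mult.commute flip: cscale_i)

lemma clin_funpow: "clin T \<Longrightarrow> clin (T ^^ k)"
  by (induction k) (use clin_id in \<open>auto simp: o_def clin_compose id_def\<close>)

lemma isomI: "clin T \<Longrightarrow> (\<And>x. norm (T x) = norm x) \<Longrightarrow> isom T" by (simp add: isom_def)
lemma isom_clin: "isom T \<Longrightarrow> clin T" by (simp add: isom_def)
lemma isom_norm: "isom T \<Longrightarrow> norm (T x) = norm x" by (simp add: isom_def)
lemma isom_inner: "isom T \<Longrightarrow> T x \<bullet> T y = x \<bullet> y"
  by (rule isometry_inner) (auto simp: isom_def clin_linear)
lemma isom_id: "isom (\<lambda>x. x)" by (simp add: isom_def clin_id)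
lemma isom_compose: "isom S \<Longrightarrow> isom T \<Longrightarrow> isom (\<lambda>x. S (T x))"
  by (simp add: isom_def clin_compose)
lemma isom_inj: "isom T \<Longrightarrow> T x = T y \<Longrightarrow> x = y"
  using isom_norm[of T "x - y"] by (simp add: clin_diff isom_clin)
lemma isom_funpow: "isom T \<Longrightarrow> isom (T ^^ k)"
  by (induction k) (use isom_id in \<open>auto simp: o_def isom_compose id_def\<close>)

lemma clin_hadj:
  assumes "clin T" shows "clin (hadj T)"
  unfolding clin_def
proof (intro conjI allI)
  show "bounded_linear (hadj T)" by (rule hadj_bounded_linear[OF clin_bl[OF assms]])
  have "T x \<bullet> J y = x \<bullet> J (hadj T y)" for x y
  proof -
    have "T x \<bullet> J y = - (T (J x) \<bullet> y)" by (simp add: clin_J[OF assms] J_inner)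
    also have "\<dots> = - (J x \<bullet> hadj T y)" by (simp add: hadj_inner[OF clin_bl[OF assms]])
    finally show ?thesis by (simp add: J_inner)
  qed
  then show "hadj T (J x) = J (hadj T x)" for x
    by (intro hadj_unique[OF clin_bl[OF assms]])
qed

lemma hadj_isom: "isom T \<Longrightarrow> hadj T (T x) = x"
  by (intro hadj_unique clin_bl isom_clin isom_inner)

lemma hadj_compose:
  assumes "clin S" "clin T" shows "hadj (\<lambda>x. S (T x)) y = hadj T (hadj S y)"
  by (rule hadj_unique[OF clin_bl[OF clin_compose[OF assms]]])
    (simp add: hadj_inner clin_bl assms)

lemma norm_hadj_le:
  assumes "isom T" shows "norm (hadj T x) \<le> norm x"
proof -
  have "(norm (hadj T x))\<^sup>2 = T (hadj T x) \<bullet> x"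
    by (simp add: power2_norm_eq_inner hadj_inner clin_bl isom_clin assms)
  also have "\<dots> \<le> norm (hadj T x) * norm x"
    using norm_cauchy_schwarz[of "T (hadj T x)" x] by (simp add: isom_norm[OF assms])
  finally show ?thesis by (cases "hadj T x = 0") (auto simp: power2_eq_square)
qed

text \<open>Pythagoras: \<open>T (hadj T x)\<close> is the orthogonal projection of \<open>x\<close>
  onto the range of \<open>T\<close>.\<close>

lemma norm_sq_isom_split:
  assumes "isom T"
  shows "(norm (x - T (hadj T x)))\<^sup>2 = (norm x)\<^sup>2 - (norm (hadj T x))\<^sup>2"
proof -
  have a: "T (hadj T x) \<bullet> x = hadj T x \<bullet> hadj T x"
    by (simp add: hadj_inner clin_bl isom_clin assms)
  have b: "x \<bullet> T (hadj T x) = hadj T x \<bullet> hadj T x"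
    using a by (simp add: inner_commute)
  show ?thesis unfolding power2_norm_eq_inner
    by (simp only: inner_diff_left inner_diff_right isom_inner[OF assms] a b)
qed

lemma cinner_eq_0_iff: "cinner J x y = 0 \<longleftrightarrow> x \<bullet> y = 0 \<and> x \<bullet> J y = 0"
  by (simp add: cinner_def complex_eq_iff)

text \<open>The imaginary part of \<open>cinner J x y\<close> is the real product of
  \<open>x\<close> with \<open>J y\<close>, and \<open>J y\<close> stays in \<open>M\<close>; so
  real orthogonality to \<open>M\<close> already is complex orthogonality.\<close>

lemma ocompl_csubspace:
  assumes "csubspace J M"
  shows "ocompl J K M = {x\<in>K. \<forall>y\<in>M. x \<bullet> y = 0}"
  using assms by (auto simp: ocompl_def cinner_eq_0_iff csubspace_def)

lemma clinear_on_UNIV_clin: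
  assumes "clinear_on J UNIV T" "\<And>x. norm (T x) \<le> norm x"
  shows "clin T"
proof -
  have add: "T (x + y) = T x + T y" and cs: "T (cscale J c x) = cscale J c (T x)" for x y c
    using assms(1) by (auto simp: clinear_on_def)
  have "T (r *\<^sub>R x) = r *\<^sub>R T x" for r x using cs[of "of_real r"] by (simp add: cscale_of_real)
  then have "bounded_linear T" using add assms(2) by (intro bounded_linear_intro[of _ 1]) auto
  then show ?thesis using cs[of \<i>] by (simp add: clin_def cscale_i)
qed

lemma clin_clinear_on: "clin T \<Longrightarrow> (\<And>x. x \<in> K \<Longrightarrow> T x \<in> K) \<Longrightarrow> clinear_on J K T"
  by (simp add: clinear_on_def clin_add clin_cscale)

end

text \<open>The sort of the space does not include \<open>banach\<close>, so the integral is taken in the dual space, which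
  does have it, and pulled back by Riesz representation.\<close>

lemma continuous_antiderivative:
  fixes f :: "real \<Rightarrow> 'a::{real_inner,complete_space}"
  assumes "continuous_on {0..} f"
  obtains F where "F 0 = 0" "\<And>t. t \<ge> 0 \<Longrightarrow> (F has_vector_derivative f t) (at t within {0..})"
proof -
  define \<iota> :: "'a \<Rightarrow> 'a \<Rightarrow>\<^sub>L real" where "\<iota> = blinfun_inner_right"
  have \<iota>_bl: "bounded_linear \<iota>" unfolding \<iota>_def by (rule bounded_linear_blinfun_inner_right)
  have \<iota>_norm: "norm (\<iota> x) = norm x" for x
  proof (rule antisym)
    show "norm (\<iota> x) \<le> norm x"
      unfolding \<iota>_def by (rule norm_blinfun_bound) (auto simp: Cauchy_Schwarz_ineq2)
    have "norm x * norm x \<le> norm (\<iota> x) * norm x"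
      using norm_blinfun[of "\<iota> x" x]
      by (simp add: \<iota>_def power2_norm_eq_inner flip: power2_eq_square)
    then show "norm x \<le> norm (\<iota> x)" by (cases "x = 0") auto
  qed
  have \<iota>_surj: "\<exists>v. \<phi> = \<iota> v" for \<phi>
  proof -
    obtain v where "\<And>x. blinfun_apply \<phi> x = v \<bullet> x"
      using riesz_representation[OF blinfun.bounded_linear_right[of \<phi>]] by blast
    then have "\<phi> = \<iota> v" by (intro blinfun_eqI) (simp add: \<iota>_def)
    then show ?thesis by blast
  qed
  define G where "G = (\<lambda>t. integral {0..t} (\<lambda>s. \<iota> (f s)))"
  have cont: "continuous_on {0..b} (\<lambda>s. \<iota> (f s))" for b
    by (rule bounded_linear.continuous_on[OF \<iota>_bl], rule continuous_on_subset[OF assms]) auto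
  have G: "(G has_vector_derivative \<iota> (f t)) (at t within {0..})" if "t \<ge> 0" for t
  proof -
    have "(G has_vector_derivative \<iota> (f t)) (at t within {0..t+1})"
      unfolding G_def using that by (intro integral_has_vector_derivative cont) auto
    moreover have "at t within {0..t+1} = at t within {0..}"
      by (rule at_within_nhd[of _ "{..<t+1}"]) auto
    ultimately show ?thesis by simp
  qed
  obtain F where F: "\<And>t. G t = \<iota> (F t)" using choice[of "\<lambda>t v. G t = \<iota> v"] \<iota>_surj by blast
  have lin: "linear \<iota>" using \<iota>_bl by (rule bounded_linear.linear)
  \<comment> \<open>Since \<open>\<iota>\<close> is linear and isometric, the error term in the
    definition of the derivative has the same norm for \<open>G\<close> and for
    \<open>F\<close>.\<close>
  have "(F has_vector_derivative f t) (at t within {0..})" if "t \<ge> 0" for t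
    using G[OF that] unfolding has_vector_derivative_def has_derivative_within_alt
    by (auto simp: F \<iota>_norm bounded_linear_scaleR_left simp flip: linear_diff[OF lin] linear_scale[OF lin])
  moreover have "F 0 = 0" using \<iota>_norm[of "F 0"] F[of 0] by (simp add: G_def)
  ultimately show ?thesis using that by blast
qed

section \<open>Resolvent and cogenerator of an isometric semigroup\<close>

lemma subspace_closure:
  fixes S :: "'a::real_normed_vector set"
  assumes "subspace S" shows "subspace (closure S)"
proof (rule subspaceI)
  show "0 \<in> closure S" using subspace_0[OF assms] closure_subset by blast
  fix x y c assume x: "x \<in> closure S"
  obtain f where f: "\<And>n. f n \<in> S" "f \<longlonglongrightarrow> x" using x unfolding closure_sequential by blast
  show "c *\<^sub>R x \<in> closure S" unfolding closure_sequential
    by (rule exI[of _ "\<lambda>n. c *\<^sub>R f n"]) (intro conjI allI subspace_scale assms f tendsto_intros)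
  assume "y \<in> closure S"
  then obtain g where g: "\<And>n. g n \<in> S" "g \<longlonglongrightarrow> y" unfolding closure_sequential by blast
  show "x + y \<in> closure S" unfolding closure_sequential
    by (rule exI[of _ "\<lambda>n. f n + g n"]) (intro conjI allI subspace_add assms f g tendsto_intros)
qed

lemma zero_vector_derivative_imp_eq:
  fixes g :: "real \<Rightarrow> 'a::real_normed_vector"
  assumes "\<And>t. t \<ge> 0 \<Longrightarrow> (g has_vector_derivative 0) (at t within {0..})" and "b \<ge> 0"
  shows "g b = g 0"
proof -
  have "\<And>t. t \<in> {0..} \<Longrightarrow> (g has_derivative (\<lambda>h. 0)) (at t within {0..})"
    using assms(1) by (auto simp: has_vector_derivative_def)
  then obtain c where "\<And>t. t \<in> {0..} \<Longrightarrow> g t = c"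
    using has_derivative_zero_constant[of "{0..}" g] by auto
  then show ?thesis using assms(2) by simp
qed

locale isometric_semigroup = chilbert J for J :: "'a::{real_inner,complete_space} \<Rightarrow> 'a" +
  fixes V :: "real \<Rightarrow> 'a \<Rightarrow> 'a"
  assumes V_isom: "t \<ge> 0 \<Longrightarrow> isom (V t)"
    and V_0: "V 0 x = x"
    and V_add: "s \<ge> 0 \<Longrightarrow> t \<ge> 0 \<Longrightarrow> V (s + t) x = V s (V t x)"
    and V_cont: "continuous_on {0..} (\<lambda>t. V t x)"
begin

lemma V_clin: "t \<ge> 0 \<Longrightarrow> clin (V t)"
  using V_isom isom_clin by blast

text \<open>The resolvent \<open>(1 - A)\<inverse> y = \<integral> exp (- t) V\<^sub>t y dt\<close> of the generator \<open>A\<close> is characterised by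
  \<open>d/dt V\<^sub>t x = V\<^sub>t (x - y)\<close>; this makes linearity and commutation properties immediate.\<close>

definition is_resolv :: "'a \<Rightarrow> 'a \<Rightarrow> bool" where
  "is_resolv x y \<longleftrightarrow> (\<forall>t\<ge>0. ((\<lambda>s. V s x) has_vector_derivative (V t x - V t y)) (at t within {0..}))"

text \<open>Here \<open>F t\<close> is the integral of \<open>exp (- s) *\<^sub>R V s y\<close> from
  0 to \<open>t\<close>, and \<open>x\<close> is its limit at infinity. Both sides of
  \<open>shift\<close> have the same derivative in \<open>b\<close>; letting \<open>b\<close> tend
  to infinity gives \<open>V t x = exp t *\<^sub>R (x - F t)\<close>, whose right side can be
  differentiated without knowing the domain of the generator.\<close>

lemma is_resolv_exists: "\<exists>x. is_resolv x y"
proof -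
  have "continuous_on {0..} (\<lambda>s. exp (- s) *\<^sub>R V s y)"
    by (intro continuous_intros V_cont)
  then obtain F where F0: "F 0 = 0" and
    F: "\<And>t. t \<ge> 0 \<Longrightarrow> (F has_vector_derivative (exp (- t) *\<^sub>R V t y)) (at t within {0..})"
    using continuous_antiderivative by blast
  have bnd: "norm (F b - F a) \<le> exp (- a) * norm y" if ab: "0 \<le> a" "a < b" for a b
  proof -
    have "norm (F b - F a) \<le> (- exp (- b) * norm y) - (- exp (- a) * norm y)"
    proof (rule differentiable_bound_general[OF ab(2), where f' = "\<lambda>t. exp (- t) *\<^sub>R V t y"
          and \<phi>' = "\<lambda>t. exp (- t) * norm y"])
      have "continuous_on {0..} F"
        unfolding continuous_on_eq_continuous_within
        by (auto intro: has_vector_derivative_continuous F)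
      then show "continuous_on {a..b} F" by (rule continuous_on_subset) (use ab in auto)
      show "continuous_on {a..b} (\<lambda>t. - exp (- t) * norm y)" by (intro continuous_intros)
      fix t assume t: "a < t" "t < b"
      have "at t within {0..} = at t" by (rule at_within_interior) (use t ab in auto)
      then show "(F has_vector_derivative exp (- t) *\<^sub>R V t y) (at t)" using F[of t] t ab by simp
      show "((\<lambda>t. - exp (- t) * norm y) has_vector_derivative exp (- t) * norm y) (at t)"
        unfolding has_real_derivative_iff_has_vector_derivative[symmetric]
        by (auto intro!: derivative_eq_intros)
      show "norm (exp (- t) *\<^sub>R V t y) \<le> exp (- t) * norm y"
        using isom_norm[OF V_isom, of t y] t ab by simp
    qed
    moreover have "0 \<le> exp (- b) * norm y" by simp
    ultimately show ?thesis by linarith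
  qed
  have bnd': "norm (F b - F a) \<le> exp (- a) * norm y" if ab: "0 \<le> a" "a \<le> b" for a b
    using bnd[of a b] ab by (cases "a = b") auto
  have e0: "(\<lambda>n. exp (- real n) * norm y) \<longlonglongrightarrow> 0"
    by real_asymp
  have "Cauchy (\<lambda>n. F (real n))"
  proof (rule CauchyI')
    fix e :: real assume "e > 0"
    then obtain N where N: "\<And>n. n \<ge> N \<Longrightarrow> exp (- real n) * norm y < e"
      using order_tendstoD(2)[OF e0] unfolding eventually_sequentially by blast
    have "dist (F (real m)) (F (real n)) < e" if "m \<ge> N" "m < n" for m n
      using bnd[of m n] N[OF that(1)] that(2) by (simp add: dist_norm norm_minus_commute)
    then show "\<exists>N. \<forall>m\<ge>N. \<forall>n>m. dist (F (real m)) (F (real n)) < e" by blast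
  qed
  then obtain x where x: "(\<lambda>n. F (real n)) \<longlonglongrightarrow> x" using Cauchy_convergent convergent_def by blast
  have xt: "(\<lambda>n. F (t + real n)) \<longlonglongrightarrow> x" if "t \<ge> 0" for t
  proof -
    have "(\<lambda>n. F (t + real n) - F (real n)) \<longlonglongrightarrow> 0"
      by (rule Lim_null_comparison[OF _ e0]) (use that bnd' in auto)
    from tendsto_add[OF this x] show ?thesis by simp
  qed
  have shift: "V t (F b) = exp t *\<^sub>R (F (t + b) - F t)" if t: "t \<ge> 0" and b: "b \<ge> 0" for t b
  proof -
    define g where "g = (\<lambda>b. V t (F b) - exp t *\<^sub>R F (t + b))"
    have "(g has_vector_derivative 0) (at b within {0..})" if b: "b \<ge> 0" for b
    proof -
      have "((\<lambda>b. V t (F b)) has_vector_derivative V t (exp (- b) *\<^sub>R V b y)) (at b within {0..})"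
        by (rule bounded_linear.has_vector_derivative[OF clin_bl[OF V_clin[OF t]] F[OF b]])
      moreover have "((\<lambda>b. F (t + b)) has_vector_derivative exp (- (t + b)) *\<^sub>R V (t + b) y) (at b within {0..})"
      proof -
        have "(F has_vector_derivative exp (- (t + b)) *\<^sub>R V (t + b) y) (at (t + b) within (+) t ` {0..})"
          by (rule has_vector_derivative_within_subset[OF F]) (use t b in auto)
        moreover have "((+) t has_vector_derivative 1) (at b within {0..})"
          by (auto intro!: derivative_eq_intros)
        ultimately show ?thesis
          using vector_diff_chain_within[of "(+) t" 1 b "{0..}" F] by (simp add: o_def)
      qed
      ultimately have "(g has_vector_derivative V t (exp (- b) *\<^sub>R V b y)
          - exp t *\<^sub>R (exp (- (t + b)) *\<^sub>R V (t + b) y)) (at b within {0..})"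
        unfolding g_def by (auto intro!: derivative_eq_intros)
      moreover have "V t (exp (- b) *\<^sub>R V b y) = exp t *\<^sub>R (exp (- (t + b)) *\<^sub>R V (t + b) y)"
        by (simp add: clin_scaleR[OF V_clin[OF t]] V_add[OF t b] flip: exp_add)
      ultimately show ?thesis by simp
    qed
    then have "g b = g 0" using b by (rule zero_vector_derivative_imp_eq)
    then show ?thesis by (simp add: g_def F0 clin_0[OF V_clin[OF t]] algebra_simps)
  qed
  have Vx: "V t x = exp t *\<^sub>R (x - F t)" if t: "t \<ge> 0" for t
  proof -
    have "(\<lambda>n. V t (F (real n))) \<longlonglongrightarrow> V t x"
      by (rule bounded_linear.tendsto[OF clin_bl[OF V_clin[OF t]] x])
    moreover have "(\<lambda>n. exp t *\<^sub>R (F (t + real n) - F t)) \<longlonglongrightarrow> exp t *\<^sub>R (x - F t)"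
      by (intro tendsto_intros xt t)
    ultimately show ?thesis using shift[OF t] by (simp add: LIMSEQ_unique)
  qed
  have "((\<lambda>s. V s x) has_vector_derivative (V t x - V t y)) (at t within {0..})" if t: "t \<ge> 0" for t
  proof -
    have "((\<lambda>t. exp t *\<^sub>R (x - F t)) has_vector_derivative
        (exp t *\<^sub>R (x - F t) - V t y)) (at t within {0..})"
      by (rule derivative_eq_intros F t refl)+ (simp add: algebra_simps flip: exp_add)
    then have d: "((\<lambda>t. exp t *\<^sub>R (x - F t)) has_vector_derivative (V t x - V t y)) (at t within {0..})"
      by (simp only: Vx[OF t])
    show ?thesis
      by (rule has_vector_derivative_transform[OF _ _ d]) (simp_all add: t Vx)
  qed
  then show ?thesis unfolding is_resolv_def by blast
qed

lemma is_resolv_linear: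
  assumes "is_resolv x y" "is_resolv x' y'"
  shows "is_resolv (x + x') (y + y')" "is_resolv (x - x') (y - y')"
proof -
  have d: "((\<lambda>s. V s x) has_vector_derivative (V t x - V t y)) (at t within {0..})"
      "((\<lambda>s. V s x') has_vector_derivative (V t x' - V t y')) (at t within {0..})" if "t \<ge> 0" for t
    using assms that unfolding is_resolv_def by blast+
  show "is_resolv (x + x') (y + y')" unfolding is_resolv_def
  proof (intro allI impI)
    fix t :: real assume t: "t \<ge> 0"
    have eq: "V t (x + x') - V t (y + y') = (V t x - V t y) + (V t x' - V t y')"
      by (simp add: clin_add[OF V_clin[OF t]])
    show "((\<lambda>s. V s (x + x')) has_vector_derivative (V t (x + x') - V t (y + y'))) (at t within {0..})"
      unfolding eq
      by (rule has_vector_derivative_transform[OF _ _ has_vector_derivative_add[OF d[OF t]]])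
        (simp_all add: t clin_add[OF V_clin])
  qed
  show "is_resolv (x - x') (y - y')" unfolding is_resolv_def
  proof (intro allI impI)
    fix t :: real assume t: "t \<ge> 0"
    have eq: "V t (x - x') - V t (y - y') = (V t x - V t y) - (V t x' - V t y')"
      by (simp add: clin_diff[OF V_clin[OF t]])
    show "((\<lambda>s. V s (x - x')) has_vector_derivative (V t (x - x') - V t (y - y'))) (at t within {0..})"
      unfolding eq
      by (rule has_vector_derivative_transform[OF _ _ has_vector_derivative_diff[OF d[OF t]]])
        (simp_all add: t clin_diff[OF V_clin])
  qed
qed

lemma is_resolv_commute:
  assumes "is_resolv x y" "bounded_linear B" "\<And>t u. t \<ge> 0 \<Longrightarrow> B (V t u) = V t (B u)"
  shows "is_resolv (B x) (B y)"
  unfolding is_resolv_def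
proof (intro allI impI)
  fix t :: real assume t: "t \<ge> 0"
  have "((\<lambda>s. B (V s x)) has_vector_derivative B (V t x - V t y)) (at t within {0..})"
    using bounded_linear.has_vector_derivative[OF assms(2)] assms(1) t unfolding is_resolv_def by blast
  moreover have "B (V t x - V t y) = V t (B x) - V t (B y)"
    by (simp add: linear_diff[OF bounded_linear.linear[OF assms(2)]] assms(3) t)
  ultimately show "((\<lambda>s. V s (B x)) has_vector_derivative V t (B x) - V t (B y)) (at t within {0..})"
    using has_vector_derivative_transform[of t "{0..}" "\<lambda>s. V s (B x)" "\<lambda>s. B (V s x)"] assms(3) t by simp
qed

text \<open>The hypothesis makes \<open>exp (- t) *\<^sub>R V t x\<close> constant in
  \<open>t\<close>, while its norm is \<open>exp (- t) * norm x\<close> because \<open>V t\<close>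
  is isometric.\<close>

lemma is_resolv_0_iff:
  assumes "is_resolv x 0" shows "x = 0"
proof -
  define g where "g = (\<lambda>t. exp (- t) *\<^sub>R V t x)"
  have "(g has_vector_derivative 0) (at t within {0..})" if t: "t \<ge> 0" for t
  proof -
    have d: "((\<lambda>s. V s x) has_vector_derivative V t x) (at t within {0..})"
      using assms t unfolding is_resolv_def by (auto simp: clin_0[OF V_clin])
    show ?thesis unfolding g_def
      by (rule derivative_eq_intros d refl)+ simp
  qed
  then have "g 1 = g 0" by (rule zero_vector_derivative_imp_eq) simp_all
  then have "norm (exp (- 1) *\<^sub>R V 1 x) = norm x" by (simp add: g_def V_0)
  then have "exp (- 1) * norm x = norm x" by (simp add: isom_norm[OF V_isom])
  then show ?thesis by (cases "x = 0") auto
qed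

lemma is_resolv_unique: "is_resolv x y \<Longrightarrow> is_resolv x' y \<Longrightarrow> x = x'"
  using is_resolv_linear(2)[of x y x' y] is_resolv_0_iff[of "x - x'"] by simp

lemma is_resolv_eq_0:
  assumes "is_resolv 0 y" shows "y = 0"
proof -
  have "((\<lambda>s. V s 0) has_vector_derivative V 0 0 - V 0 y) (at 0 within {0..})"
    using assms unfolding is_resolv_def by blast
  then have "((\<lambda>s. 0) has_vector_derivative - y) (at 0 within {0..})"
    using has_vector_derivative_transform[of 0 "{0..}" "\<lambda>s. 0" "\<lambda>s. V s 0"]
    by (simp add: V_0 clin_0[OF V_clin])
  moreover have "((\<lambda>s::real. 0::'a) has_vector_derivative 0) (at 0 within {0..})" by simp
  moreover have "at (0::real) within {0..} \<noteq> bot"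
    by (simp add: at_within_Ici_at_right)
  ultimately have "- y = 0" using vector_derivative_unique_within by blast
  then show ?thesis by simp
qed

definition resolv :: "'a \<Rightarrow> 'a" where "resolv y = (THE x. is_resolv x y)"

lemma is_resolv_resolv: "is_resolv (resolv y) y"
  unfolding resolv_def using theI'[of "\<lambda>x. is_resolv x y"] is_resolv_exists is_resolv_unique by blast

lemma resolv_eqI: "is_resolv x y \<Longrightarrow> resolv y = x"
  using is_resolv_resolv is_resolv_unique by blast

lemma resolv_commute:
  assumes "bounded_linear B" "\<And>t u. t \<ge> 0 \<Longrightarrow> B (V t u) = V t (B u)"
  shows "resolv (B y) = B (resolv y)"
  by (rule resolv_eqI[OF is_resolv_commute[OF is_resolv_resolv assms]])

text \<open>\<open>(A + 1) (A - 1)\<inverse> = 1 - 2 (1 - A)\<inverse>\<close>\<close>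

definition cogen :: "'a \<Rightarrow> 'a" where "cogen y = y - 2 *\<^sub>R resolv y"

text \<open>The norm of \<open>V s (resolv y)\<close> is constant in \<open>s\<close>. Its squared
  norm has derivative 0 at 0, so \<open>resolv y\<close> is orthogonal to
  \<open>resolv y - y\<close>, and this is the equality of the norms of
  \<open>y - 2 *\<^sub>R resolv y\<close> and \<open>y\<close>.\<close>

lemma cogen_isom: "isom cogen"
proof (rule isomI)
  have add: "resolv (x + y) = resolv x + resolv y" for x y
    by (intro resolv_eqI is_resolv_linear is_resolv_resolv)
  have sc: "resolv (c *\<^sub>R x) = c *\<^sub>R resolv x" for c x
    by (rule resolv_commute) (auto simp: clin_scaleR[OF V_clin] bounded_linear_scaleR_right)
  have J: "resolv (J x) = J (resolv x)" for x
    by (rule resolv_commute[OF J_bounded_linear]) (simp add: clin_J V_clin)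
  show n: "norm (cogen y) = norm y" for y
  proof -
    have "((\<lambda>s. V s (resolv y)) has_vector_derivative (V 0 (resolv y) - V 0 y)) (at 0 within {0..})"
      using is_resolv_resolv[of y] unfolding is_resolv_def by blast
    then have "((\<lambda>s. V s (resolv y) \<bullet> V s (resolv y)) has_vector_derivative 2 * (resolv y \<bullet> (resolv y - y))) (at 0 within {0..})"
      unfolding has_vector_derivative_def
      by (auto intro!: derivative_eq_intros simp: V_0 inner_commute algebra_simps)
    moreover have "((\<lambda>s. V s (resolv y) \<bullet> V s (resolv y)) has_vector_derivative 0) (at 0 within {0..})"
      using has_vector_derivative_transform[of 0 "{0..}" "\<lambda>s. V s (resolv y) \<bullet> V s (resolv y)" "\<lambda>s. resolv y \<bullet> resolv y" 0]
      by (simp add: isom_inner[OF V_isom])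
    moreover have "at (0::real) within {0..} \<noteq> bot"
      by (simp add: at_within_Ici_at_right)
    ultimately have "resolv y \<bullet> (resolv y - y) = 0" using vector_derivative_unique_within by fastforce
    then have "(norm (cogen y))\<^sup>2 = (norm y)\<^sup>2"
      unfolding cogen_def norm_diff_scaleR_sq
      by (simp add: inner_diff_right inner_commute power2_norm_eq_inner)
    then show ?thesis by simp
  qed
  have "bounded_linear cogen"
    by (rule bounded_linear_intro[of _ 1]) (auto simp: n, auto simp: cogen_def add sc algebra_simps)
  then show "clin cogen" unfolding clin_def by (simp add: cogen_def J J_diff J_scaleR)
qed

lemma cogen_no_fixed: "cogen x = x \<Longrightarrow> x = 0"
  using is_resolv_resolv[of x] is_resolv_eq_0[of x] by (auto simp: cogen_def)

lemma cogen_commute: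
  assumes "clin B" "\<And>t u. t \<ge> 0 \<Longrightarrow> B (V t u) = V t (B u)"
  shows "cogen (B y) = B (cogen y)"
  using resolv_commute[OF clin_bl[OF assms(1)] assms(2)] assms(1)
  by (simp add: cogen_def clin_diff clin_scaleR)

text \<open>Let \<open>z\<close> be orthogonal to the range. Then \<open>z\<close> is orthogonal to
  \<open>resolv z\<close>, so the isometry of \<open>cogen\<close> leaves
  \<open>4 * (norm (resolv z))\<^sup>2 = 0\<close>, and \<open>resolv\<close> is injective.\<close>

lemma resolv_dense: "x \<in> closure (range resolv)"
proof -
  have sub: "subspace (range resolv)"
  proof -
    have "linear cogen" using cogen_isom isom_clin clin_linear by blast
    moreover have "resolv = (\<lambda>y. (1/2) *\<^sub>R (y - cogen y))" by (auto simp: cogen_def)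
    ultimately have "linear resolv"
      by (auto intro!: linear_compose_scale_right linear_compose_sub linear_ident)
    then show ?thesis by (rule linear_subspace_image[OF _ subspace_UNIV])
  qed
  then have "subspace (closure (range resolv))" by (rule subspace_closure)
  then obtain p where p: "p \<in> closure (range resolv)" "\<And>m. m \<in> closure (range resolv) \<Longrightarrow> (x - p) \<bullet> m = 0"
    using orthogonal_projection_exists closed_closure by metis
  define z where "z = x - p"
  have "z \<bullet> resolv z = 0" using p(2)[of "resolv z"] closure_subset[of "range resolv"] by (auto simp: z_def)
  moreover have "(norm (cogen z))\<^sup>2 = (norm z)\<^sup>2" using isom_norm[OF cogen_isom] by simp
  ultimately have "resolv z = 0" unfolding cogen_def norm_diff_scaleR_sq by simp
  then have "z = 0" using is_resolv_resolv[of z] is_resolv_eq_0 by simp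
  then show ?thesis using p(1) by (simp add: z_def)
qed

end

section \<open>Taylor coefficients of the singular inner function\<close>

text \<open>\<open>phi t w = exp (- t) exp (- 2 t w / (1 - w))\<close>, and \<open>phi_fps\<close> is the expansion of \<open>w / (1 - w)\<close>.\<close>

definition phi_fps :: "complex fps" where "phi_fps = fps_X * Abs_fps (\<lambda>_. 1)"

lemma phi_has_fps_expansion:
  "phi t has_fps_expansion
    (fps_const (exp (- complex_of_real t)) * (fps_exp (- 2 * complex_of_real t) oo phi_fps))"
proof -
  have eq: "phi_fps = fps_X * inverse (1 - fps_X)"
    using fps_inverse_idempotent[of "Abs_fps (\<lambda>_. 1::complex)"] by (simp add: phi_fps_def fps_inverse_gp')
  have g: "(\<lambda>w. w * inverse (1 - w)) has_fps_expansion phi_fps"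
    unfolding eq by (intro fps_expansion_intros) auto
  have "((\<lambda>w. exp (- 2 * complex_of_real t * w)) \<circ> (\<lambda>w. w * inverse (1 - w))) has_fps_expansion
      (fps_exp (- 2 * complex_of_real t) oo phi_fps)"
    by (intro has_fps_expansion_compose g fps_expansion_intros) (simp add: phi_fps_def)
  then have A: "(\<lambda>w. exp (- complex_of_real t) * exp (- 2 * complex_of_real t * (w * inverse (1 - w)))) has_fps_expansion
    (fps_const (exp (- complex_of_real t)) * (fps_exp (- 2 * complex_of_real t) oo phi_fps))"
    by (intro has_fps_expansion_mult fps_expansion_intros) (simp add: o_def)
  have B: "\<forall>\<^sub>F w in nhds 0. exp (- complex_of_real t) * exp (- 2 * complex_of_real t * (w * inverse (1 - w))) = phi t w"
  proof -
    have "\<forall>\<^sub>F w::complex in nhds 0. w \<in> - {1}" by (rule eventually_nhds_in_open) auto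
    then show ?thesis
    proof eventually_elim
      case (elim w)
      then have "(w + 1) / (w - 1) = - 1 - 2 * (w * inverse (1 - w))"
        by (simp add: field_simps)
      then have "complex_of_real t * ((w + 1) / (w - 1)) =
          - complex_of_real t + (- 2 * complex_of_real t * (w * inverse (1 - w)))"
        by (simp only:) (simp add: algebra_simps)
      then show ?case unfolding phi_def by (simp only: exp_add)
    qed
  qed
  show ?thesis by (rule iffD1[OF has_fps_expansion_cong[OF B refl] A])
qed

lemma phi_coeff_sum:
  "phi_coeff t k = of_real (exp (- t)) * (\<Sum>i=0..k. of_real ((- 2 * t) ^ i / fact i) * fps_nth (phi_fps ^ i) k)"
proof -
  have "phi_coeff t k = fps_nth (fps_const (exp (- complex_of_real t)) * (fps_exp (- 2 * complex_of_real t) oo phi_fps)) k"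
    unfolding phi_coeff_def by (rule fps_nth_fps_expansion[OF phi_has_fps_expansion, symmetric])
  moreover have "exp (- complex_of_real t) = of_real (exp (- t))" by (simp flip: exp_of_real)
  ultimately show ?thesis by (simp add: fps_compose_nth)
qed

text \<open>Multiplication by w / (1 - w) replaces a coefficient sequence by its strict partial
  sums. This is the origin of the partial sums in the time derivative of
  \<open>phi_coeff\<close>.\<close>

lemma phi_fps_power_Suc: "fps_nth (phi_fps ^ Suc i) k = (\<Sum>m<k. fps_nth (phi_fps ^ i) m)"
proof -
  have eq: "phi_fps ^ Suc i = fps_X * (phi_fps ^ i * Abs_fps (\<lambda>_. 1))"
    by (simp add: phi_fps_def mult_ac)
  show ?thesis unfolding eq fps_X_mult_nth
    by (cases k) (simp_all add: fps_mult_nth atLeast0AtMost lessThan_Suc_atMost)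
qed

lemma phi_fps_power_eq_0: "k < i \<Longrightarrow> fps_nth (phi_fps ^ i) k = 0"
proof (induction i arbitrary: k)
  case (Suc i)
  then show ?case unfolding phi_fps_power_Suc by (intro sum.neutral) auto
qed simp

text \<open>The coefficientwise form of d/dt phi = (w + 1)/(w - 1) phi, where (w + 1)/(w - 1) = -(1
  + 2w + 2w^2 + ...). By \<open>phi_coeff_sum\<close> each coefficient is \<open>exp (- t)\<close>
  times a polynomial in \<open>t\<close>, so only finite sums are differentiated.\<close>

lemma phi_coeff_has_vector_derivative:
  "((\<lambda>t. phi_coeff t k) has_vector_derivative - (phi_coeff t k + 2 * (\<Sum>m<k. phi_coeff t m))) (at t within S)"
proof -
  define \<beta> where "\<beta> i m = fps_nth (phi_fps ^ i) m" for i m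
  define q where "q i t = (- 2 * t) ^ i / fact i" for i and t :: real
  define q' where "q' i t = (if i = 0 then 0 else - 2 * q (i - 1) t)" for i t
  have q: "(q i has_real_derivative q' i t) (at t within S)" for i
  proof (cases i)
    case (Suc j)
    have "((\<lambda>t. (- 2 * t) ^ Suc j / fact (Suc j)) has_field_derivative - 2 * ((- 2 * t) ^ j / fact j)) (at t within S)"
      by (rule derivative_eq_intros refl | simp)+
    then show ?thesis
      unfolding q_def[abs_def] q'_def Suc by simp
  qed (simp add: q_def[abs_def] q'_def)
  have e: "((\<lambda>t. exp (- t)) has_real_derivative - exp (- t)) (at t within S)"
    by (auto intro!: derivative_eq_intros)
  have C: "phi_coeff t k = of_real (exp (- t)) * (\<Sum>i=0..k. of_real (q i t) * \<beta> i k)" for t k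
    unfolding q_def \<beta>_def by (rule phi_coeff_sum)
  have d: "((\<lambda>t. of_real (exp (- t)) * (\<Sum>i=0..k. of_real (q i t) * \<beta> i k)) has_vector_derivative
      (of_real (exp (- t)) * (\<Sum>i=0..k. of_real (q' i t) * \<beta> i k) + of_real (- exp (- t)) * (\<Sum>i=0..k. of_real (q i t) * \<beta> i k)))
      (at t within S)"
    by (intro has_vector_derivative_mult has_vector_derivative_sum has_vector_derivative_mult_left
        has_vector_derivative_of_real e q)
  have "(\<Sum>i=0..k. of_real (q' i t) * \<beta> i k) = (\<Sum>i=1..k. of_real (- 2 * q (i - 1) t) * \<beta> i k)"
    by (simp add: sum.atLeast_Suc_atMost q'_def)
  also have "\<dots> = (\<Sum>i<k. of_real (- 2 * q i t) * \<beta> (Suc i) k)"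
    using sum.shift_bounds_cl_Suc_ivl[of "\<lambda>i. of_real (- 2 * q (i - 1) t) * \<beta> i k" 0]
    by (cases k) (simp_all add: sum.shift_bounds_cl_Suc_ivl atLeast0AtMost lessThan_Suc_atMost del: sum.cl_ivl_Suc)
  also have "\<dots> = (\<Sum>i<k. \<Sum>m<k. of_real (- 2 * q i t) * \<beta> i m)"
    by (simp add: \<beta>_def phi_fps_power_Suc sum_distrib_left del: power_Suc)
  also have "\<dots> = (\<Sum>m<k. \<Sum>i<k. of_real (- 2 * q i t) * \<beta> i m)" by (rule sum.swap)
  \<comment> \<open>The series \<open>phi_fps ^ i\<close> starts at order \<open>i\<close>, so the
    terms with \<open>i > m\<close> vanish and the inner sum becomes the one in
    \<open>phi_coeff_sum\<close>.\<close>
  also have "\<dots> = (\<Sum>m<k. \<Sum>i=0..m. of_real (- 2 * q i t) * \<beta> i m)"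
  proof (rule sum.cong[OF refl])
    fix m assume "m \<in> {..<k}"
    then show "(\<Sum>i<k. of_real (- 2 * q i t) * \<beta> i m) = (\<Sum>i=0..m. of_real (- 2 * q i t) * \<beta> i m)"
      by (intro sum.mono_neutral_right) (auto simp: \<beta>_def phi_fps_power_eq_0)
  qed
  also have "of_real (exp (- t)) * \<dots> = - 2 * (\<Sum>m<k. phi_coeff t m)"
    unfolding C by (simp add: sum_distrib_left mult_ac sum_negf)
  finally have "of_real (exp (- t)) * (\<Sum>i=0..k. of_real (q' i t) * \<beta> i k) = - 2 * (\<Sum>m<k. phi_coeff t m)" .
  then have eq: "of_real (exp (- t)) * (\<Sum>i=0..k. of_real (q' i t) * \<beta> i k)
      + of_real (- exp (- t)) * (\<Sum>i=0..k. of_real (q i t) * \<beta> i k) =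
      - (phi_coeff t k + 2 * (\<Sum>m<k. phi_coeff t m))"
    by (simp add: C[of t k])
  show ?thesis using d[unfolded eq] unfolding C[symmetric] .
qed

lemma phi_coeff_0: "phi_coeff 0 k = (if k = 0 then 1 else 0)"
proof -
  have "phi_coeff 0 k = (\<Sum>i=0..k. (if i = 0 then fps_nth (phi_fps ^ i) k else 0))"
  proof -
    have "of_real ((- 2 * 0) ^ i / fact i) * b = (if i = 0 then b else 0)" for i and b :: complex
      by (cases i) auto
    then show ?thesis unfolding phi_coeff_sum by (simp only:) simp
  qed
  also have "\<dots> = fps_nth (phi_fps ^ 0) k" by (subst sum.delta) auto
  finally show ?thesis by simp
qed

text \<open>The map w to (w + 1)/(w - 1) sends the disc into the left half plane, where the
  exponential is bounded by 1.\<close>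

lemma norm_phi_le_1:
  assumes "t \<ge> 0" "cmod w < 1" shows "cmod (phi t w) \<le> 1"
proof -
  have "Re ((w + 1) / (w - 1)) = ((cmod w)\<^sup>2 - 1) / (cmod (w - 1))\<^sup>2"
    unfolding Re_divide cmod_power2 by (simp add: power2_eq_square algebra_simps)
  also have "\<dots> \<le> 0" using assms(2) by (simp add: divide_le_0_iff power_le_one)
  finally have "t * Re ((w + 1) / (w - 1)) \<le> 0"
    using assms(1) by (intro mult_nonneg_nonpos)
  then have "Re (complex_of_real t * ((w + 1) / (w - 1))) \<le> 0"
    unfolding times_complex.sel by simp
  then show ?thesis unfolding phi_def norm_exp_eq_Re by simp
qed

text \<open>\<open>phi t\<close> has an essential singularity at 1 for positive \<open>t\<close>, so
  Cauchy's inequality is used on circles of radius \<open>\<rho>\<close> below 1 and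
  \<open>\<rho>\<close> tends to 1 afterwards.\<close>

lemma norm_phi_coeff_le_1:
  assumes "t \<ge> 0" shows "cmod (phi_coeff t k) \<le> 1"
proof -
  have bound: "cmod (phi_coeff t k) * \<rho> ^ k \<le> 1" if \<rho>: "0 < \<rho>" "\<rho> < 1" for \<rho>
  proof -
    have hol: "phi t holomorphic_on cball 0 \<rho>"
      unfolding phi_def[abs_def] using \<rho> by (intro holomorphic_intros) auto
    have "cmod ((deriv ^^ k) (phi t) 0) \<le> fact k * 1 / \<rho> ^ k"
      by (rule Cauchy_inequality)
        (use \<rho> assms norm_phi_le_1 hol in \<open>auto intro: holomorphic_on_imp_continuous_on holomorphic_on_subset\<close>)
    then show ?thesis using \<rho> by (simp add: phi_coeff_def norm_divide field_simps)
  qed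
  have "((\<lambda>\<rho>. cmod (phi_coeff t k) * \<rho> ^ k) \<longlongrightarrow> cmod (phi_coeff t k) * 1 ^ k) (at_left 1)"
    by (intro tendsto_intros)
  moreover have "\<forall>\<^sub>F \<rho> in at_left 1. cmod (phi_coeff t k) * \<rho> ^ k \<le> 1"
    by (rule eventually_mono[OF eventually_at_left_real[of 0]]) (auto intro: bound)
  ultimately show ?thesis using tendsto_upperbound[of _ "cmod (phi_coeff t k) * 1 ^ k" "at_left (1::real)" 1] by simp
qed

section \<open>The functional calculus recovers the semigroup from its cogenerator\<close>

lemma real_derivative_upper_bound:
  fixes g :: "real \<Rightarrow> real"
  assumes "\<And>t. t \<ge> 0 \<Longrightarrow> (g has_real_derivative g' t) (at t within {0..})"
    and "\<And>t. t \<ge> 0 \<Longrightarrow> g' t \<le> C" and "t \<ge> 0"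
  shows "g t \<le> g 0 + C * t"
proof (cases "t = 0")
  case False
  have "(\<lambda>s. g s - C * s) t \<le> (\<lambda>s. g s - C * s) 0"
  proof (rule DERIV_nonpos_imp_decreasing_open[of 0 t "\<lambda>s. g s - C * s"])
    show "0 \<le> t" by fact
    show "\<exists>y. ((\<lambda>s. g s - C * s) has_real_derivative y) (at s) \<and> y \<le> 0" if "0 < s" "s < t" for s
    proof -
      have "at s within {0..} = at s" by (rule at_within_interior) (use that in auto)
      then have "(g has_real_derivative g' s) (at s)" using assms(1)[of s] that by simp
      then have "((\<lambda>s. g s - C * s) has_real_derivative g' s - C) (at s)"
        by (auto intro!: derivative_eq_intros)
      then show ?thesis using assms(2)[of s] that by (intro exI[of _ "g' s - C"]) auto
    qed
    have "continuous_on {0..} g"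
      unfolding continuous_on_eq_continuous_within by (auto intro: DERIV_continuous assms(1))
    then have "continuous_on {0..t} g" by (rule continuous_on_subset) auto
    then show "continuous_on {0..t} (\<lambda>s. g s - C * s)" by (intro continuous_intros)
  qed
  then show ?thesis by simp
qed simp

lemma vector_derivative_norm_bound:
  fixes f :: "real \<Rightarrow> 'b::real_normed_vector"
  assumes "\<And>x. x \<in> S \<Longrightarrow> (f has_vector_derivative f' x) (at x within S)" "convex S"
    and "\<And>x. x \<in> S \<Longrightarrow> norm (f' x) \<le> B" and "x \<in> S" "y \<in> S"
  shows "norm (f x - f y) \<le> B * \<bar>x - y\<bar>"
proof -
  have "norm (f x - f y) \<le> B * norm (x - y)"
  proof (rule differentiable_bound[OF assms(2) _ _ assms(4,5)])
    show "(f has_derivative (\<lambda>h. h *\<^sub>R f' u)) (at u within S)" if "u \<in> S" for u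
      using assms(1)[OF that] by (simp add: has_vector_derivative_def)
    show "onorm (\<lambda>h. h *\<^sub>R f' u) \<le> B" if "u \<in> S" for u
    proof (rule onorm_le)
      fix h :: real
      have "norm (f' u) * \<bar>h\<bar> \<le> B * \<bar>h\<bar>" by (rule mult_right_mono[OF assms(3)[OF that]]) simp
      then show "norm (h *\<^sub>R f' u) \<le> B * norm h" by (simp add: mult.commute)
    qed
  qed
  then show ?thesis by simp
qed

text \<open>The time derivative of \<open>phi_coeff\<close>.\<close>

definition phi_coeff' :: "real \<Rightarrow> nat \<Rightarrow> complex" where
  "phi_coeff' t k = - (phi_coeff t k + 2 * (\<Sum>m<k. phi_coeff t m))"

text \<open>Stated for an arbitrary sequence because it is applied both to the coefficients and to
  their differences at two times.\<close>

lemma norm_phi_coeff'_combination: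
  assumes "\<And>m. m \<le> k \<Longrightarrow> cmod (a m) \<le> B"
  shows "cmod (- (a k + 2 * (\<Sum>m<k. a m))) \<le> (2 * real k + 1) * B"
proof -
  have "cmod (\<Sum>m<k. a m) \<le> (\<Sum>m<k. B)"
    by (rule order_trans[OF norm_sum]) (intro sum_mono assms, auto)
  moreover have "cmod (a k) \<le> B" using assms by simp
  moreover have "cmod (a k + 2 * (\<Sum>m<k. a m)) \<le> cmod (a k) + 2 * cmod (\<Sum>m<k. a m)"
    using norm_triangle_ineq[of "a k" "2 * (\<Sum>m<k. a m)"] by (simp add: norm_mult)
  ultimately show ?thesis unfolding norm_minus_cancel by (simp add: algebra_simps)
qed

lemma norm_phi_coeff'_le: "t \<ge> 0 \<Longrightarrow> cmod (phi_coeff' t k) \<le> 2 * real k + 1"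
  unfolding phi_coeff'_def
  using norm_phi_coeff'_combination[of k "phi_coeff t" 1] norm_phi_coeff_le_1 by simp

text \<open>The coefficients up to index \<open>k\<close> are Lipschitz in time with constant
  \<open>2 * real k + 1\<close>. The derivative of the \<open>k\<close>-th one is a combination of
  them, hence Lipschitz with the square of that constant, and the mean value inequality gives the
  remainder. Growth that is polynomial in \<open>k\<close> remains summable against
  \<open>r ^ k\<close>.\<close>

lemma phi_coeff_remainder:
  assumes s: "s \<ge> 0" and t: "t \<ge> 0"
  shows "cmod (phi_coeff s k - phi_coeff t k - (s - t) *\<^sub>R phi_coeff' t k) \<le> (2 * real k + 1)\<^sup>2 * (s - t)\<^sup>2"
proof -
  have lip: "cmod (phi_coeff u m - phi_coeff t m) \<le> (2 * real k + 1) * \<bar>u - t\<bar>"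
    if "u \<ge> 0" "m \<le> k" for u m
  proof (rule vector_derivative_norm_bound)
    show "((\<lambda>u. phi_coeff u m) has_vector_derivative phi_coeff' u m) (at u within {0..})" for u
      unfolding phi_coeff'_def by (rule phi_coeff_has_vector_derivative)
    show "cmod (phi_coeff' u m) \<le> 2 * real k + 1" if "u \<in> {0..}" for u
      using norm_phi_coeff'_le[of u m] that \<open>m \<le> k\<close> by simp
  qed (use that t in auto)
  define g where "g u = phi_coeff u k - (u - t) *\<^sub>R phi_coeff' t k" for u
  let ?I = "closed_segment t s"
  have I: "u \<ge> 0" "\<bar>u - t\<bar> \<le> \<bar>s - t\<bar>" if "u \<in> ?I" for u
    using that s t by (auto simp: closed_segment_eq_real_ivl split: if_splits)
  have "norm (g s - g t) \<le> ((2 * real k + 1) * ((2 * real k + 1) * \<bar>s - t\<bar>)) * \<bar>s - t\<bar>"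
  proof (rule vector_derivative_norm_bound[of ?I g "\<lambda>u. phi_coeff' u k - phi_coeff' t k"])
    show "(g has_vector_derivative phi_coeff' u k - phi_coeff' t k) (at u within ?I)" for u
      unfolding g_def
      by (rule derivative_eq_intros phi_coeff_has_vector_derivative refl)+ (simp add: phi_coeff'_def)
    show "norm (phi_coeff' u k - phi_coeff' t k) \<le> (2 * real k + 1) * ((2 * real k + 1) * \<bar>s - t\<bar>)"
      if u: "u \<in> ?I" for u
    proof -
      have "cmod (phi_coeff u m - phi_coeff t m) \<le> (2 * real k + 1) * \<bar>s - t\<bar>" if "m \<le> k" for m
        using lip[OF I(1)[OF u] that] I(2)[OF u]
        by (smt (verit) mult_left_mono of_nat_0_le_iff)
      from norm_phi_coeff'_combination[of k "\<lambda>m. phi_coeff u m - phi_coeff t m", OF this]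
      show ?thesis by (simp add: phi_coeff'_def sum_subtractf algebra_simps)
    qed
  qed auto
  moreover have "g s - g t = phi_coeff s k - phi_coeff t k - (s - t) *\<^sub>R phi_coeff' t k"
    by (simp add: g_def)
  moreover have "(2 * real k + 1) * ((2 * real k + 1) * \<bar>s - t\<bar>) * \<bar>s - t\<bar> = (2 * real k + 1)\<^sup>2 * \<bar>s - t\<bar>\<^sup>2"
    by (simp only: power2_eq_square mult_ac)
  ultimately show ?thesis by (simp only: power2_abs)
qed

text \<open>Differentiating the geometric series twice produces the coefficients
  \<open>(n + 1) * (n + 2)\<close>; four times these dominate the given ones.\<close>

lemma summable_sq_power:
  assumes "0 \<le> r" "r < (1::real)" shows "summable (\<lambda>k. (2 * real k + 1)\<^sup>2 * r ^ k)"
proof -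
  have 1: "summable (\<lambda>n. (\<lambda>_. 1) n * x ^ n)" if "norm x < 1" for x :: real
    using that by (simp add: summable_geometric)
  have 2: "summable (\<lambda>n. diffs (\<lambda>_. 1) n * x ^ n)" if "norm x < 1" for x :: real
    by (rule termdiff_converges[OF that 1])
  have "summable (\<lambda>n. diffs (diffs (\<lambda>_. 1)) n * r ^ n)"
    by (rule termdiff_converges[of _ 1, OF _ 2]) (use assms in auto)
  from summable_mult[OF this, of 4] show ?thesis
  proof (rule summable_comparison_test[rotated], intro exI allI impI)
    fix n :: nat
    have "(2 * real n + 1)\<^sup>2 \<le> 4 * (real (Suc n) * real (Suc (Suc n)))"
      by (simp add: power2_eq_square algebra_simps)
    then have "(2 * real n + 1)\<^sup>2 * r ^ n \<le> 4 * (real (Suc n) * real (Suc (Suc n))) * r ^ n"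
      using assms by (intro mult_right_mono) auto
    then show "norm ((2 * real n + 1)\<^sup>2 * r ^ n) \<le> 4 * (diffs (diffs (\<lambda>_. 1)) n * r ^ n)"
      using assms by (simp add: diffs_def mult_ac)
  qed
qed

section \<open>Absolutely convergent power series in an isometry\<close>

context chilbert
begin

definition op_ser :: "('a \<Rightarrow> 'a) \<Rightarrow> (nat \<Rightarrow> complex) \<Rightarrow> 'a \<Rightarrow> 'a" where
  "op_ser W a x = (\<Sum>k. cscale J (a k) ((W ^^ k) x))"

context
  fixes W :: "'a \<Rightarrow> 'a"
  assumes W: "isom W"
begin

lemma norm_op_ser_term: "norm (cscale J (a k) ((W ^^ k) x)) = cmod (a k) * norm x"
  by (simp add: norm_cscale isom_norm[OF isom_funpow[OF W]])

lemma op_ser_summable: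
  assumes "summable (\<lambda>k. cmod (a k))" shows "summable (\<lambda>k. cscale J (a k) ((W ^^ k) x))"
  by (rule summable_norm_cancel_complete) (simp add: norm_op_ser_term summable_mult2 assms)

lemma op_ser_clin:
  assumes a: "summable (\<lambda>k. cmod (a k))" shows "clin (op_ser W a)"
proof -
  have tm: "clin (\<lambda>x. cscale J (a k) ((W ^^ k) x))" for k
    by (intro clin_compose[OF clin_cscale_fun clin_funpow] isom_clin W)
  have "bounded_linear (op_ser W a)"
  proof (rule bounded_linear_intro)
    show "op_ser W a (x + y) = op_ser W a x + op_ser W a y" for x y
      unfolding op_ser_def by (simp add: clin_add[OF tm] suminf_add op_ser_summable a)
    show "op_ser W a (c *\<^sub>R x) = c *\<^sub>R op_ser W a x" for c x
      unfolding op_ser_def clin_scaleR[OF tm] by (intro suminf_scaleR_right[symmetric] op_ser_summable a)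
    show "norm (op_ser W a x) \<le> norm x * (\<Sum>k. cmod (a k))" for x
      unfolding op_ser_def
      using norm_suminf_le_complete(2)[of "\<lambda>k. cscale J (a k) ((W ^^ k) x)" "\<lambda>k. cmod (a k) * norm x"]
      by (simp add: norm_op_ser_term summable_mult2 a flip: suminf_mult2[OF a]) (simp add: mult.commute)
  qed
  moreover have "op_ser W a (J x) = J (op_ser W a x)" for x
    unfolding op_ser_def clin_J[OF tm]
    by (rule bounded_linear.suminf[OF J_bounded_linear op_ser_summable[OF a], symmetric])
  ultimately show ?thesis by (simp add: clin_def)
qed

lemma op_ser_apply_clin:
  assumes a: "summable (\<lambda>k. cmod (a k))" and B: "clin B"
  shows "B (op_ser W a x) = (\<Sum>k. cscale J (a k) (B ((W ^^ k) x)))"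
  unfolding op_ser_def
  using bounded_linear.suminf[OF clin_bl[OF B] op_ser_summable[OF a, of x]]
  by (simp add: clin_cscale[OF B])

lemma op_ser_commute:
  assumes a: "summable (\<lambda>k. cmod (a k))" and B: "clin B" and BW: "\<And>x. B (W x) = W (B x)"
  shows "B (op_ser W a x) = op_ser W a (B x)"
proof -
  have "B ((W ^^ k) x) = (W ^^ k) (B x)" for k by (induction k) (auto simp: BW)
  then show ?thesis using op_ser_apply_clin[OF a B, of x] by (simp add: op_ser_def)
qed

lemma op_ser_shift:
  assumes a: "summable (\<lambda>k. cmod (a k))"
  shows "cscale J c (W (op_ser W a x)) = op_ser W (\<lambda>k. if k = 0 then 0 else c * a (k - 1)) x"
proof -
  define f where "f k = cscale J (if k = 0 then 0 else c * a (k - 1)) ((W ^^ k) x)" for k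
  have B: "clin (\<lambda>y. cscale J c (W y))" by (rule clin_compose[OF clin_cscale_fun isom_clin[OF W]])
  have fS: "f (Suc k) = cscale J (a k) (cscale J c (W ((W ^^ k) x)))" for k
    by (simp add: f_def cscale_cscale mult.commute)
  have "summable (\<lambda>k. cscale J (a k) (cscale J c (W ((W ^^ k) x))))"
    using bounded_linear.summable[OF clin_bl[OF B] op_ser_summable[OF a, of x]]
    by (simp add: clin_cscale[OF B])
  then have s: "summable f" unfolding fS[symmetric] summable_Suc_iff .
  have "cscale J c (W (op_ser W a x)) = (\<Sum>k. f (Suc k))"
    unfolding fS by (rule op_ser_apply_clin[OF a B])
  also have "\<dots> = suminf f - f 0" by (rule suminf_split_head[OF s])
  finally have "cscale J c (W (op_ser W a x)) = suminf f - f 0" .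
  moreover have "f 0 = 0" by (simp add: f_def)
  ultimately have "cscale J c (W (op_ser W a x)) = suminf f" by simp
  then show ?thesis unfolding f_def[abs_def] op_ser_def .
qed

lemma op_ser_add:
  assumes "summable (\<lambda>k. cmod (a k))" "summable (\<lambda>k. cmod (b k))"
  shows "op_ser W a x + op_ser W b x = op_ser W (\<lambda>k. a k + b k) x"
    "op_ser W a x - op_ser W b x = op_ser W (\<lambda>k. a k - b k) x"
  unfolding op_ser_def cscale_add_left cscale_diff_left
  by (intro suminf_add suminf_diff op_ser_summable assms)+

definition phi_op :: "real \<Rightarrow> real \<Rightarrow> 'a \<Rightarrow> 'a" where
  "phi_op r t = op_ser W (\<lambda>k. phi_coeff t k * of_real r ^ k)"

context
  fixes r :: real assumes r: "0 \<le> r" "r < 1"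
begin

lemma phi_coeff_summable:
  assumes "t \<ge> 0"
  shows "summable (\<lambda>k. cmod (phi_coeff t k * of_real r ^ k))"
    "summable (\<lambda>k. cmod (phi_coeff' t k * of_real r ^ k))"
proof -
  have b: "cmod (c * of_real r ^ k) \<le> (2 * real k + 1)\<^sup>2 * r ^ k" if "cmod c \<le> 2 * real k + 1" for c k
  proof -
    have "2 * real k + 1 \<le> (2 * real k + 1)\<^sup>2" by (rule self_le_power) auto
    with that have "cmod c \<le> (2 * real k + 1)\<^sup>2" by linarith
    then show ?thesis using r by (simp add: norm_mult norm_power mult_right_mono)
  qed
  have "cmod (phi_coeff t k) \<le> 2 * real k + 1" for k
    using norm_phi_coeff_le_1[OF assms, of k] by simp
  then show "summable (\<lambda>k. cmod (phi_coeff t k * of_real r ^ k))"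
    by (intro summable_comparison_test[OF _ summable_sq_power[OF r]]) (auto intro!: b)
  show "summable (\<lambda>k. cmod (phi_coeff' t k * of_real r ^ k))"
    using norm_phi_coeff'_le[OF assms]
    by (intro summable_comparison_test[OF _ summable_sq_power[OF r]]) (auto intro!: b)
qed

lemma phi_op_clin: "t \<ge> 0 \<Longrightarrow> clin (phi_op r t)"
  unfolding phi_op_def by (intro op_ser_clin phi_coeff_summable)

lemma phi_op_has_derivative:
  assumes t: "t \<ge> 0"
  shows "((\<lambda>t. phi_op r t x) has_vector_derivative
    op_ser W (\<lambda>k. phi_coeff' t k * of_real r ^ k) x) (at t within {0..})"
proof -
  let ?f' = "\<lambda>k h. h *\<^sub>R cscale J (phi_coeff' t k * of_real r ^ k) ((W ^^ k) x)"
  have s: "summable (\<lambda>k. cscale J (phi_coeff' t k * of_real r ^ k) ((W ^^ k) x))"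
    by (intro op_ser_summable phi_coeff_summable t)
  have eq: "(\<Sum>k. ?f' k h) = h *\<^sub>R op_ser W (\<lambda>k. phi_coeff' t k * of_real r ^ k) x" for h
    unfolding op_ser_def by (rule suminf_scaleR_right[OF s, symmetric])
  have "((\<lambda>t. \<Sum>k. cscale J (phi_coeff t k * of_real r ^ k) ((W ^^ k) x)) has_derivative (\<lambda>h. \<Sum>k. ?f' k h))
      (at t within {0..})"
  \<comment> \<open>The remainder bound holds for all nonnegative times, so the radius 1 is an
    arbitrary choice.\<close>
  proof (rule series_has_derivative_quadratic[where \<delta> = 1])
    show "bounded_linear (\<lambda>h. \<Sum>k. ?f' k h)" unfolding eq by (rule bounded_linear_scaleR_left)
    show "summable (\<lambda>k. ?f' k h)" for h by (intro summable_scaleR_right s)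
    show "summable (\<lambda>k. (2 * real k + 1)\<^sup>2 * r ^ k * norm x)"
      by (intro summable_mult2 summable_sq_power r)
    show "summable (\<lambda>k. cscale J (phi_coeff u k * of_real r ^ k) ((W ^^ k) x))" if "u \<in> {0..}" for u
      using that by (intro op_ser_summable phi_coeff_summable) auto
    fix k u assume u: "u \<in> {0::real..}"
    have "cscale J (phi_coeff u k * of_real r ^ k) ((W ^^ k) x) - cscale J (phi_coeff t k * of_real r ^ k) ((W ^^ k) x)
        - ?f' k (u - t) = cscale J ((phi_coeff u k - phi_coeff t k - (u - t) *\<^sub>R phi_coeff' t k) * of_real r ^ k) ((W ^^ k) x)"
      by (simp add: left_diff_distrib cscale_diff_left scaleR_conv_of_real cscale_of_real scaleR_diff_left flip: cscale_cscale mult.assoc)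
    then show "norm (cscale J (phi_coeff u k * of_real r ^ k) ((W ^^ k) x) - cscale J (phi_coeff t k * of_real r ^ k) ((W ^^ k) x)
        - ?f' k (u - t)) \<le> (2 * real k + 1)\<^sup>2 * r ^ k * norm x * (norm (u - t))\<^sup>2"
      using mult_right_mono[OF phi_coeff_remainder[of u t k], of "r ^ k * norm x"] u t r
      by (simp add: norm_cscale isom_norm[OF isom_funpow[OF W]] norm_mult norm_power mult_ac)
  qed (use t r in auto)
  then show ?thesis unfolding has_vector_derivative_def eq phi_op_def op_ser_def .
qed

text \<open>The differential equation \<open>u' = (r W + 1) (r W - 1)\<inverse> u\<close> without the inverse.  Since \<open>r W\<close> is a contraction,
  it gives \<open>\<parallel>u' + u\<parallel> \<le> \<parallel>u' - u\<parallel>\<close>, that is, \<open>u \<bullet> u' \<le> 0\<close>.\<close>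

lemma phi_op_cayley:
  fixes x :: 'a
  assumes t: "t \<ge> 0"
  defines "D \<equiv> op_ser W (\<lambda>k. phi_coeff' t k * of_real r ^ k) x"
  shows "D + phi_op r t x = r *\<^sub>R W (D - phi_op r t x)"
proof -
  let ?c = "\<lambda>k. phi_coeff t k * of_real r ^ k" and ?c' = "\<lambda>k. phi_coeff' t k * of_real r ^ k"
  note s = phi_coeff_summable[OF t]
  have sd: "summable (\<lambda>k. cmod (?c' k - ?c k))"
    by (rule summable_comparison_test[OF _ summable_add[OF s]]) (auto intro!: exI order_trans[OF norm_triangle_ineq4])
  have "r *\<^sub>R W (D - phi_op r t x) = cscale J (of_real r) (W (op_ser W (\<lambda>k. ?c' k - ?c k) x))"
    unfolding D_def phi_op_def by (simp add: op_ser_add(2) s cscale_of_real)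
  also have "\<dots> = op_ser W (\<lambda>k. if k = 0 then 0 else of_real r * (?c' (k - 1) - ?c (k - 1))) x"
    by (rule op_ser_shift[OF sd])
  \<comment> \<open>Up to the factor \<open>r ^ k\<close>, both sides are -2 times the sum of
    \<open>phi_coeff t m\<close> over \<open>m < k\<close>: on the left the extra term
    \<open>- 2 * phi_coeff t (k - 1)\<close> completes the sum over
    \<open>m < k - 1\<close>.\<close>
  also have "(\<lambda>k. if k = 0 then 0 else of_real r * (?c' (k - 1) - ?c (k - 1))) = (\<lambda>k. ?c' k + ?c k)"
  proof
    show "(if k = 0 then 0 else of_real r * (?c' (k - 1) - ?c (k - 1))) = ?c' k + ?c k" for k
      by (cases k) (simp_all add: phi_coeff'_def algebra_simps)
  qed
  also have "op_ser W (\<lambda>k. ?c' k + ?c k) x = D + phi_op r t x"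
    unfolding D_def phi_op_def by (simp add: op_ser_add(1) s)
  finally show ?thesis ..
qed

lemma phi_op_0: "phi_op r 0 x = x"
proof -
  have "phi_op r 0 x = (\<Sum>k. if k = 0 then x else 0)"
    unfolding phi_op_def op_ser_def by (intro suminf_cong) (auto simp: phi_coeff_0)
  also have "\<dots> = x" using sums_single[of 0 "\<lambda>_. x"] by (simp add: sums_iff)
  finally show ?thesis .
qed

end
end
end

text \<open>With \<open>v\<close> the derivative of \<open>u\<close>, this expresses the rate of
  change of the energy through the two vectors \<open>v + u\<close> and \<open>v - u\<close> that
  the differential equation compares.\<close>

lemma inner_polarization_4: "u \<bullet> (v::'a::real_inner) = ((norm (v + u))\<^sup>2 - (norm (v - u))\<^sup>2) / 4"
  unfolding power2_norm_eq_inner by (simp add: inner_add_left inner_add_right inner_diff_left inner_diff_right inner_commute)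

lemma vector_derivative_norm_sq:
  fixes f :: "real \<Rightarrow> 'a::real_inner"
  assumes "(f has_vector_derivative f') (at t within S)"
  shows "((\<lambda>t. (norm (f t))\<^sup>2) has_real_derivative 2 * (f t \<bullet> f')) (at t within S)"
  unfolding power2_norm_eq_inner has_field_derivative_def
  by (rule has_derivative_eq_rhs[OF has_derivative_inner[OF assms[unfolded has_vector_derivative_def]
        assms[unfolded has_vector_derivative_def]]]) (auto simp: fun_eq_iff inner_commute)

context chilbert
begin

text \<open>An instance of von Neumann's inequality, for the function \<open>phi t\<close> and the
  contraction \<open>r W\<close>; here it holds because the norm decreases along the flow, which
  starts at the identity.\<close>

lemma norm_phi_op_le:
  assumes W: "isom W" and r: "0 \<le> r" "r < 1" and t: "t \<ge> 0"
  shows "norm (phi_op W r t x) \<le> norm x"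
proof -
  define D where "D t = op_ser W (\<lambda>k. phi_coeff' t k * of_real r ^ k) x" for t
  have "(norm (phi_op W r t x))\<^sup>2 \<le> (norm (phi_op W r 0 x))\<^sup>2 + 0 * t"
  proof (rule real_derivative_upper_bound[where g' = "\<lambda>t. 2 * (phi_op W r t x \<bullet> D t)", OF _ _ t])
    fix t :: real assume t: "t \<ge> 0"
    show "((\<lambda>t. (norm (phi_op W r t x))\<^sup>2) has_real_derivative 2 * (phi_op W r t x \<bullet> D t)) (at t within {0..})"
      unfolding D_def by (intro vector_derivative_norm_sq phi_op_has_derivative W r t)
    have "norm (D t + phi_op W r t x) \<le> 1 * norm (D t - phi_op W r t x)"
      unfolding D_def phi_op_cayley[OF W r t] using r
      by (simp add: isom_norm[OF W] mult_left_le_one_le)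
    then have "(norm (D t + phi_op W r t x))\<^sup>2 \<le> (norm (D t - phi_op W r t x))\<^sup>2"
      by (simp add: power_mono)
    then show "2 * (phi_op W r t x \<bullet> D t) \<le> 0" unfolding inner_polarization_4 by simp
  qed
  then show ?thesis by (simp add: phi_op_0[OF W r])
qed

end

context isometric_semigroup
begin

text \<open>\<open>V\<^sub>t R y\<close> satisfies the same equation with \<open>r = 1\<close>, so the difference \<open>d\<close> of the two solutions satisfies
  \<open>\<parallel>d' + d\<parallel> \<le> r \<parallel>d' - d\<parallel> + (1 - r) \<parallel>y\<parallel>\<close>, which bounds the derivative of \<open>\<parallel>d\<parallel>\<^sup>2\<close>.\<close>

lemma phi_op_cogen_estimate:
  assumes r: "0 \<le> r" "r < 1" and t: "t \<ge> 0"
  shows "(norm (V t (resolv y) - phi_op cogen r t (resolv y)))\<^sup>2 \<le> (1 - r) * (norm y)\<^sup>2 / 2 * t"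
proof -
  note W = cogen_isom
  define D where "D t = op_ser cogen (\<lambda>k. phi_coeff' t k * of_real r ^ k) (resolv y)" for t
  define p where "p t = V t (resolv y) - V t y" for t
  define d where "d t = V t (resolv y) - phi_op cogen r t (resolv y)" for t
  have "(norm (d t))\<^sup>2 \<le> (norm (d 0))\<^sup>2 + (1 - r) * (norm y)\<^sup>2 / 2 * t"
  proof (rule real_derivative_upper_bound[where g' = "\<lambda>t. 2 * (d t \<bullet> (p t - D t))", OF _ _ t])
    fix t :: real assume t: "t \<ge> 0"
    have "((\<lambda>t. V t (resolv y)) has_vector_derivative p t) (at t within {0..})"
      using is_resolv_resolv[of y] t unfolding is_resolv_def p_def by blast
    then have "(d has_vector_derivative p t - D t) (at t within {0..})"
      unfolding d_def D_def by (intro has_vector_derivative_diff phi_op_has_derivative W r t)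
    then show "((\<lambda>t. (norm (d t))\<^sup>2) has_real_derivative 2 * (d t \<bullet> (p t - D t))) (at t within {0..})"
      by (rule vector_derivative_norm_sq)
    let ?a = "norm (p t - D t + d t)" and ?b = "norm (p t - D t - d t)"
    have cogen_V: "V t (cogen y) = cogen (V t y)"
    proof (rule cogen_commute[OF V_clin[OF t], symmetric])
      show "V t (V s u) = V s (V t u)" if "s \<ge> 0" for s u
        using V_add[of t s u] V_add[of s t u] t that by (simp add: add.commute)
    qed
    have e1: "p t + V t (resolv y) = - V t (cogen y)"
      unfolding p_def cogen_def clin_diff[OF V_clin[OF t]] clin_scaleR[OF V_clin[OF t]] by (simp add: scaleR_2)
    have e2: "D t + phi_op cogen r t (resolv y) = r *\<^sub>R cogen (D t - phi_op cogen r t (resolv y))"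
      unfolding D_def by (rule phi_op_cayley[OF W r t])
    have e3: "r *\<^sub>R cogen (p t - V t (resolv y)) = - r *\<^sub>R V t (cogen y)"
      unfolding p_def cogen_V by (simp add: linear_neg[OF clin_linear[OF isom_clin[OF W]]])
    have e4: "p t - D t - d t = (p t - V t (resolv y)) - (D t - phi_op cogen r t (resolv y))"
      by (simp add: d_def)
    have e5: "p t - D t + d t = (p t + V t (resolv y)) - (D t + phi_op cogen r t (resolv y))"
      by (simp add: d_def)
    have "p t - D t + d t = r *\<^sub>R cogen (p t - D t - d t) - (1 - r) *\<^sub>R V t (cogen y)"
      unfolding e4 e5 e1 e2 clin_diff[OF isom_clin[OF W], of "p t - V t (resolv y)"] scaleR_diff_right e3
      by (simp add: scaleR_diff_left)
    then have "?a \<le> norm (r *\<^sub>R cogen (p t - D t - d t)) + norm ((1 - r) *\<^sub>R V t (cogen y))"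
      by (metis norm_triangle_ineq4)
    also have "\<dots> = r * ?b + (1 - r) * norm y"
      using r t by (simp add: isom_norm[OF W] isom_norm[OF V_isom])
    finally have "?a\<^sup>2 \<le> (r * ?b + (1 - r) * norm y)\<^sup>2" by (simp add: power_mono)
    \<comment> \<open>Convexity of the square with its exact defect; both the defect and the surplus
      in \<open>r * ?b\<^sup>2\<close> have a sign that allows them to be dropped.\<close>
    also have "\<dots> = r * ?b\<^sup>2 + (1 - r) * (norm y)\<^sup>2 - r * (1 - r) * (?b - norm y)\<^sup>2"
      by algebra
    also have "\<dots> \<le> ?b\<^sup>2 + (1 - r) * (norm y)\<^sup>2"
    proof -
      have "r * ?b\<^sup>2 \<le> 1 * ?b\<^sup>2" using r by (intro mult_right_mono) auto
      moreover have "r * (1 - r) * (?b - norm y)\<^sup>2 \<ge> 0" using r by simp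
      ultimately show ?thesis by linarith
    qed
    \<comment> \<open>The polarisation identity carries a factor 1/4, which against the 2 in the
      derivative of the squared norm leaves the 1/2.\<close>
    finally show "2 * (d t \<bullet> (p t - D t)) \<le> (1 - r) * (norm y)\<^sup>2 / 2"
      unfolding inner_polarization_4 by simp
  qed
  then show ?thesis by (simp add: d_def V_0 phi_op_0[OF W r])
qed

text \<open>The estimate covers the range of the resolvent, on which \<open>V t\<close> is
  differentiable. That range is dense and both families are contractive, so the convergence extends
  to every vector; the error is split as e/4 + e/2 + e/4.\<close>

lemma phi_op_cogen_tendsto:
  assumes t: "t \<ge> 0"
  shows "((\<lambda>r. phi_op cogen r t x) \<longlongrightarrow> V t x) (at_left 1)"
proof (rule tendstoI)
  fix e :: real assume e: "e > 0"
  obtain y where y: "dist (resolv y) x < e / 4"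
    using resolv_dense[of x] e unfolding closure_approachable by (metis rangeE zero_less_divide_iff zero_less_numeral)
  have "((\<lambda>r. (1 - r) * (norm y)\<^sup>2 / 2 * t) \<longlongrightarrow> (1 - 1) * (norm y)\<^sup>2 / 2 * t) (at_left 1)"
    by (intro tendsto_intros) auto
  then have "\<forall>\<^sub>F r in at_left 1. (1 - r) * (norm y)\<^sup>2 / 2 * t < (e / 2)\<^sup>2"
    by (rule order_tendstoD(2)) (use e in auto)
  moreover have "\<forall>\<^sub>F r in at_left 1. r \<in> {0<..<1::real}" by (rule eventually_at_left_real) simp
  ultimately show "\<forall>\<^sub>F r in at_left 1. dist (phi_op cogen r t x) (V t x) < e"
  proof eventually_elim
    case (elim r)
    then have r: "0 \<le> r" "r < 1" by auto
    have "(norm (V t (resolv y) - phi_op cogen r t (resolv y)))\<^sup>2 < (e / 2)\<^sup>2"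
      using phi_op_cogen_estimate[OF r t, of y] elim(1) by linarith
    then have 1: "norm (V t (resolv y) - phi_op cogen r t (resolv y)) < e / 2"
      using e by (intro power2_less_imp_less[of _ "e / 2"]) auto
    have 2: "norm (V t (resolv y) - V t x) < e / 4"
      using y isom_norm[OF V_isom[OF t], of "resolv y - x"] by (simp add: clin_diff[OF V_clin[OF t]] dist_norm)
    have 3: "norm (phi_op cogen r t (resolv y) - phi_op cogen r t x) < e / 4"
      using y norm_phi_op_le[OF cogen_isom r t, of "resolv y - x"]
      by (simp add: clin_diff[OF phi_op_clin[OF cogen_isom r t]] dist_norm)
    have eq: "phi_op cogen r t x - V t x = ((V t (resolv y) - V t x) - (V t (resolv y) - phi_op cogen r t (resolv y)))
        - (phi_op cogen r t (resolv y) - phi_op cogen r t x)" by simp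
    have "norm (phi_op cogen r t x - V t x) \<le> norm (V t (resolv y) - V t x)
        + norm (V t (resolv y) - phi_op cogen r t (resolv y)) + norm (phi_op cogen r t (resolv y) - phi_op cogen r t x)"
      unfolding eq
      by (rule order_trans[OF norm_triangle_ineq4 add_right_mono[OF norm_triangle_ineq4]])
    then have "norm (phi_op cogen r t x - V t x) < e" using 1 2 3 by linarith
    then show ?case by (simp add: dist_norm)
  qed
qed

end

section \<open>Unitary part of a tuple of commuting semigroups\<close>

context chilbert
begin

lemma range_isom_iff:
  assumes "isom T" shows "x \<in> range T \<longleftrightarrow> T (hadj T x) = x"
  using hadj_isom[OF assms] by (metis rangeE rangeI)

lemma csubspace_fixed:
  assumes "clin T" shows "csubspace J {x. T x = x}"
  unfolding csubspace_def
proof (intro conjI)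
  show "subspace {x. T x = x}"
    using assms by (auto simp: subspace_def clin_0 clin_add clin_scaleR)
  show "closed {x. T x = x}"
    by (intro closed_Collect_eq continuous_intros bounded_linear.continuous_on[OF clin_bl[OF assms]])
  show "\<forall>x\<in>{x. T x = x}. J x \<in> {x. T x = x}" using assms by (simp add: clin_J)
qed

lemma csubspace_range_isom:
  assumes "isom T" shows "csubspace J (range T)"
proof -
  have "range T = {x. T (hadj T x) = x}" using range_isom_iff[OF assms] by blast
  then show ?thesis
    using csubspace_fixed[of "\<lambda>x. T (hadj T x)"] assms by (simp add: clin_compose isom_clin clin_hadj)
qed

lemma csubspace_INT:
  assumes "\<And>i. i \<in> I \<Longrightarrow> csubspace J (M i)" shows "csubspace J (\<Inter>i\<in>I. M i)"
  using assms unfolding csubspace_def by (auto intro!: subspace_Inter closed_INT)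

lemma INT_range_invariant:
  assumes "\<And>i x. i \<in> I \<Longrightarrow> B (F i x) = F i (B x)" and "x \<in> (\<Inter>i\<in>I. range (F i))"
  shows "B x \<in> (\<Inter>i\<in>I. range (F i))"
proof (intro INT_I)
  fix i assume i: "i \<in> I"
  then obtain y where "x = F i y" using assms(2) by blast
  then show "B x \<in> range (F i)" using assms(1)[OF i] by simp
qed

text \<open>Applied with \<open>X\<close> a single factor and \<open>S\<close> its cofactor, once
  for the operators \<open>Vprod t\<close> and once for the powers of \<open>Wc\<close>. A point of
  the intersection is \<open>F l y\<close>; cancelling the injective \<open>F l\<close> shows that
  \<open>y\<close> lies in the intersection again, and then \<open>S y\<close> is a preimage of the
  point under \<open>X\<close>.\<close>

lemma image_INT_range:
  assumes l: "l \<in> I" and inj: "\<And>x y. F l x = F l y \<Longrightarrow> x = y"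
    and F: "\<And>i. i \<in> I \<Longrightarrow> \<exists>m\<in>I. \<forall>x. F m x = F l (F i x)"
    and XS: "\<And>x. F l x = X (S x)"
    and X: "\<And>i x. i \<in> I \<Longrightarrow> X (F i x) = F i (X x)" and S: "\<And>i x. i \<in> I \<Longrightarrow> S (F i x) = F i (S x)"
  shows "X ` (\<Inter>i\<in>I. range (F i)) = (\<Inter>i\<in>I. range (F i))" (is "_ ` ?M = _")
proof (rule antisym)
  show "X ` ?M \<subseteq> ?M" by (rule image_subsetI) (rule INT_range_invariant, rule X)
  show "?M \<subseteq> X ` ?M"
  proof
    fix x assume x: "x \<in> ?M"
    obtain y where y: "x = F l y" using x l by blast
    have "y \<in> range (F i)" if i: "i \<in> I" for i
    proof -
      obtain m where m: "m \<in> I" "\<forall>x. F m x = F l (F i x)" using F[OF i] by blast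
      obtain z where "x = F m z" using x m(1) by blast
      then have "y = F i z" using inj y m(2) by simp
      then show ?thesis by simp
    qed
    then have "S y \<in> ?M" by (intro INT_range_invariant[where B = S] S) auto
    then show "x \<in> X ` ?M" unfolding y XS by (rule imageI)
  qed
qed

lemma csubspace_Int: "csubspace J M \<Longrightarrow> csubspace J N \<Longrightarrow> csubspace J (M \<inter> N)"
  unfolding csubspace_def by (auto intro!: subspace_inter)

lemma ocompl_eq: "csubspace J M \<Longrightarrow> ocompl J UNIV M = {x. \<forall>y\<in>M. x \<bullet> y = 0}"
  by (simp add: ocompl_csubspace)

lemma csubspace_ocompl:
  assumes "csubspace J M" shows "csubspace J (ocompl J UNIV M)"
proof -
  have eq: "ocompl J UNIV M = {x. \<forall>y\<in>M. x \<bullet> y = 0}" by (rule ocompl_eq[OF assms])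
  have "closed {x. \<forall>y\<in>M. x \<bullet> y = 0}"
    unfolding Ball_def by (intro closed_Collect_all closed_Collect_imp closed_Collect_eq continuous_intros) auto
  moreover have "\<forall>x\<in>{x. \<forall>y\<in>M. x \<bullet> y = 0}. J x \<in> {x. \<forall>y\<in>M. x \<bullet> y = 0}"
    using assms by (auto simp: csubspace_def J_inner)
  ultimately show ?thesis unfolding eq csubspace_def by (auto simp: subspace_def inner_add_left)
qed

lemma csubspace_decompose:
  assumes "csubspace J M"
  obtains a b where "x = a + b" "a \<in> M" "b \<in> ocompl J UNIV M"
proof -
  obtain p where "p \<in> M" "\<And>m. m \<in> M \<Longrightarrow> (x - p) \<bullet> m = 0"
    using orthogonal_projection_exists[of M x] assms unfolding csubspace_def by metis
  then show ?thesis using that[of p "x - p"] by (simp add: ocompl_eq[OF assms])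
qed

lemma
  assumes "csubspace J M"
  shows csubspace_0: "0 \<in> M" and csubspace_add: "x \<in> M \<Longrightarrow> y \<in> M \<Longrightarrow> x + y \<in> M"
    and csubspace_diff: "x \<in> M \<Longrightarrow> y \<in> M \<Longrightarrow> x - y \<in> M"
    and csubspace_scaleR: "x \<in> M \<Longrightarrow> c *\<^sub>R x \<in> M"
    and csubspace_J: "x \<in> M \<Longrightarrow> J x \<in> M"
  using assms unfolding csubspace_def by (auto intro: subspace_0 subspace_add subspace_diff subspace_scale)

lemma csubspace_suminf:
  assumes M: "csubspace J M" and f: "\<And>k. f k \<in> M" and s: "summable (\<lambda>k. cscale J (c k) (f k))"
  shows "(\<Sum>k. cscale J (c k) (f k)) \<in> M"
proof -
  have "(\<Sum>k<N. cscale J (c k) (f k)) \<in> M" for N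
    unfolding cscale_def using M f
    by (intro subspace_sum csubspace_add[OF M] csubspace_scaleR[OF M] csubspace_J[OF M]) (auto simp: csubspace_def)
  moreover have "closed M" using M by (simp add: csubspace_def)
  ultimately show ?thesis using closed_sequentially[OF _ _ summable_LIMSEQ[OF s]] by blast
qed

lemma ocompl_ocompl:
  assumes "csubspace J M" shows "ocompl J UNIV (ocompl J UNIV M) = M"
proof
  show "M \<subseteq> ocompl J UNIV (ocompl J UNIV M)"
    unfolding ocompl_eq[OF csubspace_ocompl[OF assms]] by (auto simp: ocompl_eq[OF assms] inner_commute)
  show "ocompl J UNIV (ocompl J UNIV M) \<subseteq> M"
  proof
    fix x assume x: "x \<in> ocompl J UNIV (ocompl J UNIV M)"
    obtain a b where ab: "x = a + b" "a \<in> M" "b \<in> ocompl J UNIV M"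
      using csubspace_decompose[OF assms] by metis
    have "x \<bullet> b = 0" using x ab(3) unfolding ocompl_eq[OF csubspace_ocompl[OF assms]] by blast
    moreover have "a \<bullet> b = 0" using ab(2,3) by (auto simp: ocompl_eq[OF assms] inner_commute)
    ultimately have "b = 0" by (simp add: ab(1) inner_add_left)
    then show "x \<in> M" using ab by simp
  qed
qed

lemma Uprod_isom: "(\<And>i. i < k \<Longrightarrow> isom (A i)) \<Longrightarrow> isom (Uprod A k)"
proof (induction k)
  case (Suc k)
  then show ?case using isom_compose[of "A k" "Uprod A k"] by (simp add: o_def)
qed (simp add: id_def isom_id)

lemma Uprod_commute: "(\<And>i x. i < k \<Longrightarrow> B (A i x) = A i (B x)) \<Longrightarrow> B (Uprod A k x) = Uprod A k (B x)"
proof (induction k)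
  case (Suc k)
  have "B (A k (Uprod A k x)) = A k (B (Uprod A k x))" by (rule Suc.prems) simp
  moreover have "B (Uprod A k x) = Uprod A k (B x)" by (rule Suc.IH) (rule Suc.prems, simp)
  ultimately show ?case by simp
qed simp

lemma Uprod_image: "(\<And>i. i < k \<Longrightarrow> A i ` M = M) \<Longrightarrow> Uprod A k ` M = M"
proof (induction k)
  case (Suc k)
  have "Uprod A (Suc k) ` M = A k ` (Uprod A k ` M)" by (simp add: image_comp)
  then show ?case using Suc by simp
qed simp

text \<open>The cofactor of \<open>A j\<close> in \<open>Uprod A k\<close>. Replacing the factor by
  \<open>id\<close> instead of deleting it keeps the indices, so that two factors can be removed one
  after the other.\<close>

definition Uskip :: "(nat \<Rightarrow> 'a \<Rightarrow> 'a) \<Rightarrow> nat \<Rightarrow> nat \<Rightarrow> 'a \<Rightarrow> 'a" where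
  "Uskip A j = Uprod (\<lambda>i. if i = j then id else A i)"

lemma Uprod_cong: "(\<And>i. i < k \<Longrightarrow> A i = B i) \<Longrightarrow> Uprod A k = Uprod B k"
  by (induction k) auto

lemma Uprod_Uskip:
  assumes "\<And>i l x. i < k \<Longrightarrow> l < k \<Longrightarrow> A i (A l x) = A l (A i x)" "j < k"
  shows "Uprod A k x = A j (Uskip A j k x)"
  using assms
proof (induction k)
  case (Suc k)
  show ?case
  proof (cases "j = k")
    case True
    then have "Uskip A j k = Uprod A k" unfolding Uskip_def by (intro Uprod_cong) auto
    then show ?thesis using True by (simp add: Uskip_def)
  next
    case False
    then have "Uprod A k x = A j (Uskip A j k x)" using Suc by simp
    then have "Uprod A (Suc k) x = A j (A k (Uskip A j k x))" using Suc.prems by simp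
    then show ?thesis using False by (simp add: Uskip_def)
  qed
qed simp

lemma Uskip_isom: "(\<And>i. i < k \<Longrightarrow> isom (A i)) \<Longrightarrow> isom (Uskip A j k)"
  unfolding Uskip_def by (rule Uprod_isom) (simp add: id_def isom_id)

lemma Uskip_commute: "(\<And>i x. i < k \<Longrightarrow> B (A i x) = A i (B x)) \<Longrightarrow> B (Uskip A j k x) = Uskip A j k (B x)"
  unfolding Uskip_def by (rule Uprod_commute) simp

end

section \<open>Commuting tuples and their largest jointly unitary subspace\<close>

locale isometric_tuple = chilbert J for J :: "'a::{real_inner,complete_space} \<Rightarrow> 'a" +
  fixes n :: nat and V :: "nat \<Rightarrow> real \<Rightarrow> 'a \<Rightarrow> 'a"
  assumes isometric: "n_isometric_semigroup J UNIV n V"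
begin

lemma semigroup: "j < n \<Longrightarrow> isometric_semigroup J (V j)"
proof
  assume j: "j < n"
  have sg: "semigroup_on J UNIV (V j)" and iso: "\<And>t. t \<ge> 0 \<Longrightarrow> isometry_on J UNIV (V j t)"
    using isometric j unfolding n_isometric_semigroup_def by blast+
  show "isom (V j t)" if "t \<ge> 0" for t
    using iso[OF that] by (intro isomI clinear_on_UNIV_clin) (auto simp: isometry_on_def)
  show "V j 0 x = x" for x using sg by (simp add: semigroup_on_def)
  show "V j (s + t) x = V j s (V j t x)" if "s \<ge> 0" "t \<ge> 0" for s t x
    using sg that by (simp add: semigroup_on_def)
  show "continuous_on {0..} (\<lambda>t. V j t x)" for x using sg by (simp add: semigroup_on_def)
qed

lemmas V_isom = isometric_semigroup.V_isom[OF semigroup]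
  and V_clin = isometric_semigroup.V_clin[OF semigroup]
  and V_0 = isometric_semigroup.V_0[OF semigroup]
  and V_add = isometric_semigroup.V_add[OF semigroup]
  and V_cont = isometric_semigroup.V_cont[OF semigroup]

lemma V_mult_nat:
  assumes "j < n" "h \<ge> 0" shows "V j (real m * h) x = (V j h ^^ m) x"
proof (induction m)
  case (Suc m)
  have "V j (real (Suc m) * h) x = V j (h + real m * h) x" by (simp add: algebra_simps)
  also have "\<dots> = V j h (V j (real m * h) x)" using assms by (intro V_add) auto
  finally show ?case using Suc by simp
qed (simp add: V_0 assms)

text \<open>Only operators at equal times are assumed to commute; rational time ratios and
  strong continuity give the general case.\<close>

lemma V_commute:
  assumes i: "i < n" and j: "j < n" and s: "s \<ge> 0" and t: "t \<ge> 0"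
  shows "V i s (V j t x) = V j t (V i s x)"
proof (cases "t = 0")
  case False
  then have t0: "t > 0" using t by simp
  \<comment> \<open>\<open>\<sigma> m\<close> is the largest multiple of \<open>t / Suc m\<close>
    not exceeding \<open>s\<close>. Since \<open>t\<close> is a multiple of the same step, the
    operators at times \<open>\<sigma> m\<close> and \<open>t\<close> are powers of operators at one
    common time.\<close>
  define q where "q m = nat \<lfloor>s * real (Suc m) / t\<rfloor>" for m
  define \<sigma> where "\<sigma> m = real (q m) * (t / real (Suc m))" for m
  have "norm (\<sigma> m - s) \<le> t * (1 / real (Suc m))" for m
  proof -
    let ?y = "s * real (Suc m) / t"
    have "?y \<ge> 0" using s t by simp
    then have qr: "real (q m) = of_int \<lfloor>?y\<rfloor>" unfolding q_def by simp
    have "\<bar>real (q m) - ?y\<bar> \<le> 1" unfolding qr by linarith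
    then have "\<bar>real (q m) - ?y\<bar> * (t / real (Suc m)) \<le> 1 * (t / real (Suc m))"
      using t by (intro mult_right_mono) auto
    moreover have "\<sigma> m - s = (real (q m) - ?y) * (t / real (Suc m))"
      using t0 by (simp add: \<sigma>_def left_diff_distrib diff_divide_distrib del: of_nat_Suc)
    ultimately show ?thesis using t by (simp add: abs_mult)
  qed
  moreover have "(\<lambda>m. t * (1 / real (Suc m))) \<longlonglongrightarrow> 0"
    using tendsto_mult_right[OF LIMSEQ_inverse_real_of_nat, of t] by (simp add: inverse_eq_divide)
  ultimately have "(\<lambda>m. \<sigma> m - s) \<longlonglongrightarrow> 0"
    by (intro Lim_null_comparison[of "\<lambda>m. \<sigma> m - s"]) auto
  then have \<sigma>: "\<sigma> \<longlonglongrightarrow> s" by (rule LIM_zero_cancel)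
  have \<sigma>0: "\<sigma> m \<ge> 0" for m using t by (simp add: \<sigma>_def)
  have lim: "(\<lambda>m. V i (\<sigma> m) y) \<longlonglongrightarrow> V i s y" for y
    using continuous_on_tendsto_compose[OF V_cont[OF i] \<sigma>] s \<sigma>0 by simp
  have "V i (\<sigma> m) (V j t x) = V j t (V i (\<sigma> m) x)" for m
  proof -
    define h where "h = t / real (Suc m)"
    have h: "h \<ge> 0" using t by (simp add: h_def)
    have c: "V i h (V j h y) = V j h (V i h y)" for y
      using isometric i j h unfolding n_isometric_semigroup_def by blast
    have c1: "V i h ((V j h ^^ l) y) = (V j h ^^ l) (V i h y)" for l y
      by (induction l) (auto simp: c)
    have c2: "(V i h ^^ k) ((V j h ^^ l) y) = (V j h ^^ l) ((V i h ^^ k) y)" for k l y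
      by (induction k) (auto simp: c1)
    have "t = real (Suc m) * h" by (simp add: h_def)
    then show ?thesis unfolding \<sigma>_def h_def[symmetric] using V_mult_nat[OF i h] V_mult_nat[OF j h] c2 by metis
  qed
  then have "(\<lambda>m. V j t (V i (\<sigma> m) x)) \<longlonglongrightarrow> V i s (V j t x)" using lim[of "V j t x"] by simp
  moreover have "(\<lambda>m. V j t (V i (\<sigma> m) x)) \<longlonglongrightarrow> V j t (V i s x)"
    by (rule bounded_linear.tendsto[OF clin_bl[OF V_clin[OF j t]] lim])
  ultimately show ?thesis by (rule LIMSEQ_unique)
qed (simp add: V_0 j)

lemma semigroup_on_subset:
  assumes "j < n" "\<And>t x. t \<ge> 0 \<Longrightarrow> x \<in> M \<Longrightarrow> V j t x \<in> M"
  shows "semigroup_on J M (V j)" "t \<ge> 0 \<Longrightarrow> isometry_on J M (V j t)"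
proof -
  have c: "clinear_on J M (V j t)" if "t \<ge> 0" for t
    by (rule clin_clinear_on[OF V_clin[OF assms(1) that]]) (use assms(2) that in auto)
  show "semigroup_on J M (V j)" unfolding semigroup_on_def
    using c isom_norm[OF V_isom[OF assms(1)]] V_0[OF assms(1)] V_add[OF assms(1)] V_cont[OF assms(1)] by simp
  show "isometry_on J M (V j t)" if "t \<ge> 0"
    using c[OF that] isom_norm[OF V_isom[OF assms(1) that]] by (simp add: isometry_on_def)
qed

lemma n_isometric_subset:
  assumes "\<And>j t x. j < n \<Longrightarrow> t \<ge> 0 \<Longrightarrow> x \<in> M \<Longrightarrow> V j t x \<in> M"
  shows "n_isometric_semigroup J M n V"
  using semigroup_on_subset[of _ M] assms V_commute unfolding n_isometric_semigroup_def by simp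

text \<open>Surjectivity on \<open>M\<close> already makes \<open>M\<close> reducing: each
  \<open>y\<close> in \<open>M\<close> is \<open>V j t y'\<close> with \<open>y'\<close> in
  \<open>M\<close>, so a vector orthogonal to \<open>M\<close> has an image orthogonal to
  \<open>M\<close>. The ambient \<open>K\<close> is the whole space or the c.n.u. part in the
  applications.\<close>

lemma surjective_part:
  assumes M: "csubspace J M" "M \<subseteq> K"
    and K: "\<And>j t x. j < n \<Longrightarrow> t \<ge> 0 \<Longrightarrow> x \<in> K \<Longrightarrow> V j t x \<in> K"
    and VM: "\<And>j t. j < n \<Longrightarrow> t \<ge> 0 \<Longrightarrow> V j t ` M = M"
  shows "jointly_reducing J K n V M"
    and "\<forall>j<n. semigroup_on J M (V j) \<and> (\<forall>t\<ge>0. unitary_on J M (V j t))"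
proof -
  have inM: "V j t x \<in> M" if "j < n" "t \<ge> 0" "x \<in> M" for j t x using VM that by blast
  show "\<forall>j<n. semigroup_on J M (V j) \<and> (\<forall>t\<ge>0. unitary_on J M (V j t))"
  proof (intro allI impI conjI)
    fix j assume j: "j < n"
    show "semigroup_on J M (V j)" by (rule semigroup_on_subset(1)[OF j inM[OF j]])
    show "unitary_on J M (V j t)" if "t \<ge> 0" for t
      unfolding unitary_on_def using semigroup_on_subset(2)[OF j inM[OF j] that] VM[OF j that] by blast
  qed
  have "V j t x \<in> ocompl J K M" if jt: "j < n" "t \<ge> 0" and x: "x \<in> ocompl J K M" for j t x
  proof -
    have "V j t x \<bullet> y = 0" if "y \<in> M" for y
    proof -
      have "y \<in> V j t ` M" by (simp only: VM[OF jt] that)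
      then obtain y' where "y' \<in> M" "y = V j t y'" by blast
      then show ?thesis using x by (simp add: isom_inner[OF V_isom[OF jt]] ocompl_csubspace[OF M(1)])
    qed
    then show ?thesis using x K[OF jt] by (simp add: ocompl_csubspace[OF M(1)])
  qed
  then show "jointly_reducing J K n V M"
    unfolding jointly_reducing_def reduces_def using M inM by blast
qed

definition Vprod :: "real \<Rightarrow> 'a \<Rightarrow> 'a" where "Vprod t = Uprod (\<lambda>j. V j t) n"

definition Hu :: "'a set" where "Hu = (\<Inter>t\<in>{0..}. range (Vprod t))"

lemma Vprod_isom: "t \<ge> 0 \<Longrightarrow> isom (Vprod t)"
  unfolding Vprod_def by (intro Uprod_isom V_isom)

lemma Vprod_commute:
  "t \<ge> 0 \<Longrightarrow> (\<And>i x. i < n \<Longrightarrow> B (V i t x) = V i t (B x)) \<Longrightarrow> B (Vprod t x) = Vprod t (B x)"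
  unfolding Vprod_def by (rule Uprod_commute)

text \<open>Regrouping the factors moves operators at time \<open>t\<close> past operators at time
  \<open>s\<close>, so this rests on commutation at different times.\<close>

lemma Vprod_add:
  assumes s: "s \<ge> 0" and t: "t \<ge> 0" shows "Vprod (s + t) x = Vprod s (Vprod t x)"
proof -
  have "k \<le> n \<Longrightarrow> Uprod (\<lambda>j. V j (s + t)) k x = Uprod (\<lambda>j. V j s) k (Uprod (\<lambda>j. V j t) k x)" for k
  proof (induction k)
    case (Suc k)
    have "V k t (Uprod (\<lambda>j. V j s) k y) = Uprod (\<lambda>j. V j s) k (V k t y)" for y
      by (rule Uprod_commute) (use Suc.prems s t in \<open>auto intro!: V_commute\<close>)
    then show ?case using Suc s t by (simp add: V_add)
  qed simp
  then show ?thesis by (simp add: Vprod_def)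
qed

lemma csubspace_Hu: "csubspace J Hu"
  unfolding Hu_def by (intro csubspace_INT csubspace_range_isom Vprod_isom) auto

lemma V_image_Hu:
  assumes j: "j < n" and t: "t \<ge> 0" shows "V j t ` Hu = Hu"
  unfolding Hu_def
proof (rule image_INT_range[where l = t and S = "Uskip (\<lambda>j. V j t) j n"])
  show "\<And>x y. Vprod t x = Vprod t y \<Longrightarrow> x = y" by (rule isom_inj[OF Vprod_isom[OF t]])
  show "\<exists>m\<in>{0..}. \<forall>x. Vprod m x = Vprod t (Vprod s x)" if "s \<in> {0..}" for s
    using Vprod_add[of t s] t that by (intro bexI[of _ "t + s"]) auto
  show "Vprod t x = V j t (Uskip (\<lambda>j. V j t) j n x)" for x
    unfolding Vprod_def by (rule Uprod_Uskip[where A = "\<lambda>j. V j t"]) (rule V_commute t j | assumption)+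
  fix s x assume "s \<in> {0::real..}"
  then have s: "s \<ge> 0" by simp
  show "V j t (Vprod s x) = Vprod s (V j t x)"
    by (rule Vprod_commute[OF s]) (rule V_commute[OF j _ t s])
  show "Uskip (\<lambda>j. V j t) j n (Vprod s x) = Vprod s (Uskip (\<lambda>j. V j t) j n x)"
    by (rule Vprod_commute[OF s], rule Uskip_commute[symmetric], rule V_commute[OF _ _ s t])
qed (use t in simp)

lemma surjective_subset_Hu:
  assumes "\<And>j t. j < n \<Longrightarrow> t \<ge> 0 \<Longrightarrow> V j t ` M = M" shows "M \<subseteq> Hu"
  unfolding Hu_def
proof (intro INT_greatest)
  fix t :: real assume "t \<in> {0..}"
  then have "Vprod t ` M = M" unfolding Vprod_def by (intro Uprod_image assms) auto
  then show "M \<subseteq> range (Vprod t)" by blast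
qed

lemma decomposition_exists:
  defines "Hp \<equiv> ocompl J UNIV Hu"
  shows "csubspace J Hp" "Hu = ocompl J UNIV Hp"
    "jointly_reducing J UNIV n V Hp" "jointly_reducing J UNIV n V Hu"
    "cnu J Hp n V" "n_unitary_semigroup J Hu n V"
proof -
  show Hp: "csubspace J Hp" unfolding Hp_def by (rule csubspace_ocompl[OF csubspace_Hu])
  show HuHp: "Hu = ocompl J UNIV Hp" unfolding Hp_def by (rule ocompl_ocompl[OF csubspace_Hu, symmetric])
  note red = surjective_part[OF csubspace_Hu subset_UNIV UNIV_I V_image_Hu]
  show redu: "jointly_reducing J UNIV n V Hu" by (rule red(1))
  then show "jointly_reducing J UNIV n V Hp"
    using Hp HuHp unfolding jointly_reducing_def reduces_def Hp_def[symmetric] by simp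
  have HuV: "V j t x \<in> Hu" if "j < n" "t \<ge> 0" "x \<in> Hu" for j t x
    using redu that unfolding jointly_reducing_def reduces_def by blast
  show "n_unitary_semigroup J Hu n V"
    unfolding n_unitary_semigroup_def using red(2) n_isometric_subset[OF HuV] by blast
  have HpV: "V j t x \<in> Hp" if "j < n" "t \<ge> 0" "x \<in> Hp" for j t x
    using redu that unfolding jointly_reducing_def reduces_def Hp_def by blast
  have "M = {0}" if M: "jointly_reducing J Hp n V M" "\<forall>j<n. \<forall>t\<ge>0. unitary_on J M (V j t)" for M
  proof -
    have "M \<subseteq> Hu" using M(2) by (intro surjective_subset_Hu) (auto simp: unitary_on_def)
    moreover have "M \<subseteq> Hp" "csubspace J M" using M(1) by (auto simp: jointly_reducing_def)
    moreover from this have "0 \<in> M" by (intro csubspace_0)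
    moreover have "x = 0" if "x \<in> Hu" "x \<in> Hp" for x
      using that by (auto simp: Hp_def ocompl_eq[OF csubspace_Hu])
    ultimately show ?thesis by blast
  qed
  then show "cnu J Hp n V"
    unfolding cnu_def using n_isometric_subset[OF HpV] by blast
qed

text \<open>\<open>B\<close> lies in \<open>Hu\<close> by maximality. Conversely every member of
  \<open>Hu\<close> splits along \<open>A\<close> and \<open>B\<close>, and its component in
  \<open>A\<close> lies in \<open>Hu \<inter> A\<close>, which is a jointly unitary part of the
  c.n.u. space \<open>A\<close> and hence zero.\<close>

lemma decomposition_unique:
  assumes A: "csubspace J A" and B: "B = ocompl J UNIV A"
    and red: "jointly_reducing J UNIV n V A" and cnu: "cnu J A n V" and un: "n_unitary_semigroup J B n V"
  shows "A = ocompl J UNIV Hu" "B = Hu"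
proof -
  have VB: "V j t ` B = B" if "j < n" "t \<ge> 0" for j t
    using un that unfolding n_unitary_semigroup_def unitary_on_def by blast
  have BHu: "B \<subseteq> Hu" by (rule surjective_subset_Hu[OF VB])
  have AV: "V j t x \<in> A" if "j < n" "t \<ge> 0" "x \<in> A" for j t x
    using red that unfolding jointly_reducing_def reduces_def by blast
  \<comment> \<open>The inclusion to be shown is the second one: if \<open>V j t y\<close> lies in
    \<open>A\<close> for some \<open>y\<close> in \<open>Hu\<close>, then the component of
    \<open>y\<close> in \<open>B\<close> is mapped into both \<open>A\<close> and \<open>B\<close>,
    hence to zero, so \<open>y\<close> lies in \<open>A\<close>.\<close>
  have VM: "V j t ` (Hu \<inter> A) = Hu \<inter> A" if jt: "j < n" "t \<ge> 0" for j t
  proof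
    show "V j t ` (Hu \<inter> A) \<subseteq> Hu \<inter> A"
      using equalityD1[OF V_image_Hu[OF jt]] AV[OF jt] by blast
    show "Hu \<inter> A \<subseteq> V j t ` (Hu \<inter> A)"
    proof
      fix x assume x: "x \<in> Hu \<inter> A"
      then have "x \<in> V j t ` Hu" by (simp add: V_image_Hu[OF jt])
      then obtain y where y: "y \<in> Hu" "x = V j t y" by blast
      obtain a b where ab: "y = a + b" "a \<in> A" "b \<in> B" using csubspace_decompose[OF A] B by metis
      have "V j t b = x - V j t a" unfolding y(2) ab(1) by (simp add: clin_add[OF V_clin[OF jt]])
      then have "V j t b \<in> A" using x AV[OF jt ab(2)] csubspace_diff[OF A] by simp
      moreover have "V j t b \<in> B" using equalityD1[OF VB[OF jt]] ab(3) by blast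
      ultimately have "V j t b = 0" by (auto simp: B ocompl_eq[OF A])
      then have "b = 0" using isom_norm[OF V_isom[OF jt], of b] by simp
      then have "y \<in> Hu \<inter> A" using y(1) ab by simp
      then show "x \<in> V j t ` (Hu \<inter> A)" unfolding y(2) by (rule imageI)
    qed
  qed
  note part = surjective_part[OF csubspace_Int[OF csubspace_Hu A] Int_lower2 AV VM]
  have M0: "Hu \<inter> A = {0}"
  proof (rule ccontr)
    assume ne: "Hu \<inter> A \<noteq> {0}"
    have "\<exists>M. M \<noteq> {0} \<and> jointly_reducing J A n V M \<and>
        (\<forall>j<n. semigroup_on J M (V j) \<and> (\<forall>t\<ge>0. unitary_on J M (V j t)))"
      by (rule exI[of _ "Hu \<inter> A"]) (intro conjI ne part)
    then show False using cnu unfolding cnu_def by (elim conjE notE)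
  qed
  show BH: "B = Hu"
  proof
    show "Hu \<subseteq> B"
    proof
      fix x assume x: "x \<in> Hu"
      obtain a b where ab: "x = a + b" "a \<in> A" "b \<in> B" using csubspace_decompose[OF A] B by metis
      have "a = x - b" using ab by simp
      then have "a \<in> Hu" using csubspace_diff[OF csubspace_Hu x] ab(3) BHu by blast
      then have "a = 0" using M0 ab(2) by blast
      then show "x \<in> B" using ab by simp
    qed
  qed (rule BHu)
  show "A = ocompl J UNIV Hu" using ocompl_ocompl[OF A] B BH by simp
qed

end

section \<open>Commuting isometries with product \<open>W\<close> and their B-C-L triple\<close>

context chilbert
begin

context
  fixes W :: "'a \<Rightarrow> 'a"
  assumes W: "isom W"
begin

definition wandering :: "'a set" where "wandering = {x. hadj W x = 0}"

text \<open>If \<open>X X' = W\<close>, then a wandering vector \<open>e\<close> has \<open>X e = bclA X e + W (bclB X e)\<close> with both parts wandering and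
  \<open>bclB X\<close> the adjoint of \<open>X'\<close>; the symbol of \<open>X\<close> is thus \<open>bclA X + z bclB X = bclU X ((1 - bclP X) + z bclP X)\<close>,
  where \<open>bclP X\<close> is \<open>X' hadj X'\<close>.\<close>

definition bclB :: "('a \<Rightarrow> 'a) \<Rightarrow> 'a \<Rightarrow> 'a" where "bclB X e = hadj W (X e)"
definition bclA :: "('a \<Rightarrow> 'a) \<Rightarrow> 'a \<Rightarrow> 'a" where "bclA X e = X e - W (bclB X e)"
definition bclU :: "('a \<Rightarrow> 'a) \<Rightarrow> 'a \<Rightarrow> 'a" where "bclU X e = bclA X e + bclB X e"
definition bclP :: "('a \<Rightarrow> 'a) \<Rightarrow> 'a \<Rightarrow> 'a" where "bclP X e = hadj X (W (bclB X e))"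

text \<open>Requiring the factorisation in both orders makes \<open>X\<close> commute with
  \<open>W\<close>, since both \<open>X (W x)\<close> and \<open>W (X x)\<close> are
  \<open>X (X' (X x))\<close>.\<close>

definition divides_W :: "('a \<Rightarrow> 'a) \<Rightarrow> bool" where
  "divides_W X \<longleftrightarrow> isom X \<and> (\<exists>X'. isom X' \<and> (\<forall>x. X (X' x) = W x) \<and> (\<forall>x. X' (X x) = W x))"

lemma wandering_csubspace: "csubspace J wandering"
proof -
  have c: "clin (hadj W)" by (intro clin_hadj isom_clin W)
  have "closed wandering" unfolding wandering_def
    by (intro closed_Collect_eq continuous_intros bounded_linear.continuous_on[OF clin_bl[OF c]])
  then show ?thesis
    unfolding csubspace_def by (auto simp: wandering_def subspace_def clin_0[OF c] clin_add[OF c] clin_scaleR[OF c] clin_J[OF c])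
qed

lemma wandering_W_inner: "e \<in> wandering \<Longrightarrow> W f \<bullet> e = 0"
  using hadj_inner[OF clin_bl[OF isom_clin[OF W]], of f e] by (simp add: wandering_def)

lemma wandering_decomposition_unique:
  assumes "a + W b = a' + W b'" "a \<in> wandering" "a' \<in> wandering"
  shows "a = a'" "b = b'"
proof -
  have "hadj W (a + W b) = hadj W (a' + W b')" using assms(1) by simp
  then show "b = b'"
    using assms(2,3) by (simp add: clin_add[OF clin_hadj[OF isom_clin[OF W]]] hadj_isom[OF W] wandering_def)
  then show "a = a'" using assms(1) by simp
qed

lemma bclB_clin: "clin X \<Longrightarrow> clin (bclB X)"
  unfolding bclB_def[abs_def] by (rule clin_compose[OF clin_hadj[OF isom_clin[OF W]]])
lemma bclA_clin: "clin X \<Longrightarrow> clin (bclA X)"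
  unfolding bclA_def[abs_def] by (rule clin_minus[OF _ clin_compose[OF isom_clin[OF W] bclB_clin]])
lemma bclU_clin: "clin X \<Longrightarrow> clin (bclU X)"
  unfolding bclU_def[abs_def] by (rule clin_plus[OF bclA_clin bclB_clin])
lemma bclP_clin: "clin X \<Longrightarrow> clin (bclP X)"
  unfolding bclP_def[abs_def] by (rule clin_compose[OF clin_hadj clin_compose[OF isom_clin[OF W] bclB_clin]])

lemma apply_eq_bclA_bclB: "X e = bclA X e + W (bclB X e)"
  by (simp add: bclA_def)

context
  fixes X :: "'a \<Rightarrow> 'a"
  assumes dvd: "divides_W X"
begin

lemma X_isom: "isom X" and X_clin: "clin X"
  using dvd isom_clin by (auto simp: divides_W_def)

lemma X_W: "X (W x) = W (X x)"
  using dvd unfolding divides_W_def by metis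

text \<open>Everything follows by cancelling \<open>hadj X\<close> against \<open>X\<close>: once in
  \<open>hadj X' (hadj X (X e))\<close>, which is \<open>hadj W (X e)\<close>, and once in
  \<open>hadj X (X (X' y))\<close>, which is \<open>hadj X (W y)\<close>.\<close>

lemma complementary_factor:
  obtains X' where "isom X'" "\<And>e. bclP X e = X' (hadj X' e)" "\<And>e. bclB X e = hadj X' e"
    "\<And>x. X (X' x) = W x" "\<And>x. X' (X x) = W x"
    "\<And>y. hadj W y = hadj X' (hadj X y)" "\<And>y. hadj W y = hadj X (hadj X' y)"
proof -
  obtain X' where X': "isom X'" "\<And>x. X (X' x) = W x" "\<And>x. X' (X x) = W x"
    using dvd unfolding divides_W_def by metis
  have 1: "hadj W y = hadj X' (hadj X y)" for y
    using hadj_compose[OF X_clin isom_clin[OF X'(1)], of y] by (simp add: X'(2))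
  have 2: "hadj W y = hadj X (hadj X' y)" for y
    using hadj_compose[OF isom_clin[OF X'(1)] X_clin, of y] by (simp add: X'(3))
  have 3: "bclB X e = hadj X' e" for e by (simp add: bclB_def 1 hadj_isom[OF X_isom])
  have 4: "bclP X e = X' (hadj X' e)" for e
    by (simp add: bclP_def 3 hadj_isom[OF X_isom] flip: X'(2))
  show ?thesis using that[OF X'(1) 4 3 X'(2,3) 1 2] .
qed

text \<open>The adjoint of \<open>X'\<close> commutes with the adjoint of \<open>W\<close> and
  therefore preserves its kernel.\<close>

lemma bclB_wandering: "e \<in> wandering \<Longrightarrow> bclB X e \<in> wandering"
proof -
  assume e: "e \<in> wandering"
  obtain X' where X': "\<And>e. bclB X e = hadj X' e" "\<And>y. hadj W y = hadj X' (hadj X y)" "\<And>y. hadj W y = hadj X (hadj X' y)" "isom X'"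
    using complementary_factor by metis
  have "hadj W (hadj X' e) = hadj X' (hadj X (hadj X' e))" by (rule X'(2))
  also have "\<dots> = hadj X' (hadj W e)" by (simp only: X'(3))
  also have "\<dots> = 0" using e by (simp add: wandering_def clin_0[OF clin_hadj[OF isom_clin[OF X'(4)]]])
  finally show ?thesis by (simp add: wandering_def X'(1))
qed

lemma bclA_wandering: "bclA X e \<in> wandering"
  by (simp add: wandering_def bclA_def bclB_def clin_diff[OF clin_hadj[OF isom_clin[OF W]]] hadj_isom[OF W])

lemma bclP_wandering: "e \<in> wandering \<Longrightarrow> bclP X e \<in> wandering"
proof -
  assume e: "e \<in> wandering"
  obtain X' where X': "isom X'" "\<And>e. bclP X e = X' (hadj X' e)" "\<And>y. hadj W y = hadj X (hadj X' y)"
    using complementary_factor by metis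
  have "hadj W (X' (hadj X' e)) = hadj W e" unfolding X'(3) by (simp add: hadj_isom[OF X'(1)])
  then show ?thesis using e by (simp add: wandering_def X'(2))
qed

lemma bclU_wandering: "e \<in> wandering \<Longrightarrow> bclU X e \<in> wandering"
  unfolding bclU_def by (intro csubspace_add[OF wandering_csubspace] bclA_wandering bclB_wandering)

text \<open>\<open>bclP X\<close> projects onto the range of \<open>X'\<close>. On wandering vectors
  \<open>bclU X\<close> acts as \<open>X\<close> on the kernel of this projection and as the adjoint
  of \<open>X'\<close> on its range, isometrically in both cases and with orthogonal images.\<close>

lemma bclP_idem: "bclP X (bclP X e) = bclP X e" and bclP_selfadjoint: "bclP X e \<bullet> f = e \<bullet> bclP X f"
  and bclU_bclP: "bclU X (bclP X e) = bclB X e" and bclP_inner: "bclP X e \<bullet> e \<le> e \<bullet> e"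
  and bclU_norm: "e \<in> wandering \<Longrightarrow> norm (bclU X e) = norm e"
proof -
  obtain X' where X': "isom X'" "\<And>e. bclP X e = X' (hadj X' e)" "\<And>e. bclB X e = hadj X' e"
    "\<And>x. X (X' x) = W x"  "\<And>x. X' (X x) = W x"
    using complementary_factor by metis
  show "bclP X (bclP X e) = bclP X e" by (simp add: X'(2) hadj_isom[OF X'(1)])
  have i: "X' x \<bullet> y = x \<bullet> hadj X' y" for x y
    by (simp add: hadj_inner[OF clin_bl[OF isom_clin[OF X'(1)]]])
  have i': "y \<bullet> X' x = hadj X' y \<bullet> x" for x y
    using i[of x y] by (simp add: inner_commute)
  show "bclP X e \<bullet> f = e \<bullet> bclP X f" by (simp only: X'(2) i i')
  show "bclP X e \<bullet> e \<le> e \<bullet> e"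
    using power_mono[OF norm_hadj_le[OF X'(1), of e] norm_ge_zero, of 2]
    by (simp only: X'(2) i power2_norm_eq_inner)
  have bclP_bclB: "bclB X (bclP X e) = bclB X e" for e
    by (simp add: X'(2,3) hadj_isom[OF X'(1)])
  have bclA: "bclA X e = X (e - bclP X e)" for e
    by (simp add: bclA_def X'(2,3) clin_diff[OF X_clin] X'(4))
  show "bclU X (bclP X e) = bclB X e"
    unfolding bclU_def bclP_bclB bclA by (simp add: X'(2) hadj_isom[OF X'(1)] clin_0[OF X_clin])
  show "norm (bclU X e) = norm e" if e: "e \<in> wandering"
  proof -
    \<comment> \<open>Moving \<open>hadj X'\<close> across the product produces
      \<open>W (e - bclP X e) \<bullet> e\<close>, and a wandering vector is orthogonal to the range
      of \<open>W\<close>.\<close>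
    have "bclA X e \<bullet> bclB X e = X' (X (e - bclP X e)) \<bullet> e" by (simp only: bclA X'(3) i)
    also have "\<dots> = 0" using wandering_W_inner[OF e] by (simp only: X'(5))
    finally have orth: "bclA X e \<bullet> bclB X e = 0" .
    have "(norm (bclU X e))\<^sup>2 = (norm (bclA X e))\<^sup>2 + (norm (bclB X e))\<^sup>2"
      unfolding power2_norm_eq_inner bclU_def using orth
      by (simp add: inner_add_left inner_add_right inner_commute[of "bclB X e" "bclA X e"])
    also have "norm (bclA X e) = norm (e - X' (hadj X' e))" by (simp add: bclA isom_norm[OF X_isom] X'(2))
    finally show ?thesis using norm_sq_isom_split[OF X'(1), of e] by (simp add: X'(3))
  qed
qed

end

lemma bclU_inj: "divides_W X \<Longrightarrow> e \<in> wandering \<Longrightarrow> f \<in> wandering \<Longrightarrow> bclU X e = bclU X f \<Longrightarrow> e = f"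
  using bclU_norm[of X "e - f"] csubspace_diff[OF wandering_csubspace]
  by (simp add: clin_diff[OF bclU_clin[OF X_clin]])

context
  fixes X Y Z :: "'a \<Rightarrow> 'a" and e :: 'a
  assumes X: "divides_W X" and Y: "divides_W Y" and Z: "divides_W Z"
    and ZXY: "\<And>x. Z x = X (Y x)" and e: "e \<in> wandering"
begin

text \<open>Compare the two expansions of \<open>X Y e\<close> along \<open>E \<oplus> W E \<oplus> W W E\<close>; the last component vanishes because \<open>X Y\<close>
  still divides \<open>W\<close>.\<close>

lemma product_parts:
  shows "bclA Z e = bclA X (bclA Y e)" "bclB Z e = bclB X (bclA Y e) + bclA X (bclB Y e)" "bclB X (bclB Y e) = 0"
proof -
  note add = clin_add[OF isom_clin[OF W]]
  have "bclA Z e + W (bclB Z e) = X (bclA Y e + W (bclB Y e))"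
    using apply_eq_bclA_bclB[of Z e] ZXY[of e] apply_eq_bclA_bclB[of Y e] by simp
  also have "\<dots> = X (bclA Y e) + W (X (bclB Y e))"
    by (simp add: clin_add[OF X_clin[OF X]] X_W[OF X])
  also have "\<dots> = bclA X (bclA Y e) + W (bclB X (bclA Y e) + (bclA X (bclB Y e) + W (bclB X (bclB Y e))))"
    using apply_eq_bclA_bclB[of X "bclA Y e"] apply_eq_bclA_bclB[of X "bclB Y e"] by (simp add: add)
  finally have eq: "bclA Z e + W (bclB Z e) = bclA X (bclA Y e) + W (bclB X (bclA Y e) + (bclA X (bclB Y e) + W (bclB X (bclB Y e))))" .
  note u = wandering_decomposition_unique[OF eq bclA_wandering[OF Z] bclA_wandering[OF X]]
  show "bclA Z e = bclA X (bclA Y e)" by (rule u(1))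
  have "bclB Z e + W 0 = (bclB X (bclA Y e) + bclA X (bclB Y e)) + W (bclB X (bclB Y e))"
    using u(2) by (simp add: clin_0[OF isom_clin[OF W]])
  note v = wandering_decomposition_unique[OF this bclB_wandering[OF Z e]
      csubspace_add[OF wandering_csubspace bclB_wandering[OF X bclA_wandering[OF Y]] bclA_wandering[OF X]]]
  show "bclB Z e = bclB X (bclA Y e) + bclA X (bclB Y e)" "bclB X (bclB Y e) = 0" using v by simp_all
qed

text \<open>\<open>bclU\<close> is the pencil evaluated at z = 1, and the pencil of a product is the
  product of the pencils.\<close>

lemma bclU_product: "bclU Z e = bclU X (bclU Y e)"
  unfolding bclU_def[of Z] bclU_def[of Y] product_parts(1,2) clin_add[OF bclU_clin[OF X_clin[OF X]]]
  unfolding bclU_def product_parts(3) by simp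

end

lemma divides_W_W: "divides_W W"
  unfolding divides_W_def using isom_id W by blast

lemma bclU_W: "bclU W e = e" and bclP_W: "bclP W e = e"
  by (simp_all add: bclU_def bclA_def bclP_def bclB_def hadj_isom[OF W])

text \<open>The unitary of the cofactor is a right inverse, because the product of the two is
  \<open>bclU W\<close>, the identity.\<close>

lemma bclU_bij:
  assumes X: "divides_W X" shows "bclU X ` wandering = wandering"
proof
  show "bclU X ` wandering \<subseteq> wandering" using bclU_wandering[OF X] by blast
  show "wandering \<subseteq> bclU X ` wandering"
  proof
    fix e assume e: "e \<in> wandering"
    obtain X' where X': "isom X'" "\<And>x. X (X' x) = W x" "\<And>x. X' (X x) = W x"
      using X unfolding divides_W_def by metis
    have d: "divides_W X'" unfolding divides_W_def using X' X_isom[OF X] by blast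
    have "bclU X (bclU X' e) = bclU W e" by (rule bclU_product[OF X d divides_W_W _ e, symmetric]) (simp add: X'(2))
    then have "e = bclU X (bclU X' e)" by (simp add: bclU_W)
    then show "e \<in> bclU X ` wandering" using bclU_wandering[OF d e] by blast
  qed
qed

lemma bclU_unitary: "divides_W X \<Longrightarrow> unitary_on J wandering (bclU X)"
  unfolding unitary_on_def isometry_on_def
  using bclU_bij bclU_norm clin_clinear_on[OF bclU_clin[OF X_clin] bclU_wandering] by simp

text \<open>The cocycle identity for the projections. Under the injective map \<open>bclU X\<close>
  after \<open>bclU Y\<close> the left side becomes
  \<open>bclU X (bclB Y e) + bclB X (bclU Y e)\<close>. As the quadratic coefficient vanishes, this
  is the linear coefficient of the product pencil, that is \<open>bclB Z e\<close>, and so is the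
  image of the right side.\<close>

lemma bclP_product:
  assumes X: "divides_W X" and Y: "divides_W Y" and Z: "divides_W Z"
    and ZXY: "\<And>x. Z x = X (Y x)" and e: "e \<in> wandering"
  shows "bclP Y e + uadj wandering (bclU Y) (bclP X (bclU Y e)) = bclP Z e"
proof -
  note [simp] = bclP_wandering[OF X] bclP_wandering[OF Y] bclP_wandering[OF Z] bclU_wandering[OF Y] bclU_wandering[OF X] e
  define f where "f = uadj wandering (bclU Y) (bclP X (bclU Y e))"
  have "bclP X (bclU Y e) \<in> bclU Y ` wandering" by (simp add: bclU_bij[OF Y])
  then have f: "f \<in> wandering" "bclU Y f = bclP X (bclU Y e)"
    unfolding f_def uadj_def by (rule inv_into_into, rule f_inv_into_f)
  have w: "bclP Y e + f \<in> wandering" using f by (intro csubspace_add[OF wandering_csubspace]) auto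
  have "bclU X (bclU Y (bclP Y e + f)) = bclU X (bclB Y e) + bclB X (bclU Y e)"
    by (simp add: clin_add[OF bclU_clin[OF X_clin[OF X]]] clin_add[OF bclU_clin[OF X_clin[OF Y]]] f bclU_bclP[OF X] bclU_bclP[OF Y])
  also have "\<dots> = bclB Z e"
    unfolding bclU_def clin_add[OF bclB_clin[OF X_clin[OF X]]]
    using product_parts[OF X Y Z ZXY e] by (simp add: add.commute)
  also have "\<dots> = bclU X (bclU Y (bclP Z e))"
    using bclU_bclP[OF Z, of e] bclU_product[OF X Y Z ZXY, of "bclP Z e"] by simp
  finally have "bclU Y (bclP Y e + f) = bclU Y (bclP Z e)"
    by (rule bclU_inj[OF X, rotated 2]) (use w bclU_wandering[OF Y] in auto)
  then have "bclP Y e + f = bclP Z e"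
    by (rule bclU_inj[OF Y, rotated 2]) (use w in auto)
  then show ?thesis by (simp add: f_def)
qed

lemma bclP_proj: "divides_W X \<Longrightarrow> orth_proj_on J wandering (bclP X)"
  unfolding orth_proj_on_def cinner_def
  using clin_clinear_on[OF bclP_clin[OF X_clin] bclP_wandering] bclP_idem bclP_selfadjoint
  by (simp add: clin_J[OF bclP_clin[OF X_clin], symmetric])

end

section \<open>The B-C-L triple of a commuting family of isometries\<close>

context
  fixes A :: "nat \<Rightarrow> 'a \<Rightarrow> 'a" and n :: nat
  assumes A: "\<And>j. j < n \<Longrightarrow> isom (A j)"
    and comm: "\<And>i j x. i < n \<Longrightarrow> j < n \<Longrightarrow> A i (A j x) = A j (A i x)"
begin

abbreviation "Aprod \<equiv> Uprod A n"

lemma Aprod_isom: "isom Aprod" by (rule Uprod_isom[OF A])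

text \<open>\<open>X\<close> commutes with the whole product, so the cofactor on the right is one on
  the left as well: cancel \<open>X\<close> in \<open>X (X' (X x)) = X (Aprod x)\<close>.\<close>

lemma divides_Aprod_intro:
  assumes "isom X" "isom X'" "\<And>x. Aprod x = X (X' x)" "\<And>j x. j < n \<Longrightarrow> X (A j x) = A j (X x)"
  shows "divides_W Aprod X"
proof -
  have "X (X' (X x)) = X (Aprod x)" for x
    using assms(3)[of "X x"] Uprod_commute[of n X A x] assms(4) by simp
  then have "X' (X x) = Aprod x" for x using isom_inj[OF assms(1)] by blast
  then show ?thesis unfolding divides_W_def[OF Aprod_isom] using assms by metis
qed

lemma divides_A:
  assumes j: "j < n" shows "divides_W Aprod (A j)"
  by (rule divides_Aprod_intro[OF A[OF j] Uskip_isom[OF A] Uprod_Uskip[of n A j, OF comm j] comm[OF j]])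

lemma divides_A_A:
  assumes i: "i < n" and j: "j < n" and ne: "i \<noteq> j" shows "divides_W Aprod (\<lambda>x. A i (A j x))"
proof -
  \<comment> \<open>The family with \<open>A i\<close> neutralised; extracting \<open>A j\<close>
    from its product exhibits the cofactor of the pair.\<close>
  define A' where "A' = (\<lambda>l. if l = i then id else A l)"
  have A': "isom (A' l)" if "l < n" for l using A[OF that] by (simp add: A'_def id_def isom_id)
  have c': "A' l (A' m x) = A' m (A' l x)" if "l < n" "m < n" for l m x
    using comm[OF that] by (simp add: A'_def)
  have "Aprod x = A i (Uskip A i n x)" for x by (rule Uprod_Uskip[of n A i, OF comm i])
  moreover have "Uskip A i n x = A j (Uskip A' j n x)" for x
    using Uprod_Uskip[of n A' j x, OF c' j] ne by (simp add: Uskip_def[of A] A'_def)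
  ultimately have "Aprod x = A i (A j (Uskip A' j n x))" for x by simp
  then show ?thesis
    by (intro divides_Aprod_intro[OF isom_compose[OF A[OF i] A[OF j]] Uskip_isom[OF A']])
      (use comm i j in auto)
qed

lemma divides_Uprod:
  assumes "k \<le> n" shows "divides_W Aprod (Uprod A k)"
proof -
  have "\<exists>Z. isom Z \<and> (\<forall>x. Uprod A m x = Uprod A k (Z x))" if "k \<le> m" "m \<le> n" for m
    using that
  proof (induction m rule: dec_induct)
    case base
    then show ?case using isom_id by blast
  next
    case (step m)
    then obtain Z where Z: "isom Z" "\<And>x. Uprod A m x = Uprod A k (Z x)" by auto
    have "Uprod A (Suc m) x = Uprod A k (A m (Z x))" for x
      using Uprod_commute[of k "A m" A "Z x"] comm[of m] step.prems step.hyps Z(2) by simp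
    then show ?case using isom_compose[OF A Z(1), of m] step.prems by auto
  qed
  from this[OF assms order_refl] obtain Z where "isom Z" "\<And>x. Aprod x = Uprod A k (Z x)" by blast
  moreover have "Uprod A k (A j x) = A j (Uprod A k x)" if "j < n" for j x
    using Uprod_commute[of k "A j" A x] comm[OF that] assms by simp
  ultimately show ?thesis using Uprod_isom[of k A] A assms by (intro divides_Aprod_intro[of "Uprod A k" Z]) auto
qed

text \<open>Both B-C-L identities are cases of \<open>bclP_product\<close>. For a pair of indices
  the right side belongs to the product \<open>A i A j\<close>, which does not depend on the order
  and whose projection is bounded by the identity. For the long sum the partial sums are the
  projections of the partial products.\<close>

theorem BCL_triple_of_factors:
  "BCL_triple J n (wandering Aprod) (\<lambda>j. bclP Aprod (A j)) (\<lambda>j. bclU Aprod (A j))"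
proof -
  note W = Aprod_isom
  let ?U = "\<lambda>j. bclU Aprod (A j)" and ?P = "\<lambda>j. bclP Aprod (A j)" and ?E = "wandering Aprod"
  have UA: "Uprod ?U k e = bclU Aprod (Uprod A k) e" if "k \<le> n" "e \<in> ?E" for k e
    using that
  proof (induction k)
    case 0
    then show ?case by (simp add: bclU_def[OF W] bclA_def[OF W] bclB_def[OF W] wandering_def[OF W] clin_0[OF isom_clin[OF W]])
  next
    case (Suc k)
    then show ?case
      using bclU_product[OF W divides_A[of k] divides_Uprod[of k] divides_Uprod[of "Suc k"], of e] by (simp add: o_def)
  qed
  have PA: "(\<Sum>j<k. uadj ?E (Uprod ?U j) (?P j (Uprod ?U j e))) = bclP Aprod (Uprod A k) e"
    if "k \<le> n" "e \<in> ?E" for k e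
    using that
  proof (induction k)
    case 0
    have "bclP Aprod (\<lambda>x. x) e = 0" using 0
      by (simp add: bclP_def[OF W] bclB_def[OF W] wandering_def[OF W] clin_0[OF isom_clin[OF W]] clin_0[OF clin_hadj[OF clin_id]])
    then show ?case by (simp add: id_def)
  next
    case (Suc k)
    have "uadj ?E (Uprod ?U k) y = uadj ?E (bclU Aprod (Uprod A k)) y" for y
      unfolding uadj_def inv_into_def using UA[of k] Suc.prems by (metis (no_types, lifting) Suc_leD)
    then show ?case
      using Suc bclP_product[OF W divides_A[of k] divides_Uprod[of k] divides_Uprod[of "Suc k"], of e] UA[of k e] by (simp add: o_def)
  qed
  \<comment> \<open>The square of \<open>A i\<close> need not divide the product, so the diagonal
    case is handled by reflexivity.\<close>
  have AA: "bclU Aprod (A i) (bclU Aprod (A j) e) = bclU Aprod (A j) (bclU Aprod (A i) e)" if "i < n" "j < n" "e \<in> ?E" for i j e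
  proof (cases "i = j")
    case False
    have "(\<lambda>x. A i (A j x)) = (\<lambda>x. A j (A i x))" using comm that by blast
    then show ?thesis
      using bclU_product[OF W divides_A[OF that(1)] divides_A[OF that(2)] divides_A_A[OF that(1,2) False] refl that(3)]
        bclU_product[OF W divides_A[OF that(2)] divides_A[OF that(1)] divides_A_A[OF that(2,1)] refl that(3)] False by simp
  qed simp
  have PP: "?P j e + uadj ?E (?U j) (?P i (?U j e)) = bclP Aprod (\<lambda>x. A i (A j x)) e"
    if "i < n" "j < n" "i \<noteq> j" "e \<in> ?E" for i j e
    by (rule bclP_product[OF W divides_A[OF that(1)] divides_A[OF that(2)] divides_A_A[OF that(1-3)] refl that(4)])
  have sym: "(\<lambda>x. A i (A j x)) = (\<lambda>x. A j (A i x))" if "i < n" "j < n" for i j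
    using comm that by blast
  show ?thesis
    unfolding BCL_triple_def
  proof (intro conjI allI impI ballI)
    show "csubspace J ?E" by (rule wandering_csubspace[OF W])
    show "orth_proj_on J ?E (?P j)" if "j < n" for j by (rule bclP_proj[OF W divides_A[OF that]])
    show "unitary_on J ?E (?U j)" if "j < n" for j by (rule bclU_unitary[OF W divides_A[OF that]])
    show "?U i (?U j e) = ?U j (?U i e)" if "i < n" "j < n" "e \<in> ?E" for i j e by (rule AA[OF that])
    show "Uprod ?U n e = e" if "e \<in> ?E" for e using UA[OF order_refl that] by (simp add: bclU_W[OF W])
    show "(\<Sum>j<n. uadj ?E (Uprod ?U j) (?P j (Uprod ?U j e))) = e" if "e \<in> ?E" for e
      using PA[OF order_refl that] by (simp add: bclP_W[OF W])
    fix i j e assume h: "i < n" "j < n" "i \<noteq> j" "e \<in> ?E"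
    show "?P j e + uadj ?E (?U j) (?P i (?U j e)) = ?P i e + uadj ?E (?U i) (?P j (?U i e))"
      using PP[of i j e] PP[of j i e] h sym[of i j] by simp
    show "Re (cinner J (?P j e + uadj ?E (?U j) (?P i (?U j e))) e) \<le> Re (cinner J e e)"
      unfolding PP[OF h] cinner_def using bclP_inner[OF W divides_A_A[OF h(1-3)], of e] by simp
  qed
qed

end
end

section \<open>Power series and the Hardy space\<close>

lemma has_integral_cos_sin_period:
  fixes m :: int
  shows "((\<lambda>\<theta>. cos (of_int m * \<theta>)) has_integral (if m = 0 then 2 * pi else 0)) {0..2*pi}"
    and "((\<lambda>\<theta>. sin (of_int m * \<theta>)) has_integral 0) {0..2*pi}"
proof -
  have s: "sin (of_int m * (2 * pi)) = 0" "cos (of_int m * (2 * pi)) = 1"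
    using sin_integer_2pi[of "of_int m"] cos_integer_2pi[of "of_int m"] by (simp_all add: mult_ac)
  show "((\<lambda>\<theta>. cos (of_int m * \<theta>)) has_integral (if m = 0 then 2 * pi else 0)) {0..2*pi}"
  proof (cases "m = 0")
    case True
    then show ?thesis using has_integral_const_real[of "1::real" 0 "2*pi"] by simp
  next
    case False
    have "((\<lambda>\<theta>. cos (of_int m * \<theta>)) has_integral
        sin (of_int m * (2 * pi)) / of_int m - sin (of_int m * 0) / of_int m) {0..2*pi}"
    proof (rule fundamental_theorem_of_calculus)
      show "((\<lambda>\<theta>. sin (of_int m * \<theta>) / of_int m) has_vector_derivative cos (of_int m * x)) (at x within {0..2*pi})" for x
        unfolding has_real_derivative_iff_has_vector_derivative[symmetric]
        using False by (auto intro!: derivative_eq_intros)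
    qed simp
    then show ?thesis using False s by simp
  qed
  show "((\<lambda>\<theta>. sin (of_int m * \<theta>)) has_integral 0) {0..2*pi}"
  proof (cases "m = 0")
    case False
    have "((\<lambda>\<theta>. sin (of_int m * \<theta>)) has_integral
        (- cos (of_int m * (2 * pi)) / of_int m) - (- cos (of_int m * 0) / of_int m)) {0..2*pi}"
    proof (rule fundamental_theorem_of_calculus)
      show "((\<lambda>\<theta>. - cos (of_int m * \<theta>) / of_int m) has_vector_derivative sin (of_int m * x)) (at x within {0..2*pi})" for x
        unfolding has_real_derivative_iff_has_vector_derivative[symmetric]
        using False by (auto intro!: derivative_eq_intros)
    qed simp
    then show ?thesis using False s by simp
  qed simp
qed

text \<open>The partial sums are finite, so the radius can tend to 1 without exchanging a limit with
  a series. This bounds the square sum of the Taylor coefficients by the integral means over smaller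
  circles.\<close>

lemma sum_le_of_power_sum_le:
  fixes c :: "nat \<Rightarrow> real"
  assumes "\<And>r. 0 < r \<Longrightarrow> r < 1 \<Longrightarrow> (\<Sum>k<N. (r ^ k * c k)\<^sup>2) \<le> B"
  shows "(\<Sum>k<N. (c k)\<^sup>2) \<le> B"
proof -
  have "((\<lambda>r. \<Sum>k<N. (r ^ k * c k)\<^sup>2) \<longlongrightarrow> (\<Sum>k<N. (1 ^ k * c k)\<^sup>2)) (at_left (1::real))"
    by (intro tendsto_intros)
  moreover have "\<forall>\<^sub>F r in at_left 1. (\<Sum>k<N. (r ^ k * c k)\<^sup>2) \<le> B"
    by (rule eventually_mono[OF eventually_at_left_real[of 0]]) (auto intro: assms)
  ultimately have "(\<Sum>k<N. (1 ^ k * c k)\<^sup>2) \<le> B" by (rule tendsto_upperbound) simp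
  then show ?thesis by simp
qed

context chilbert
begin

lemma inner_cscale_cis:
  "cscale J (cis \<alpha>) x \<bullet> cscale J (cis \<beta>) y = cos (\<alpha> - \<beta>) * (x \<bullet> y) - sin (\<alpha> - \<beta>) * (x \<bullet> J y)"
  by (simp add: cscale_def inner_add_left inner_add_right J_inner cos_diff sin_diff algebra_simps)

lemma trig_sum_norm_integral:
  "((\<lambda>\<theta>. (norm (\<Sum>k<N. cscale J (cis (real k * \<theta>)) (b k)))\<^sup>2) has_integral
      2 * pi * (\<Sum>k<N. (norm (b k))\<^sup>2)) {0..2*pi}"
proof -
  have "(norm (\<Sum>k<N. cscale J (cis (real k * \<theta>)) (b k)))\<^sup>2 =
      (\<Sum>j<N. \<Sum>k<N. cos (of_int (int j - int k) * \<theta>) * (b j \<bullet> b k) - sin (of_int (int j - int k) * \<theta>) * (b j \<bullet> J (b k)))" for \<theta>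
    unfolding power2_norm_eq_inner inner_sum_left inner_sum_right inner_cscale_cis
    by (subst sum.swap) (simp add: left_diff_distrib)
  moreover have "((\<lambda>\<theta>. \<Sum>j<N. \<Sum>k<N. cos (of_int (int j - int k) * \<theta>) * (b j \<bullet> b k) - sin (of_int (int j - int k) * \<theta>) * (b j \<bullet> J (b k)))
      has_integral (\<Sum>j<N. \<Sum>k<N. (if int j - int k = 0 then 2 * pi else 0) * (b j \<bullet> b k) - 0 * (b j \<bullet> J (b k)))) {0..2*pi}"
    by (intro has_integral_sum has_integral_diff has_integral_mult_left has_integral_cos_sin_period finite_lessThan)
  moreover have "(\<Sum>j<N. \<Sum>k<N. (if int j - int k = 0 then 2 * pi else 0) * (b j \<bullet> b k) - 0 * (b j \<bullet> J (b k))) =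
      2 * pi * (\<Sum>k<N. (norm (b k))\<^sup>2)"
  proof -
    have "(\<Sum>k<N. (if int j - int k = 0 then 2 * pi else 0) * (b j \<bullet> b k) - 0 * (b j \<bullet> J (b k))) = 2 * pi * (norm (b j))\<^sup>2"
      if "j < N" for j
    proof -
      have "(\<Sum>k<N. (if int j - int k = 0 then 2 * pi else 0) * (b j \<bullet> b k) - 0 * (b j \<bullet> J (b k)))
          = (\<Sum>k<N. if k = j then 2 * pi * (b j \<bullet> b k) else 0)"
        by (intro sum.cong) auto
      also have "\<dots> = 2 * pi * (norm (b j))\<^sup>2" using that by (simp add: power2_norm_eq_inner)
      finally show ?thesis .
    qed
    then show ?thesis by (simp add: sum_distrib_left)
  qed
  ultimately show ?thesis by simp
qed

text \<open>The value 0 off the disc follows the normalisation in \<open>H2\<close>.\<close>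

definition pow_ser :: "(nat \<Rightarrow> 'a) \<Rightarrow> complex \<Rightarrow> 'a" where
  "pow_ser a z = (if cmod z < 1 then \<Sum>k. cscale J (z ^ k) (a k) else 0)"

definition radius_one :: "(nat \<Rightarrow> 'a) \<Rightarrow> bool" where
  "radius_one a \<longleftrightarrow> (\<forall>r. 0 \<le> r \<and> r < 1 \<longrightarrow> summable (\<lambda>k. r ^ k * norm (a k)))"

lemma pow_ser_summable:
  assumes "radius_one a" "cmod z < 1"
  shows "summable (\<lambda>k. cscale J (z ^ k) (a k))"
  by (rule summable_norm_cancel_complete)
    (use assms in \<open>simp add: norm_cscale norm_power radius_one_def\<close>)

lemma radius_one_bounded:
  assumes "\<And>k. norm (a k) \<le> C" shows "radius_one a"
  unfolding radius_one_def
proof (intro allI impI)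
  fix r :: real assume r: "0 \<le> r \<and> r < 1"
  have "summable (\<lambda>k. r ^ k * C)" using r by (intro summable_mult2 summable_geometric) auto
  then show "summable (\<lambda>k. r ^ k * norm (a k))"
    by (rule summable_comparison_test[rotated]) (use assms r in \<open>auto intro!: mult_left_mono\<close>)
qed

lemma square_summable_bounded:
  assumes "summable (\<lambda>k. (norm (a k))\<^sup>2)"
  obtains C where "\<And>k. norm (a k :: 'a) \<le> C"
proof -
  have "norm (a k) \<le> sqrt (\<Sum>k. (norm (a k))\<^sup>2)" for k
    using sum_le_suminf[OF assms, of "{k}"] by (intro real_le_rsqrt) auto
  then show ?thesis using that by blast
qed

text \<open>Parseval's identity. The trigonometric partial sums converge uniformly in the angle,
  hence so do their squared norms, and the limit is exchanged with the integral of a real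
  function.\<close>

lemma h2mean_pow_ser:
  assumes a: "radius_one a" and r: "0 < r" "r < 1"
  shows "h2mean (pow_ser a) r = (\<Sum>k. (r ^ k * norm (a k))\<^sup>2)" "summable (\<lambda>k. (r ^ k * norm (a k))\<^sup>2)"
proof -
  define b where "b k = r ^ k *\<^sub>R a k" for k
  define g where "g \<theta> = pow_ser a (complex_of_real r * cis \<theta>)" for \<theta>
  define h where "h N \<theta> = (\<Sum>k<N. cscale J (cis (real k * \<theta>)) (b k))" for N \<theta>
  have nb: "norm (b k) = r ^ k * norm (a k)" for k using r by (simp add: b_def)
  have sb: "summable (\<lambda>k. norm (b k))" using a r unfolding radius_one_def nb by simp
  have tm: "cscale J ((complex_of_real r * cis \<theta>) ^ k) (a k) = cscale J (cis (real k * \<theta>)) (b k)" for k \<theta>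
  proof -
    have "(complex_of_real r * cis \<theta>) ^ k = cis (real k * \<theta>) * complex_of_real (r ^ k)"
      by (simp add: power_mult_distrib Complex.DeMoivre)
    then show ?thesis by (simp only: b_def cscale_cscale[symmetric] cscale_of_real)
  qed
  have g: "g \<theta> = (\<Sum>k. cscale J (cis (real k * \<theta>)) (b k))" for \<theta>
    unfolding g_def pow_ser_def tm using r by (simp add: norm_mult)
  have sg: "summable (\<lambda>k. cscale J (cis (real k * \<theta>)) (b k))" for \<theta>
    by (rule summable_norm_cancel_complete) (simp add: norm_cscale sb)
  define S where "S = (\<Sum>k. norm (b k))"
  \<comment> \<open>The tail of the series of norms: an error bound that does not depend on the
    angle.\<close>
  define tl where "tl N = S - (\<Sum>k<N. norm (b k))" for N
  have tail: "norm (g \<theta> - h N \<theta>) \<le> tl N" for N \<theta>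
  proof -
    have "g \<theta> - h N \<theta> = (\<Sum>k. cscale J (cis (real (k + N) * \<theta>)) (b (k + N)))"
      unfolding g h_def by (rule suminf_minus_initial_segment[OF sg, symmetric])
    also have "norm \<dots> \<le> (\<Sum>k. norm (b (k + N)))"
      by (rule norm_suminf_le_complete(2)) (simp_all add: norm_cscale summable_ignore_initial_segment[OF sb])
    also have "\<dots> = S - (\<Sum>k<N. norm (b k))" unfolding S_def by (rule suminf_minus_initial_segment[OF sb])
    finally show ?thesis by (simp add: tl_def)
  qed
  have gS: "norm (g \<theta>) \<le> S" for \<theta> using tail[of \<theta> 0] by (simp add: h_def tl_def)
  have hS: "norm (h N \<theta>) \<le> S" for N \<theta>
  proof -
    have "norm (h N \<theta>) \<le> (\<Sum>k<N. norm (b k))"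
      unfolding h_def by (rule order_trans[OF norm_sum]) (simp add: norm_cscale)
    also have "\<dots> \<le> S" unfolding S_def by (rule sum_le_suminf[OF sb]) auto
    finally show ?thesis .
  qed
  have diff: "\<bar>(norm (h N \<theta>))\<^sup>2 - (norm (g \<theta>))\<^sup>2\<bar> \<le> (tl N) * (2 * S)" for N \<theta>
  proof -
    have "(norm (h N \<theta>))\<^sup>2 - (norm (g \<theta>))\<^sup>2 = (norm (h N \<theta>) - norm (g \<theta>)) * (norm (h N \<theta>) + norm (g \<theta>))"
      by (simp add: power2_eq_square algebra_simps)
    then have "\<bar>(norm (h N \<theta>))\<^sup>2 - (norm (g \<theta>))\<^sup>2\<bar> = \<bar>norm (h N \<theta>) - norm (g \<theta>)\<bar> * (norm (h N \<theta>) + norm (g \<theta>))"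
      by (simp add: abs_mult)
    also have "\<dots> \<le> (tl N) * (2 * S)"
    proof (rule mult_mono)
      show "\<bar>norm (h N \<theta>) - norm (g \<theta>)\<bar> \<le> tl N"
        using norm_triangle_ineq3[of "h N \<theta>" "g \<theta>"] tail[of \<theta> N] by (simp add: norm_minus_commute)
      then show "0 \<le> tl N" by linarith
    qed (use gS[of \<theta>] hS[of N \<theta>] in auto)
    finally show ?thesis .
  qed
  have lim0: "(\<lambda>N. (tl N) * (2 * S)) \<longlonglongrightarrow> 0"
  proof -
    have "(\<lambda>N. (tl N) * (2 * S)) \<longlonglongrightarrow> (S - S) * (2 * S)"
      unfolding S_def tl_def by (intro tendsto_intros summable_LIMSEQ sb)
    then show ?thesis by simp
  qed
  have ul: "uniform_limit {0..2*pi} (\<lambda>N \<theta>. (norm (h N \<theta>))\<^sup>2) (\<lambda>\<theta>. (norm (g \<theta>))\<^sup>2) sequentially"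
  proof (rule uniform_limitI)
    fix e :: real assume "e > 0"
    then have "\<forall>\<^sub>F N in sequentially. (tl N) * (2 * S) < e"
      by (rule order_tendstoD(2)[OF lim0])
    then show "\<forall>\<^sub>F N in sequentially. \<forall>\<theta>\<in>{0..2*pi}. dist ((norm (h N \<theta>))\<^sup>2) ((norm (g \<theta>))\<^sup>2) < e"
    proof eventually_elim
      case (elim N)
      then show ?case using diff[of N] unfolding dist_real_def by (meson le_less_trans)
    qed
  qed
  have cont: "continuous_on {0..2*pi} (\<lambda>\<theta>. (norm (h N \<theta>))\<^sup>2)" for N
    unfolding h_def cscale_def by (intro continuous_intros)
  obtain I K where I: "\<And>N. ((\<lambda>\<theta>. (norm (h N \<theta>))\<^sup>2) has_integral I N) {0..2*pi}"
    and K: "((\<lambda>\<theta>. (norm (g \<theta>))\<^sup>2) has_integral K) {0..2*pi}" and IK: "I \<longlonglongrightarrow> K"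
    using uniform_limit_integral[OF ul cont sequentially_bot] by blast
  have "I N = 2 * pi * (\<Sum>k<N. (norm (b k))\<^sup>2)" for N
    using has_integral_unique[OF I] trig_sum_norm_integral[where N = N and b = b] unfolding h_def by blast
  then have "I = (\<lambda>N. 2 * pi * (\<Sum>k<N. (norm (b k))\<^sup>2))" by (rule ext)
  then have "(\<lambda>N. 2 * pi * (\<Sum>k<N. (norm (b k))\<^sup>2) / (2 * pi)) \<longlonglongrightarrow> K / (2 * pi)"
    using tendsto_divide[OF IK tendsto_const[of "2 * pi"]] by simp
  then have "(\<lambda>k. (norm (b k))\<^sup>2) sums (K / (2 * pi))" unfolding sums_def by simp
  moreover have "h2mean (pow_ser a) r = K / (2 * pi)"
    unfolding h2mean_def g_def[symmetric] using integral_unique[OF K] by simp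
  ultimately show "h2mean (pow_ser a) r = (\<Sum>k. (r ^ k * norm (a k))\<^sup>2)" "summable (\<lambda>k. (r ^ k * norm (a k))\<^sup>2)"
    unfolding nb by (auto simp: sums_iff)
qed

lemma pow_ser_cholo:
  assumes a: "\<And>k. norm (a k) \<le> C" shows "cholo_on J (pow_ser a) (ball 0 1)"
  unfolding cholo_on_def
proof
  fix z :: complex assume "z \<in> ball 0 1"
  then have z: "cmod z < 1" by simp
  \<comment> \<open>\<open>K\<close> is the midpoint of \<open>cmod z\<close> and 1, hence at least
    1/2. Therefore \<open>K ^ (k - 1)\<close> and \<open>K ^ (k - 2)\<close> are at most
    \<open>4 * K ^ k\<close>, and a single majorant serves the derivative series and the
    remainders.\<close>
  define \<delta> where "\<delta> = (1 - cmod z) / 2"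
  define K where "K = cmod z + \<delta>"
  have \<delta>: "\<delta> > 0" and K: "1 / 2 \<le> K" "0 < K" "K < 1" "cmod z \<le> K"
    using z add_pos_nonneg[of 1 "cmod z"] by (auto simp: K_def \<delta>_def field_simps)
  have Kpow: "K ^ (k - i) \<le> 4 * K ^ k" if "i \<le> 2" for k i
  proof -
    have "(1 / 2)\<^sup>2 \<le> K\<^sup>2" using K by (intro power_mono) auto
    then have "K ^ (k - i) * 1 \<le> K ^ (k - i) * (4 * K\<^sup>2)"
      using K by (intro mult_left_mono) (auto simp: power2_eq_square)
    also have "\<dots> = 4 * K ^ (k - i + 2)" by (simp add: power_add power2_eq_square)
    also have "\<dots> \<le> 4 * K ^ k" using K that by (intro mult_left_mono power_decreasing) auto
    finally show ?thesis by simp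
  qed
  have C: "C \<ge> 0" using order_trans[OF norm_ge_zero a] .
  note ro = radius_one_bounded[of a, OF a]
  define v where "v = (\<Sum>k. cscale J (of_nat k * z ^ (k - 1)) (a k))"
  let ?f' = "\<lambda>k h. cscale J (of_nat k * z ^ (k - 1) * h) (a k)"
  have sK: "summable (\<lambda>k. (2 * real k + 1)\<^sup>2 * K ^ k * (4 * C))"
    by (intro summable_mult2 summable_sq_power) (use K in auto)
  have sv: "summable (\<lambda>k. cscale J (of_nat k * z ^ (k - 1)) (a k))"
  proof (rule norm_suminf_le_complete(1)[OF _ sK])
    fix k
    have "norm (cscale J (of_nat k * z ^ (k - 1)) (a k)) \<le> real k * K ^ (k - 1) * C"
      unfolding norm_cscale norm_mult norm_power norm_of_nat
      using K a C by (intro mult_mono power_mono) auto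
    also have "\<dots> \<le> (2 * real k + 1)\<^sup>2 * (4 * K ^ k) * C"
    proof (intro mult_right_mono mult_mono Kpow)
      have "2 * real k + 1 \<le> (2 * real k + 1)\<^sup>2" by (rule self_le_power) auto
      then show "real k \<le> (2 * real k + 1)\<^sup>2" by linarith
    qed (use K C in auto)
    finally show "norm (cscale J (of_nat k * z ^ (k - 1)) (a k)) \<le> (2 * real k + 1)\<^sup>2 * K ^ k * (4 * C)" by simp
  qed
  have f': "?f' k h = cscale J h (cscale J (of_nat k * z ^ (k - 1)) (a k))" for k h
    by (simp add: cscale_cscale mult.commute)
  have sf': "summable (\<lambda>k. ?f' k h)" for h
    unfolding f' by (rule bounded_linear.summable[OF cscale_bounded_linear sv])
  have vh: "(\<Sum>k. ?f' k h) = cscale J h v" for h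
    unfolding f' v_def by (rule bounded_linear.suminf[OF cscale_bounded_linear sv, symmetric])
  have "((\<lambda>w. \<Sum>k. cscale J (w ^ k) (a k)) has_derivative (\<lambda>h. \<Sum>k. ?f' k h)) (at z)"
  proof (rule series_has_derivative_quadratic[OF UNIV_I _ \<delta> sf'])
    have in1: "cmod w < 1" "cmod w \<le> K" if "dist w z < \<delta>" for w
    proof -
      have "cmod w \<le> cmod z + cmod (w - z)" using norm_triangle_ineq[of z "w - z"] by simp
      then show "cmod w \<le> K" using that by (simp add: K_def dist_norm)
      then show "cmod w < 1" using K by linarith
    qed
    show "summable (\<lambda>k. cscale J (w ^ k) (a k))" if "dist w z < \<delta>" for w
      by (rule pow_ser_summable[OF ro in1(1)[OF that]])
    show "bounded_linear (\<lambda>h. \<Sum>k. ?f' k h)" unfolding vh by (rule cscale_bounded_linear_left)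
    show "summable (\<lambda>k. (2 * real k + 1)\<^sup>2 * K ^ k * (4 * C))" by (rule sK)
    show "0 \<le> (2 * real k + 1)\<^sup>2 * K ^ k * (4 * C)" for k using K C by simp
    fix k w assume w: "dist w z < \<delta>"
    have "cscale J (w ^ k) (a k) - cscale J (z ^ k) (a k) - ?f' k (w - z)
        = cscale J (w ^ k - z ^ k - of_nat k * z ^ (k - 1) * (w - z)) (a k)"
      by (simp add: cscale_diff_left)
    then have "norm (cscale J (w ^ k) (a k) - cscale J (z ^ k) (a k) - ?f' k (w - z))
        = cmod (w ^ k - z ^ k - of_nat k * z ^ (k - 1) * (w - z)) * norm (a k)"
      by (simp only: norm_cscale)
    also have "\<dots> \<le> (real k * real (k - 1) * K ^ (k - 2) * (norm (w - z))\<^sup>2) * C"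
    proof (rule mult_mono[OF _ a])
      show "cmod (w ^ k - z ^ k - of_nat k * z ^ (k - 1) * (w - z)) \<le> real k * real (k - 1) * K ^ (k - 2) * (norm (w - z))\<^sup>2"
      proof (cases "w = z")
        case False
        define h where "h = w - z"
        have h: "h \<noteq> 0" "w = z + h" using False by (auto simp: h_def)
        have "cmod (((z + h) ^ k - z ^ k) / h - of_nat k * z ^ (k - Suc 0)) \<le> real k * real (k - Suc 0) * K ^ (k - 2) * cmod h"
          using lemma_termdiff3[OF h(1) K(4), of k] in1(2)[OF w] h(2) by simp
        then have "cmod (((z + h) ^ k - z ^ k) / h - of_nat k * z ^ (k - Suc 0)) * cmod h
            \<le> real k * real (k - Suc 0) * K ^ (k - 2) * cmod h * cmod h"
          by (rule mult_right_mono) simp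
        moreover have "(((z + h) ^ k - z ^ k) / h - of_nat k * z ^ (k - Suc 0)) * h = w ^ k - z ^ k - of_nat k * z ^ (k - 1) * (w - z)"
        proof -
          have "(u / h - v) * h = u - v * h" for u v using h(1) by (simp add: left_diff_distrib)
          then show ?thesis using h(2) by simp
        qed
        ultimately show ?thesis by (simp add: h_def power2_eq_square mult.assoc flip: norm_mult)
      qed (cases k, auto)
    qed (use K in auto)
    also have "\<dots> \<le> ((2 * real k + 1)\<^sup>2 * K ^ k * (4 * C)) * (norm (w - z))\<^sup>2"
    proof -
      have "real k * real (k - 1) \<le> (2 * real k + 1)\<^sup>2"
        unfolding power2_eq_square by (intro mult_mono) auto
      then have "real k * real (k - 1) * K ^ (k - 2) * (C * (norm (w - z))\<^sup>2) \<le> (2 * real k + 1)\<^sup>2 * (4 * K ^ k) * (C * (norm (w - z))\<^sup>2)"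
        using C K by (intro mult_right_mono mult_mono Kpow) auto
      then show ?thesis by (simp add: mult_ac)
    qed
    finally show "norm (cscale J (w ^ k) (a k) - cscale J (z ^ k) (a k) - ?f' k (w - z))
        \<le> ((2 * real k + 1)\<^sup>2 * K ^ k * (4 * C)) * (norm (w - z))\<^sup>2" .
  qed
  then have "((\<lambda>w. \<Sum>k. cscale J (w ^ k) (a k)) has_derivative (\<lambda>h. cscale J h v)) (at z)"
    unfolding vh .
  then have "(pow_ser a has_derivative (\<lambda>h. cscale J h v)) (at z)"
    by (rule has_derivative_transform_within_open[of _ _ _ UNIV "ball 0 1"]) (use z in \<open>auto simp: pow_ser_def\<close>)
  then show "\<exists>v. (pow_ser a has_derivative (\<lambda>h. cscale J h v)) (at z)" by blast
qed

lemma pow_ser_in_subspace: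
  assumes E: "csubspace J E" and a: "\<And>k. a k \<in> E" and r: "radius_one a"
  shows "pow_ser a z \<in> E"
proof (cases "cmod z < 1")
  case True
  have "(\<Sum>k. cscale J (z ^ k) (a k)) \<in> E" by (rule csubspace_suminf[OF E a pow_ser_summable[OF r True]])
  then show ?thesis using True by (simp add: pow_ser_def)
qed (simp add: pow_ser_def csubspace_0[OF E])

lemma pow_ser_H2:
  assumes E: "csubspace J E" and aE: "\<And>k. a k \<in> E" and a: "summable (\<lambda>k. (norm (a k))\<^sup>2)"
  shows "pow_ser a \<in> H2 J E" "H2norm (pow_ser a) = sqrt (\<Sum>k. (norm (a k))\<^sup>2)"
proof -
  obtain C where C: "\<And>k. norm (a k) \<le> C" using square_summable_bounded[OF a] by blast
  note r1 = radius_one_bounded[of a, OF C]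
  define S where "S = (\<Sum>k. (norm (a k))\<^sup>2)"
  have le: "h2mean (pow_ser a) r \<le> S" if r: "0 < r" "r < 1" for r
  proof -
    have "(r ^ k * norm (a k))\<^sup>2 \<le> (norm (a k))\<^sup>2" for k
      using r by (intro power_mono mult_left_le_one_le power_le_one) auto
    then show ?thesis unfolding h2mean_pow_ser(1)[OF r1 r] S_def
      using h2mean_pow_ser(2)[OF r1 r] a by (intro suminf_le) auto
  qed
  have bdd: "bdd_above (h2mean (pow_ser a) ` {0<..<1})"
    by (rule bdd_aboveI[of _ S]) (use le in auto)
  show "pow_ser a \<in> H2 J E"
    unfolding H2_def
    by (intro CollectI conjI allI impI pow_ser_in_subspace[OF E aE r1] pow_ser_cholo[of a C, OF C] bdd)
      (simp add: pow_ser_def)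
  have "Sup (h2mean (pow_ser a) ` {0<..<1}) = S"
  proof (rule antisym)
    show "Sup (h2mean (pow_ser a) ` {0<..<1}) \<le> S"
      by (rule cSup_least) (use le in \<open>auto simp: dense\<close>)
    show "S \<le> Sup (h2mean (pow_ser a) ` {0<..<1})"
      unfolding S_def
    proof (rule suminf_le_const[OF a])
      fix N
      show "(\<Sum>k<N. (norm (a k))\<^sup>2) \<le> Sup (h2mean (pow_ser a) ` {0<..<1})"
      proof (rule sum_le_of_power_sum_le)
        fix r :: real assume r: "0 < r" "r < 1"
        have "(\<Sum>k<N. (r ^ k * norm (a k))\<^sup>2) \<le> h2mean (pow_ser a) r"
          using h2mean_pow_ser[OF r1 r] by (auto intro!: sum_le_suminf)
        also have "\<dots> \<le> Sup (h2mean (pow_ser a) ` {0<..<1})" using r bdd by (intro cSup_upper) auto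
        finally show "(\<Sum>k<N. (r ^ k * norm (a k))\<^sup>2) \<le> Sup (h2mean (pow_ser a) ` {0<..<1})" .
      qed
    qed
  qed
  then show "H2norm (pow_ser a) = sqrt (\<Sum>k. (norm (a k))\<^sup>2)" by (simp add: H2norm_def S_def)
qed


section \<open>Taylor coefficients of vector-valued holomorphic functions\<close>

lemma cinner_add_left: "cinner J (x + x') y = cinner J x y + cinner J x' y"
  and cinner_add_right: "cinner J x (y + y') = cinner J x y + cinner J x y'"
  and cinner_scaleR_right: "cinner J x (c *\<^sub>R y) = of_real c * cinner J x y"
  and cinner_J_right: "cinner J x (J y) = - \<i> * cinner J x y"
  and cinner_cscale_left: "cinner J (cscale J h x) y = h * cinner J x y"
  by (simp_all add: cinner_def cscale_def complex_eq_iff inner_add_left inner_add_right J_add J_scaleR J_inner algebra_simps)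

lemma norm_cinner_le: "cmod (cinner J x y) \<le> 2 * norm x * norm y"
proof -
  have "\<bar>x \<bullet> y\<bar> \<le> norm x * norm y" "\<bar>x \<bullet> J y\<bar> \<le> norm x * norm y"
    using Cauchy_Schwarz_ineq2[of x y] Cauchy_Schwarz_ineq2[of x "J y"] by simp_all
  then show ?thesis using cmod_le[of "cinner J x y"] by (simp add: cinner_def)
qed

lemma cinner_bounded_linear_left: "bounded_linear (\<lambda>x. cinner J x y)"
proof (rule bounded_linear_intro)
  show "cinner J (x + x') y = cinner J x y + cinner J x' y" for x x' by (rule cinner_add_left)
  show "cinner J (r *\<^sub>R x) y = r *\<^sub>R cinner J x y" for r x
    by (simp add: cinner_def complex_eq_iff)
  show "norm (cinner J x y) \<le> norm x * (2 * norm y)" for x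
    using norm_cinner_le[of x y] by (simp add: mult_ac)
qed

lemma cinner_ext: "(\<And>y. cinner J x y = cinner J x' y) \<Longrightarrow> x = x'"
  by (rule inner_ext) (simp add: cinner_def inner_commute)

lemma cholo_cinner_holomorphic:
  assumes "cholo_on J f S" "open S" shows "(\<lambda>z. cinner J (f z) y) holomorphic_on S"
  unfolding holomorphic_on_open[OF assms(2)]
proof
  fix z assume "z \<in> S"
  then obtain v where "(f has_derivative (\<lambda>h. cscale J h v)) (at z)"
    using assms(1) unfolding cholo_on_def by blast
  from bounded_linear.has_derivative[OF cinner_bounded_linear_left this]
  have "((\<lambda>z. cinner J (f z) y) has_field_derivative cinner J v y) (at z)"
    unfolding has_field_derivative_def
    by (rule has_derivative_eq_rhs) (auto simp: fun_eq_iff cinner_cscale_left)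
  then show "\<exists>f'. ((\<lambda>z. cinner J (f z) y) has_field_derivative f') (at z)" by blast
qed

text \<open>The scalar functions \<open>cinner J (f z) y\<close> have Taylor coefficients that depend boundedly and conjugate-linearly on \<open>y\<close>;
  Riesz representation turns them into vectors.\<close>

lemma cholo_power_series:
  assumes f: "cholo_on J f (ball 0 1)"
  obtains a where "radius_one a" "\<And>z. cmod z < 1 \<Longrightarrow> f z = (\<Sum>k. cscale J (z ^ k) (a k))"
    "\<And>k y. (\<And>z. cmod z < 1 \<Longrightarrow> f z \<bullet> y = 0 \<and> f z \<bullet> J y = 0) \<Longrightarrow> a k \<bullet> y = 0"
proof -
  define g where "g y z = cinner J (f z) y" for y z
  define c where "c k y = (deriv ^^ k) (g y) 0 / fact k" for k y
  have hol: "g y holomorphic_on ball 0 1" for y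
    unfolding g_def by (rule cholo_cinner_holomorphic[OF f open_ball])
  have z0: "(0::complex) \<in> ball 0 1" by simp
  have contf: "continuous_on (ball 0 1) f"
    using f unfolding cholo_on_def
    by (intro continuous_at_imp_continuous_on ballI) (metis has_derivative_continuous)
  have "\<exists>M. 0 \<le> M \<and> (\<forall>k y. cmod (c k y) \<le> M / \<rho> ^ k * norm y)" if \<rho>: "0 < \<rho>" "\<rho> < 1" for \<rho>
  proof -
    have sub: "cball 0 \<rho> \<subseteq> ball (0::complex) 1" using \<rho> by auto
    have "bounded (f ` cball 0 \<rho>)"
      by (intro compact_imp_bounded compact_continuous_image continuous_on_subset[OF contf sub] compact_cball)
    then obtain B where B: "\<And>z. z \<in> cball 0 \<rho> \<Longrightarrow> norm (f z) \<le> B" unfolding bounded_iff by blast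
    have B0: "B \<ge> 0" using order_trans[OF norm_ge_zero B[of 0]] \<rho> by simp
    have "cmod (c k y) \<le> 2 * B / \<rho> ^ k * norm y" for k y
    proof -
      have "cmod ((deriv ^^ k) (g y) 0) \<le> fact k * (2 * B * norm y) / \<rho> ^ k"
      proof (rule Cauchy_inequality)
        show "g y holomorphic_on ball 0 \<rho>" by (rule holomorphic_on_subset[OF hol]) (use \<rho> in auto)
        show "continuous_on (cball 0 \<rho>) (g y)"
          by (rule continuous_on_subset[OF holomorphic_on_imp_continuous_on[OF hol] sub])
        show "cmod (g y x) \<le> 2 * B * norm y" if "cmod (0 - x) = \<rho>" for x
        proof -
          have "norm (f x) \<le> B" using B[of x] that by simp
          then have "2 * norm (f x) * norm y \<le> 2 * B * norm y" by (intro mult_right_mono) auto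
          then show ?thesis using norm_cinner_le[of "f x" y] by (simp add: g_def)
        qed
      qed (use \<rho> in auto)
      then have "cmod ((deriv ^^ k) (g y) 0) / fact k \<le> (fact k * (2 * B * norm y) / \<rho> ^ k) / fact k"
        by (rule divide_right_mono) simp
      then show ?thesis by (simp add: c_def norm_divide)
    qed
    then show ?thesis using B0 by (intro exI[of _ "2 * B"]) auto
  qed
  then obtain M where M: "\<And>\<rho>. 0 < \<rho> \<Longrightarrow> \<rho> < 1 \<Longrightarrow> 0 \<le> M \<rho>"
    "\<And>\<rho> k y. 0 < \<rho> \<Longrightarrow> \<rho> < 1 \<Longrightarrow> cmod (c k y) \<le> M \<rho> / \<rho> ^ k * norm y" by metis
  have c_add: "c k (y + y') = c k y + c k y'" for k y y'
  proof -
    have "g (y + y') = (\<lambda>z. g y z + g y' z)" by (simp add: g_def cinner_add_right fun_eq_iff)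
    then show ?thesis
      using higher_deriv_add[OF hol hol open_ball z0] by (simp add: c_def add_divide_distrib)
  qed
  have c_scale: "c k y' = u * c k y" if "\<And>z. g y' z = u * g y z" for k y y' u
  proof -
    have "g y' = (\<lambda>z. u * g y z)" using that by (rule ext)
    then show ?thesis
      using higher_deriv_cmult[OF hol z0 open_ball] by (simp add: c_def)
  qed
  have c_scaleR: "c k (r *\<^sub>R y) = of_real r * c k y" for k r y
    by (rule c_scale) (simp add: g_def cinner_scaleR_right)
  have c_J: "c k (J y) = - \<i> * c k y" for k y
    by (rule c_scale) (simp add: g_def cinner_J_right)
  have "\<exists>v. \<forall>y. c k y = cinner J v y" for k
  proof -
    \<comment> \<open>Real Riesz representation is applied to the real part; replacing
      \<open>y\<close> by \<open>J y\<close> multiplies \<open>c k y\<close> by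
      \<open>- \<i>\<close>, which recovers the imaginary part from the same vector.\<close>
    have "bounded_linear (\<lambda>y. Re (c k y))"
    proof (rule bounded_linear_intro)
      show "norm (Re (c k y)) \<le> norm y * (M (1/2) / (1/2) ^ k)" for y
        using M(2)[of "1/2" k y] abs_Re_le_cmod[of "c k y"] by (simp add: mult.commute)
    qed (simp_all add: c_add c_scaleR)
    then obtain v where v: "\<And>y. Re (c k y) = v \<bullet> y" using riesz_representation by blast
    have "Im (c k y) = v \<bullet> J y" for y using v[of "J y"] by (simp add: c_J)
    then show ?thesis using v by (intro exI[of _ v]) (simp add: cinner_def complex_eq_iff)
  qed
  then obtain a where a: "\<And>k y. c k y = cinner J (a k) y" by metis
  have norm_a: "norm (a k) \<le> M \<rho> / \<rho> ^ k" if "0 < \<rho>" "\<rho> < 1" for \<rho> k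
  proof (cases "a k = 0")
    case True
    then show ?thesis using M(1)[OF that] that by simp
  next
    case False
    have "norm (a k) * norm (a k) = Re (c k (a k))"
      by (simp add: a cinner_def power2_norm_eq_inner flip: power2_eq_square)
    also have "\<dots> \<le> M \<rho> / \<rho> ^ k * norm (a k)"
      using M(2)[OF that, of k "a k"] complex_Re_le_cmod[of "c k (a k)"] by linarith
    finally show ?thesis using False by (meson mult_right_le_imp_le zero_less_norm_iff)
  qed
  have ro: "radius_one a" unfolding radius_one_def
  proof (intro allI impI)
    fix r :: real assume r: "0 \<le> r \<and> r < 1"
    \<comment> \<open>A radius strictly between \<open>r\<close> and 1: the Cauchy bound at
      \<open>\<rho>\<close> leaves a geometric series of ratio \<open>r / \<rho>\<close>.\<close>
    define \<rho> where "\<rho> = (r + 1) / 2"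
    have \<rho>: "0 < \<rho>" "\<rho> < 1" "r < \<rho>" using r by (auto simp: \<rho>_def)
    have "summable (\<lambda>k. (r / \<rho>) ^ k * M \<rho>)"
      using r \<rho> by (intro summable_mult2 summable_geometric) auto
    then show "summable (\<lambda>k. r ^ k * norm (a k))"
    proof (rule summable_comparison_test[rotated], intro exI allI impI)
      fix k
      have "r ^ k * norm (a k) \<le> r ^ k * (M \<rho> / \<rho> ^ k)"
        using r norm_a[OF \<rho>(1,2)] by (intro mult_left_mono) auto
      then show "norm (r ^ k * norm (a k)) \<le> (r / \<rho>) ^ k * M \<rho>"
        using r by (simp add: power_divide)
    qed
  qed
  have fz: "f z = (\<Sum>k. cscale J (z ^ k) (a k))" if z: "cmod z < 1" for z
  proof (rule cinner_ext)
    fix y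
    have "(\<lambda>k. (deriv ^^ k) (g y) 0 / fact k * (z - 0) ^ k) sums g y z"
      by (rule holomorphic_power_series[OF hol]) (use z in auto)
    moreover have "(deriv ^^ k) (g y) 0 / fact k * (z - 0) ^ k = cinner J (cscale J (z ^ k) (a k)) y" for k
      unfolding c_def[symmetric] a cinner_cscale_left by simp
    ultimately have "(\<lambda>k. cinner J (cscale J (z ^ k) (a k)) y) sums cinner J (f z) y" by (simp add: g_def)
    moreover have "(\<lambda>k. cinner J (cscale J (z ^ k) (a k)) y) sums cinner J (\<Sum>k. cscale J (z ^ k) (a k)) y"
      by (intro bounded_linear.sums[OF cinner_bounded_linear_left] summable_sums pow_ser_summable[OF ro z])
    ultimately show "cinner J (f z) y = cinner J (\<Sum>k. cscale J (z ^ k) (a k)) y" by (rule sums_unique2)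
  qed
  \<comment> \<open>Orthogonality to all values passes to the coefficients; this is how a closed
    subspace containing the values is later seen to contain the coefficients.\<close>
  have orth: "a k \<bullet> y = 0" if "\<And>z. cmod z < 1 \<Longrightarrow> f z \<bullet> y = 0 \<and> f z \<bullet> J y = 0" for k y
  proof -
    have "(deriv ^^ k) (g y) 0 = (deriv ^^ k) (\<lambda>_. 0) 0"
      by (rule higher_deriv_transform_within_open[OF hol _ open_ball z0])
        (use that in \<open>auto simp: g_def cinner_eq_0_iff\<close>)
    then have "c k y = 0" by (simp add: c_def)
    then show ?thesis by (simp add: a cinner_eq_0_iff)
  qed
  show ?thesis using that[OF ro fz orth] by blast
qed

text \<open>The coefficients are orthogonal to everything orthogonal to \<open>E\<close>, hence lie
  in the double complement of \<open>E\<close>, which is \<open>E\<close>. Bounded integral means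
  bound their square sums.\<close>

lemma H2_eq_pow_ser:
  assumes E: "csubspace J E" and f: "f \<in> H2 J E"
  obtains a where "\<And>k. a k \<in> E" "summable (\<lambda>k. (norm (a k))\<^sup>2)" "f = pow_ser a"
proof -
  have f0: "\<And>z. 1 \<le> cmod z \<Longrightarrow> f z = 0" and fE: "\<And>z. cmod z < 1 \<Longrightarrow> f z \<in> E"
    and fh: "cholo_on J f (ball 0 1)" and fb: "bdd_above (h2mean f ` {0<..<1})"
    using f unfolding H2_def by auto
  obtain a where a: "radius_one a" "\<And>z. cmod z < 1 \<Longrightarrow> f z = (\<Sum>k. cscale J (z ^ k) (a k))"
    "\<And>k y. (\<And>z. cmod z < 1 \<Longrightarrow> f z \<bullet> y = 0 \<and> f z \<bullet> J y = 0) \<Longrightarrow> a k \<bullet> y = 0"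
    using cholo_power_series[OF fh] by metis
  have fp: "f = pow_ser a" using a(2) f0 by (auto simp: pow_ser_def fun_eq_iff)
  obtain B where "\<forall>u\<in>h2mean f ` {0<..<1}. u \<le> B" using fb unfolding bdd_above_def by blast
  then have B: "h2mean f r \<le> B" if "0 < r" "r < 1" for r using that by simp
  have "a k \<in> E" for k
  proof -
    have "a k \<bullet> y = 0" if y: "y \<in> ocompl J UNIV E" for y
    proof (rule a(3))
      fix z :: complex assume "cmod z < 1"
      moreover have "J y \<in> ocompl J UNIV E" by (rule csubspace_J[OF csubspace_ocompl[OF E] y])
      ultimately show "f z \<bullet> y = 0 \<and> f z \<bullet> J y = 0"
        using y fE[of z] by (simp add: ocompl_eq[OF E] inner_commute[of "f z"])
    qed
    then have "a k \<in> ocompl J UNIV (ocompl J UNIV E)" by (simp add: ocompl_eq[OF csubspace_ocompl[OF E]])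
    then show ?thesis by (simp add: ocompl_ocompl[OF E])
  qed
  moreover have "summable (\<lambda>k. (norm (a k))\<^sup>2)"
  proof (rule summableI_nonneg_bounded)
    fix N
    show "(\<Sum>k<N. (norm (a k))\<^sup>2) \<le> B"
    proof (rule sum_le_of_power_sum_le)
      fix r :: real assume r: "0 < r" "r < 1"
      have "(\<Sum>k<N. (r ^ k * norm (a k))\<^sup>2) \<le> h2mean f r"
        unfolding fp using h2mean_pow_ser[OF a(1) r] by (auto intro!: sum_le_suminf)
      then show "(\<Sum>k<N. (r ^ k * norm (a k))\<^sup>2) \<le> B" using B[OF r] by simp
    qed
  qed simp
  ultimately show ?thesis using that fp by blast
qed

section \<open>The Wold model of a pure isometry\<close>

context
  fixes W :: "'a \<Rightarrow> 'a"
  assumes W: "isom W" and pure: "\<And>x. (\<And>k. x \<in> range (W ^^ k)) \<Longrightarrow> x = 0"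
begin

abbreviation "Wa \<equiv> hadj W"

lemma Wa_clin: "clin Wa" by (intro clin_hadj isom_clin W)

lemma hadj_funpow: "hadj (W ^^ k) x = (Wa ^^ k) x"
proof (induction k arbitrary: x)
  case 0
  then show ?case using hadj_isom[OF isom_id] by (simp add: id_def)
next
  case (Suc k)
  have "W ^^ Suc k = (\<lambda>y. W ((W ^^ k) y))" by (simp add: fun_eq_iff)
  then have "hadj (W ^^ Suc k) x = hadj (\<lambda>y. W ((W ^^ k) y)) x" by (rule arg_cong)
  also have "\<dots> = hadj (W ^^ k) (Wa x)"
    by (rule hadj_compose[OF isom_clin[OF W] clin_funpow[OF isom_clin[OF W]]])
  also have "\<dots> = (Wa ^^ Suc k) x" unfolding Suc.IH by (simp only: funpow_Suc_right o_apply)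
  finally show ?case .
qed

text \<open>\<open>Q k\<close> is the projection of \<open>x\<close> onto the range of
  \<open>W ^^ k\<close>. These ranges decrease, so by Pythagoras the projections form a Cauchy
  sequence, and the limit lies in every range; purity makes it zero.\<close>

lemma norm_Wa_power_tendsto_0: "(\<lambda>k. norm ((Wa ^^ k) x)) \<longlonglongrightarrow> 0"
proof -
  define Q where "Q k = (W ^^ k) ((Wa ^^ k) x)" for k
  have Wk: "isom (W ^^ k)" for k by (rule isom_funpow[OF W])
  have nQ: "norm (Q k) = norm ((Wa ^^ k) x)" for k by (simp add: Q_def isom_norm[OF Wk])
  have dec: "norm ((Wa ^^ Suc k) x) \<le> norm ((Wa ^^ k) x)" for k
    using norm_hadj_le[OF W] by simp
  have Qdiff: "(norm (Q k - Q m))\<^sup>2 = (norm (Q k))\<^sup>2 - (norm (Q m))\<^sup>2" if km: "k \<le> m" for k m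
  proof -
    obtain l where l: "m = k + l" using le_Suc_ex[OF km] by blast
    have e1: "(W ^^ m) u = (W ^^ k) ((W ^^ l) u)" for u by (simp only: l funpow_add o_apply)
    have e2: "(Wa ^^ m) x = (Wa ^^ l) ((Wa ^^ k) x)"
      by (simp only: l add.commute[of k l] funpow_add o_apply)
    have "Q m = (W ^^ k) ((W ^^ l) (hadj (W ^^ l) ((Wa ^^ k) x)))"
      unfolding Q_def hadj_funpow e1 e2 ..
    then have "Q k - Q m = (W ^^ k) ((Wa ^^ k) x - (W ^^ l) (hadj (W ^^ l) ((Wa ^^ k) x)))"
      by (simp add: Q_def clin_diff[OF isom_clin[OF Wk]])
    then have "(norm (Q k - Q m))\<^sup>2 = (norm ((Wa ^^ k) x))\<^sup>2 - (norm (hadj (W ^^ l) ((Wa ^^ k) x)))\<^sup>2"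
      using norm_sq_isom_split[OF Wk[of l]] by (simp add: isom_norm[OF Wk])
    also have "hadj (W ^^ l) ((Wa ^^ k) x) = (Wa ^^ m) x"
      unfolding hadj_funpow e2 ..
    finally show ?thesis by (simp add: nQ)
  qed
  have "decseq (\<lambda>k. norm (Q k))" unfolding nQ by (rule decseq_SucI) (rule dec)
  then obtain L where L: "(\<lambda>k. norm (Q k)) \<longlonglongrightarrow> L"
    using decseq_convergent[of "\<lambda>k. norm (Q k)" 0] norm_ge_zero by metis
  then have "(\<lambda>k. (norm (Q k))\<^sup>2) \<longlonglongrightarrow> L\<^sup>2" by (intro tendsto_intros)
  then have C2: "Cauchy (\<lambda>k. (norm (Q k))\<^sup>2)" by (rule LIMSEQ_imp_Cauchy)
  have "Cauchy Q"
  proof (rule CauchyI')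
    fix e :: real assume e: "e > 0"
    then obtain N where N: "\<And>k m. k \<ge> N \<Longrightarrow> m \<ge> N \<Longrightarrow> dist ((norm (Q k))\<^sup>2) ((norm (Q m))\<^sup>2) < e\<^sup>2"
      using metric_CauchyD[OF C2, of "e\<^sup>2"] by auto
    have "dist (Q k) (Q m) < e" if "N \<le> k" "k < m" for k m
    proof -
      have "(norm (Q k - Q m))\<^sup>2 < e\<^sup>2" using Qdiff[of k m] N[of k m] that by (simp add: dist_real_def)
      then show ?thesis using e by (simp add: dist_norm power2_less_imp_less)
    qed
    then show "\<exists>N. \<forall>k\<ge>N. \<forall>m>k. dist (Q k) (Q m) < e" by blast
  qed
  then obtain y where y: "Q \<longlonglongrightarrow> y" using Cauchy_convergent convergent_def by blast
  have "y \<in> range (W ^^ k)" for k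
  proof -
    have "closed (range (W ^^ k))" using csubspace_range_isom[OF Wk] by (simp add: csubspace_def)
    moreover have "Q (m + k) \<in> range (W ^^ k)" for m
      unfolding Q_def by (simp add: add.commute[of m k] funpow_add)
    ultimately show ?thesis
      using closed_sequentially[OF _ _ LIMSEQ_ignore_initial_segment[OF y, of k], of "range (W ^^ k)"] by simp
  qed
  then have "y = 0" using pure by simp
  then show ?thesis using tendsto_norm[OF y] by (simp add: nQ)
qed

text \<open>The coefficients of the Wold expansion of \<open>x\<close> as the sum of
  \<open>(W ^^ k) (wcoeff x k)\<close>: each is the projection of \<open>(Wa ^^ k) x\<close> onto
  the wandering space.\<close>

definition wcoeff :: "'a \<Rightarrow> nat \<Rightarrow> 'a" where
  "wcoeff x k = (Wa ^^ k) x - W (Wa ((Wa ^^ k) x))"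

lemma wcoeff_wandering: "wcoeff x k \<in> wandering W"
  by (simp add: wandering_def[OF W] wcoeff_def clin_diff[OF Wa_clin] hadj_isom[OF W])

text \<open>Each term is the loss of squared norm in one application of \<open>Wa\<close>; the sum
  telescopes and purity sends the remainder to zero.\<close>

lemma wcoeff_sums: "(\<lambda>k. (norm (wcoeff x k))\<^sup>2) sums (norm x)\<^sup>2"
proof -
  have "(\<Sum>k<N. (norm (wcoeff x k))\<^sup>2) = (norm x)\<^sup>2 - (norm ((Wa ^^ N) x))\<^sup>2" for N
  proof (induction N)
    case (Suc N)
    have "(norm (wcoeff x N))\<^sup>2 = (norm ((Wa ^^ N) x))\<^sup>2 - (norm (Wa ((Wa ^^ N) x)))\<^sup>2"
      unfolding wcoeff_def by (rule norm_sq_isom_split[OF W])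
    then show ?case using Suc by simp
  qed simp
  moreover have "(\<lambda>N. (norm x)\<^sup>2 - (norm ((Wa ^^ N) x))\<^sup>2) \<longlonglongrightarrow> (norm x)\<^sup>2 - 0\<^sup>2"
    by (intro tendsto_intros norm_Wa_power_tendsto_0)
  ultimately show ?thesis unfolding sums_def by simp
qed

lemma wcoeff_clin: "clin (\<lambda>x. wcoeff x k)"
  unfolding wcoeff_def
  by (rule clin_minus[OF clin_funpow[OF Wa_clin] clin_compose[OF isom_clin[OF W] clin_compose[OF Wa_clin clin_funpow[OF Wa_clin]]]])

lemma norm_wcoeff_le: "norm (wcoeff x k) \<le> norm x"
proof (rule power2_le_imp_le)
  show "(norm (wcoeff x k))\<^sup>2 \<le> (norm x)\<^sup>2"
    using sum_le_suminf[OF sums_summable[OF wcoeff_sums[of x]], of "{k}"] sums_unique[OF wcoeff_sums[of x]] by simp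
qed simp

text \<open>The partial sums \<open>s m\<close> of the shifted sequences satisfy \<open>s m = a m + W (s (m + 1))\<close>, so their limits are the backward
  shifts of the preimage.\<close>

lemma wcoeff_surj:
  assumes aE: "\<And>k. a k \<in> wandering W" and a: "summable (\<lambda>k. (norm (a k))\<^sup>2)"
  obtains x where "wcoeff x = a"
proof -
  define s where "s m N = (\<Sum>k<N. (W ^^ k) (a (m + k)))" for m N
  note W_clin = isom_clin[OF W]
  have s_Suc: "s m (Suc N) = a m + W (s (Suc m) N)" for m N
    unfolding s_def sum.lessThan_Suc_shift clin_sum[OF W_clin] by simp
  have ns: "(norm (s m N))\<^sup>2 = (\<Sum>k<N. (norm (a (m + k)))\<^sup>2)" for m N
  proof (induction N arbitrary: m)
    case (Suc N)
    have "W (s (Suc m) N) \<bullet> a m = 0" by (rule wandering_W_inner[OF W aE])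
    moreover from this have "a m \<bullet> W (s (Suc m) N) = 0" by (simp only: inner_commute)
    ultimately have "(norm (s m (Suc N)))\<^sup>2 = (norm (a m))\<^sup>2 + (norm (s (Suc m) N))\<^sup>2"
      unfolding s_Suc power2_norm_eq_inner
      by (simp add: inner_add_left inner_add_right isom_inner[OF W])
    then show ?case unfolding Suc.IH sum.lessThan_Suc_shift by simp
  qed (simp add: s_def)
  have split: "s m (N + M) - s m N = (W ^^ N) (s (m + N) M)" for m N M
  proof (induction N arbitrary: m)
    case (Suc N)
    have "s m (Suc N + M) - s m (Suc N) = W (s (Suc m) (N + M) - s (Suc m) N)"
      by (simp add: s_Suc clin_diff[OF W_clin])
    then show ?case unfolding Suc.IH by simp
  qed (simp add: s_def)
  have "convergent (s m)" for m
  proof -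
    have am: "summable (\<lambda>k. (norm (a (m + k)))\<^sup>2)"
      using summable_ignore_initial_segment[OF a, of m] by (simp add: add.commute)
    have "Cauchy (s m)"
    proof (rule CauchyI')
      fix e :: real assume e: "e > 0"
      then obtain N where N: "\<And>p q. p \<ge> N \<Longrightarrow> norm (\<Sum>k=p..<q. (norm (a (m + k)))\<^sup>2) < e\<^sup>2"
        using am unfolding summable_Cauchy by (meson zero_less_power)
      have "dist (s m p) (s m q) < e" if "N \<le> p" and pq: "p < q" for p q
      proof -
        obtain M where M: "q = p + M" using le_Suc_ex[OF less_imp_le[OF pq]] by blast
        have "(norm (s m q - s m p))\<^sup>2 = (\<Sum>k<M. (norm (a (m + p + k)))\<^sup>2)"
          unfolding M split isom_norm[OF isom_funpow[OF W]] ns ..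
        also have "\<dots> = (\<Sum>k=p..<q. (norm (a (m + k)))\<^sup>2)"
          unfolding M using sum.shift_bounds_nat_ivl[of "\<lambda>k. (norm (a (m + k)))\<^sup>2" 0 p M]
          by (simp add: lessThan_atLeast0 add.commute add.left_commute)
        also have "\<dots> < e\<^sup>2" using N[OF that(1), of q] by (simp add: sum_nonneg)
        finally show ?thesis using e by (simp add: dist_norm norm_minus_commute power2_less_imp_less)
      qed
      then show "\<exists>N. \<forall>p\<ge>N. \<forall>q>p. dist (s m p) (s m q) < e" by blast
    qed
    then show ?thesis by (rule Cauchy_convergent)
  qed
  then obtain y where y: "\<And>m. s m \<longlonglongrightarrow> y m" unfolding convergent_def by metis
  have y_rec: "y m = a m + W (y (Suc m))" for m
  proof (rule LIMSEQ_unique)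
    show "(\<lambda>N. s m (Suc N)) \<longlonglongrightarrow> y m" by (rule LIMSEQ_Suc[OF y])
    show "(\<lambda>N. s m (Suc N)) \<longlonglongrightarrow> a m + W (y (Suc m))"
      unfolding s_Suc by (intro tendsto_intros bounded_linear.tendsto[OF clin_bl[OF W_clin]] y)
  qed
  have Wa_y: "Wa (y m) = y (Suc m)" for m
    using aE[of m] by (subst y_rec) (simp add: clin_add[OF Wa_clin] hadj_isom[OF W] wandering_def[OF W])
  have "(Wa ^^ k) (y 0) = y k" for k by (induction k) (simp_all add: Wa_y)
  then have "wcoeff (y 0) k = y k - W (y (Suc k))" for k by (simp add: wcoeff_def Wa_y)
  then have "wcoeff (y 0) k = a k" for k using y_rec[of k] by simp
  then show ?thesis using that[of "y 0"] by blast
qed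

definition Lam :: "'a \<Rightarrow> complex \<Rightarrow> 'a" where "Lam x = pow_ser (wcoeff x)"

lemma radius_one_wcoeff: "radius_one (wcoeff x)"
  by (rule radius_one_bounded[of _ "norm x"]) (rule norm_wcoeff_le)

lemma Lam_eq: "cmod z < 1 \<Longrightarrow> Lam x z = (\<Sum>k. cscale J (z ^ k) (wcoeff x k))"
  by (simp add: Lam_def pow_ser_def)

lemma Lam_clin: "clin (\<lambda>x. Lam x z)"
proof (cases "cmod z < 1")
  case True
  have s: "summable (\<lambda>k. cscale J (z ^ k) (wcoeff x k))" for x by (rule pow_ser_summable[OF radius_one_wcoeff True])
  note tm = clin_compose[OF clin_cscale_fun wcoeff_clin]
  have "bounded_linear (\<lambda>x. Lam x z)"
  proof (rule bounded_linear_intro)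
    show "Lam (x + y) z = Lam x z + Lam y z" for x y
      unfolding Lam_eq[OF True] by (simp add: clin_add[OF tm] suminf_add s)
    show "Lam (c *\<^sub>R x) z = c *\<^sub>R Lam x z" for c x
      unfolding Lam_eq[OF True] clin_scaleR[OF tm] by (intro suminf_scaleR_right[symmetric] s)
    show "norm (Lam x z) \<le> norm x * (\<Sum>k. cmod z ^ k)" for x
    proof -
      have g: "summable (\<lambda>k. cmod z ^ k)" using True by (intro summable_geometric) simp
      have "norm (Lam x z) \<le> (\<Sum>k. cmod z ^ k * norm x)"
        unfolding Lam_eq[OF True]
        by (rule norm_suminf_le_complete(2))
          (use norm_wcoeff_le[of x] in \<open>auto simp: norm_cscale norm_power intro!: mult_left_mono summable_mult2 g\<close>)
      then show ?thesis using suminf_mult2[OF g, of "norm x"] by (simp add: mult.commute)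
    qed
  qed
  moreover have "Lam (J x) z = J (Lam x z)" for x
    unfolding Lam_eq[OF True] clin_J[OF tm] by (rule bounded_linear.suminf[OF J_bounded_linear s, symmetric])
  ultimately show ?thesis by (simp add: clin_def)
next
  case False
  then have "(\<lambda>x. Lam x z) = (\<lambda>x. 0)" by (simp add: Lam_def pow_ser_def)
  then show ?thesis by (simp add: clin_def bounded_linear_zero)
qed

theorem Lam_unitary: "unitary_onto_H2 J (wandering W) Lam"
  unfolding unitary_onto_H2_def
proof (intro conjI allI)
  note E = wandering_csubspace[OF W]
  have in_H2: "Lam x \<in> H2 J (wandering W)" for x
    unfolding Lam_def by (rule pow_ser_H2(1)[OF E wcoeff_wandering sums_summable[OF wcoeff_sums]])
  show norm: "H2norm (Lam x) = norm x" for x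
    unfolding Lam_def pow_ser_H2(2)[OF E wcoeff_wandering sums_summable[OF wcoeff_sums]] sums_unique[OF wcoeff_sums, symmetric] by simp
  show "Lam (x + y) z = Lam x z + Lam y z" for x y z by (rule clin_add[OF Lam_clin])
  show "Lam (cscale J c x) z = cscale J c (Lam x z)" for c x z by (rule clin_cscale[OF Lam_clin])
  show "bij_betw Lam UNIV (H2 J (wandering W))"
    unfolding bij_betw_def
  proof
    show "inj Lam"
    proof (rule injI)
      fix x y assume "Lam x = Lam y"
      then have "Lam (x - y) = Lam 0"
        by (auto simp: fun_eq_iff clin_diff[OF Lam_clin] clin_0[OF Lam_clin])
      then have "norm (x - y) = norm (0::'a)" using norm by metis
      then show "x = y" by simp
    qed
    show "range Lam = H2 J (wandering W)"
    proof
      show "H2 J (wandering W) \<subseteq> range Lam"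
      proof
        fix f assume "f \<in> H2 J (wandering W)"
        then obtain a where a: "\<And>k. a k \<in> wandering W" "summable (\<lambda>k. (norm (a k))\<^sup>2)" "f = pow_ser a"
          using H2_eq_pow_ser[OF E] by metis
        obtain x where "wcoeff x = a" using wcoeff_surj[OF a(1,2)] by blast
        then show "f \<in> range Lam" using a(3) by (auto simp: Lam_def)
      qed
    qed (use in_H2 in blast)
  qed
qed

section \<open>Intertwining of the factors of the isometry with their symbols\<close>

lemma pi_op_eq:
  assumes X: "divides_W W X"
  shows "pi_op J (bclP W X) (bclU W X) z e = bclA W X e + cscale J z (bclB W X e)"
proof -
  note U = bclU_clin[OF W X_clin[OF W X]]
  show ?thesis
    unfolding pi_op_def
    by (simp add: clin_add[OF U] clin_diff[OF U] clin_cscale[OF U] bclU_bclP[OF W X])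
      (simp add: bclU_def[OF W])
qed

text \<open>Split \<open>y\<close> into its wandering part and \<open>W (Wa y)\<close>. The first
  part is mapped by the pencil, and \<open>X\<close> commutes with \<open>W\<close>, so one step of
  the Wold expansion of \<open>X y\<close> yields \<open>bclA\<close> of the wandering part and
  passes \<open>bclB\<close> of it on to the next coefficient.\<close>

lemma wcoeff_intertwine:
  assumes X: "divides_W W X"
  shows "wcoeff (X x) 0 = bclA W X (wcoeff x 0)" "wcoeff (X x) (Suc k) = bclA W X (wcoeff x (Suc k)) + bclB W X (wcoeff x k)"
proof -
  note Xc = X_clin[OF W X] and add = clin_add[OF X_clin[OF W X]]
  note Wac = Wa_clin and W_clin = isom_clin[OF W]
  have step: "X y = bclA W X (y - W (Wa y)) + W (bclB W X (y - W (Wa y)) + X (Wa y))" for y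
  proof -
    have "X y = X (y - W (Wa y)) + X (W (Wa y))" by (simp add: clin_diff[OF Xc])
    also have "X (y - W (Wa y)) = bclA W X (y - W (Wa y)) + W (bclB W X (y - W (Wa y)))"
      by (rule apply_eq_bclA_bclB[OF W])
    finally show ?thesis by (simp add: X_W[OF W X] clin_add[OF W_clin])
  qed
  have Wa_step: "Wa (X y) = bclB W X (y - W (Wa y)) + X (Wa y)" for y
    using bclA_wandering[OF W X] by (subst step) (simp add: clin_add[OF Wac] hadj_isom[OF W] wandering_def[OF W])
  have P_step: "X y - W (Wa (X y)) = bclA W X (y - W (Wa y))" for y
    unfolding Wa_step by (subst step) simp
  show "wcoeff (X x) 0 = bclA W X (wcoeff x 0)" by (simp add: wcoeff_def P_step)
  \<comment> \<open>Only the most recent \<open>bclB\<close> term survives, since \<open>Wa\<close>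
    kills the earlier ones, which are wandering.\<close>
  have pow: "(Wa ^^ Suc k) (X x) = bclB W X (wcoeff x k) + X ((Wa ^^ Suc k) x)" for k
  proof (induction k)
    case 0
    then show ?case by (simp add: Wa_step wcoeff_def)
  next
    case (Suc k)
    have z: "Wa (bclB W X (wcoeff x k)) = 0" using bclB_wandering[OF W X wcoeff_wandering] by (simp add: wandering_def[OF W])
    have "(Wa ^^ Suc (Suc k)) (X x) = Wa ((Wa ^^ Suc k) (X x))" by simp
    also have "\<dots> = Wa (bclB W X (wcoeff x k)) + Wa (X ((Wa ^^ Suc k) x))" unfolding Suc.IH by (rule clin_add[OF Wac])
    also have "\<dots> = bclB W X (wcoeff x (Suc k)) + X ((Wa ^^ Suc (Suc k)) x)"
      by (simp only: z Wa_step[of "(Wa ^^ Suc k) x"] add_0_left) (simp add: wcoeff_def)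
    finally show ?case .
  qed
  have z: "Wa (bclB W X (wcoeff x k)) = 0" using bclB_wandering[OF W X wcoeff_wandering] by (simp add: wandering_def[OF W])
  have "wcoeff (X x) (Suc k) = bclB W X (wcoeff x k) + (X ((Wa ^^ Suc k) x) - W (Wa (X ((Wa ^^ Suc k) x))))"
    unfolding wcoeff_def[of "X x"] pow clin_add[OF Wac] z by (simp add: clin_0[OF W_clin])
  then show "wcoeff (X x) (Suc k) = bclA W X (wcoeff x (Suc k)) + bclB W X (wcoeff x k)"
    unfolding P_step by (simp add: wcoeff_def add.commute)
qed

lemma Lam_intertwine:
  assumes X: "divides_W W X" and z: "cmod z < 1"
  shows "Lam (X x) z = pi_op J (bclP W X) (bclU W X) z (Lam x z)"
proof -
  note s = pow_ser_summable[OF radius_one_wcoeff z]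
  note A = bclA_clin[OF W X_clin[OF W X]] and B = bclB_clin[OF W X_clin[OF W X]]
  have "Lam (X x) z = cscale J (z ^ 0) (wcoeff (X x) 0) + (\<Sum>k. cscale J (z ^ Suc k) (wcoeff (X x) (Suc k)))"
    unfolding Lam_eq[OF z] using suminf_split_head[OF s[of "X x"]] by simp
  also have "(\<Sum>k. cscale J (z ^ Suc k) (wcoeff (X x) (Suc k))) =
      (\<Sum>k. bclA W X (cscale J (z ^ Suc k) (wcoeff x (Suc k))) + cscale J z (bclB W X (cscale J (z ^ k) (wcoeff x k))))"
    by (intro suminf_cong)
      (simp add: wcoeff_intertwine[OF X] cscale_add_right clin_cscale[OF A] clin_cscale[OF B] cscale_cscale)
  also have "\<dots> = (\<Sum>k. bclA W X (cscale J (z ^ Suc k) (wcoeff x (Suc k)))) + (\<Sum>k. cscale J z (bclB W X (cscale J (z ^ k) (wcoeff x k))))"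
    using s[of x] summable_Suc_iff[of "\<lambda>k. cscale J (z ^ k) (wcoeff x k)"]
    by (intro suminf_add[symmetric] bounded_linear.summable[OF clin_bl[OF A]]
        bounded_linear.summable[OF clin_bl[OF clin_compose[OF clin_cscale_fun B]]]) auto
  also have "(\<Sum>k. cscale J z (bclB W X (cscale J (z ^ k) (wcoeff x k)))) = cscale J z (bclB W X (Lam x z))"
    unfolding Lam_eq[OF z]
    by (rule bounded_linear.suminf[OF clin_bl[OF clin_compose[OF clin_cscale_fun B]] s, symmetric])
  also have "(\<Sum>k. bclA W X (cscale J (z ^ Suc k) (wcoeff x (Suc k)))) = bclA W X (Lam x z) - bclA W X (cscale J (z ^ 0) (wcoeff x 0))"
    unfolding Lam_eq[OF z] bounded_linear.suminf[OF clin_bl[OF A] s]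
    by (rule suminf_split_head[OF bounded_linear.summable[OF clin_bl[OF A] s]])
  finally show ?thesis unfolding pi_op_eq[OF X] wcoeff_intertwine(1)[OF X] by simp
qed

text \<open>\<open>phi_calc\<close> is the limit of the very series that defines
  \<open>phi_op\<close>, with \<open>X\<close> replaced by its symbol. \<open>Lam\<close>
  intertwines the powers and evaluation at \<open>z\<close> is bounded, so the strong limit is
  carried over; in particular the limit taken by \<open>Lim\<close> exists.\<close>

lemma Lam_model_op:
  assumes X: "divides_W W X"
    and lim: "((\<lambda>r. phi_op X r t x) \<longlongrightarrow> y) (at_left 1)" and t: "t \<ge> 0"
  shows "Lam y = model_op J (bclP W X) (bclU W X) t (Lam x)"
proof
  fix z
  show "Lam y z = model_op J (bclP W X) (bclU W X) t (Lam x) z"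
  proof (cases "cmod z < 1")
    case True
    let ?p = "pi_op J (bclP W X) (bclU W X) z"
    note Xi = X_isom[OF W X]
    have pow: "(?p ^^ k) (Lam x z) = Lam ((X ^^ k) x) z" for k
      by (induction k) (simp_all add: Lam_intertwine[OF X True])
    have "((\<lambda>r. Lam (phi_op X r t x) z) \<longlongrightarrow> Lam y z) (at_left 1)"
      by (rule bounded_linear.tendsto[OF clin_bl[OF Lam_clin] lim])
    moreover have "\<forall>\<^sub>F r in at_left 1. Lam (phi_op X r t x) z =
        (\<Sum>k. cscale J (phi_coeff t k * of_real r ^ k) ((?p ^^ k) (Lam x z)))"
    proof (rule eventually_mono[OF eventually_at_left_real[of 0]])
      fix r :: real assume r: "r \<in> {0<..<1}"
      show "Lam (phi_op X r t x) z = (\<Sum>k. cscale J (phi_coeff t k * of_real r ^ k) ((?p ^^ k) (Lam x z)))"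
        unfolding pow phi_op_def[OF Xi]
        by (rule op_ser_apply_clin[OF Xi phi_coeff_summable(1) Lam_clin]) (use r t Xi in auto)
    qed simp
    ultimately have "((\<lambda>r. \<Sum>k. cscale J (phi_coeff t k * of_real r ^ k) ((?p ^^ k) (Lam x z))) \<longlongrightarrow> Lam y z) (at_left 1)"
      by (rule Lim_transform_eventually)
    then have "phi_calc J t ?p (Lam x z) = Lam y z"
      unfolding phi_calc_def by (intro tendsto_Lim) auto
    then show ?thesis using True by (simp add: model_op_def)
  qed (simp add: model_op_def Lam_def pow_ser_def)
qed

end
end

section \<open>Purity of the product of the cogenerators\<close>

context chilbert
begin

lemma op_ser_in_subspace:
  assumes W: "isom W" and a: "summable (\<lambda>k. cmod (a k))"
    and M: "csubspace J M" and WM: "\<And>x. x \<in> M \<Longrightarrow> W x \<in> M" and x: "x \<in> M"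
  shows "op_ser W a x \<in> M"
proof -
  have "(W ^^ k) x \<in> M" for k by (induction k) (simp_all add: x WM)
  then show ?thesis unfolding op_ser_def by (rule csubspace_suminf[OF M _ op_ser_summable[OF W a]])
qed

lemma subspace_eqI:
  assumes M: "csubspace J M" and xy: "x \<in> M" "y \<in> M" and eq: "\<And>v. v \<in> M \<Longrightarrow> v \<bullet> x = v \<bullet> y"
  shows "x = y"
proof -
  have "(x - y) \<bullet> (x - y) = 0" using eq[OF csubspace_diff[OF M xy]] by (simp add: inner_diff_right)
  then show ?thesis by simp
qed

end

context isometric_semigroup
begin

text \<open>On \<open>K\<close> the approximants \<open>S\<^sub>m\<close> of \<open>V\<^sub>t\<close> are normal, so their adjoints \<open>T\<^sub>m\<close> converge strongly as well, and the limit
  of \<open>T\<^sub>m x\<close> is a preimage of \<open>x\<close>.\<close>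

lemma unitary_cogen_imp_surjective:
  assumes K: "csubspace J K" and cK: "cogen ` K = K" and t: "t \<ge> 0"
  shows "K \<subseteq> V t ` K"
proof
  fix x assume x: "x \<in> K"
  note W = cogen_isom
  define r where "r m = 1 - 1 / real (m + 2)" for m
  have r: "0 \<le> r m" "r m < 1" for m by (auto simp: r_def field_simps)
  define S where "S m = phi_op cogen (r m) t" for m
  define T where "T m = hadj (S m)" for m
  have Sc: "clin (S m)" for m unfolding S_def by (rule phi_op_clin[OF W r t])
  have Tc: "clin (T m)" for m unfolding T_def by (rule clin_hadj[OF Sc])
  have SK: "S m u \<in> M" if "csubspace J M" "\<And>x. x \<in> M \<Longrightarrow> cogen x \<in> M" "u \<in> M" for m u M
    unfolding S_def phi_op_def[OF W] by (rule op_ser_in_subspace[OF W phi_coeff_summable(1)[OF W r t] that])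
  have cogK: "cogen u \<in> K" if "u \<in> K" for u using cK that by blast
  have cogK': "\<exists>v\<in>K. u = cogen v" if "u \<in> K" for u
  proof -
    have "u \<in> cogen ` K" by (simp only: cK that)
    then show ?thesis by blast
  qed
  have SinK: "S m u \<in> K" if "u \<in> K" for m u by (rule SK[OF K cogK that])
  have T_inner: "v \<bullet> T m u = S m v \<bullet> u" for v m u unfolding T_def by (rule hadj_inner[OF clin_bl[OF Sc]])
  have T_inner': "T m u \<bullet> v = u \<bullet> S m v" for v m u unfolding T_def by (rule hadj_inner'[OF clin_bl[OF Sc]])
  have Kperp: "cogen u \<in> ocompl J UNIV K" if u: "u \<in> ocompl J UNIV K" for u
  proof -
    have "cogen u \<bullet> y = 0" if y: "y \<in> K" for y
    proof -
      obtain v where v: "v \<in> K" "y = cogen v" using cogK'[OF y] by blast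
      then show ?thesis using u by (simp add: isom_inner[OF W] ocompl_eq[OF K])
    qed
    then show ?thesis by (simp add: ocompl_eq[OF K])
  qed
  \<comment> \<open>Since \<open>cogen\<close> maps \<open>K\<close> onto itself isometrically, it
    preserves the complement of \<open>K\<close>, and so does the series \<open>S m\<close>; its
    adjoint therefore preserves \<open>K\<close>.\<close>
  have TinK: "T m u \<in> K" if u: "u \<in> K" for m u
  proof -
    have "T m u \<bullet> y = 0" if y: "y \<in> ocompl J UNIV K" for y
    proof -
      have "S m y \<in> ocompl J UNIV K" by (rule SK[OF csubspace_ocompl[OF K] Kperp y])
      then have "S m y \<bullet> u = 0" using u by (simp add: ocompl_eq[OF K])
      then show ?thesis unfolding T_inner' by (simp only: inner_commute)
    qed
    then have "T m u \<in> ocompl J UNIV (ocompl J UNIV K)" by (simp add: ocompl_eq[OF csubspace_ocompl[OF K]])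
    then show ?thesis by (simp add: ocompl_ocompl[OF K])
  qed
  have Scog: "S m (cogen u) = cogen (S m u)" for m u
    unfolding S_def phi_op_def[OF W]
    by (rule op_ser_commute[OF W phi_coeff_summable(1)[OF W r t] isom_clin[OF W] refl, symmetric])
  have Tcog: "T m (cogen u) = cogen (T m u)" if u: "u \<in> K" for m u
  proof (rule subspace_eqI[OF K TinK[OF cogK[OF u]] cogK[OF TinK[OF u]]])
    fix v assume "v \<in> K"
    then obtain v' where v: "v = cogen v'" using cogK' by blast
    show "v \<bullet> T m (cogen u) = v \<bullet> cogen (T m u)"
      unfolding v T_inner Scog isom_inner[OF W] ..
  qed
  \<comment> \<open>\<open>cogen\<close> is unitary on \<open>K\<close>, so commutation with
    \<open>cogen\<close> passes from \<open>S m\<close> to its adjoint, and from there to every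
    series in \<open>cogen\<close>.\<close>
  have TS: "T m (S l u) = S l (T m u)" if u: "u \<in> K" for m l u
  proof -
    have uk: "(cogen ^^ k) u \<in> K" for k by (induction k) (simp_all add: u cogK)
    have "T m ((cogen ^^ k) u) = (cogen ^^ k) (T m u)" for k by (induction k) (simp_all add: Tcog uk)
    then show ?thesis
      using op_ser_apply_clin[OF W phi_coeff_summable(1)[OF W r t] Tc, of m l u]
      unfolding S_def phi_op_def[OF W] op_ser_def by simp
  qed
  have normal: "norm (T m x - T l x) = norm (S m x - S l x)" for m l
  proof -
    define u where "u = T m x - T l x"
    define w where "w = S m x - S l x"
    have "S m u - S l u = T m w - T l w"
      unfolding u_def w_def clin_diff[OF Sc] clin_diff[OF Tc] TS[OF x] by simp
    then have "u \<bullet> u = x \<bullet> (T m w - T l w)"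
      by (simp add: u_def inner_diff_left T_inner' flip: inner_diff_right)
    also have "\<dots> = w \<bullet> w" unfolding inner_diff_right T_inner by (simp add: w_def inner_diff_left)
    finally have "(norm u)\<^sup>2 = (norm w)\<^sup>2" by (simp add: power2_norm_eq_inner)
    then show ?thesis by (simp add: u_def w_def)
  qed
  have "filterlim r (at_left 1) sequentially"
  proof -
    have "r \<longlonglongrightarrow> 1 - 0" unfolding r_def
      using LIMSEQ_ignore_initial_segment[OF lim_1_over_n, of 2] by (intro tendsto_intros) simp
    then show ?thesis unfolding filterlim_at using r(2) by (auto intro!: always_eventually simp: less_imp_neq)
  qed
  then have Slim: "(\<lambda>m. S m u) \<longlonglongrightarrow> V t u" for u
    unfolding S_def by (rule filterlim_compose[OF phi_op_cogen_tendsto[OF t]])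
  have "Cauchy (\<lambda>m. T m x)"
    using LIMSEQ_imp_Cauchy[OF Slim[of x]] unfolding Cauchy_def dist_norm normal .
  then obtain z where z: "(\<lambda>m. T m x) \<longlonglongrightarrow> z" using Cauchy_convergent convergent_def by blast
  have clK: "closed K" using K by (simp add: csubspace_def)
  have zK: "z \<in> K" using closed_sequentially[OF clK _ z] TinK[OF x] by simp
  have VK: "V t u \<in> K" if "u \<in> K" for u using closed_sequentially[OF clK _ Slim[of u]] SinK[OF that] by simp
  \<comment> \<open>Contractivity of the \<open>S m\<close> lets the argument vary with
    \<open>m\<close>: \<open>S m (T m x)\<close> has the same limit as \<open>S m z\<close>, namely
    \<open>V t z\<close>.\<close>
  have "(\<lambda>m. S m (z - T m x)) \<longlonglongrightarrow> 0"
  proof (rule Lim_null_comparison)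
    show "\<forall>\<^sub>F m in sequentially. norm (S m (z - T m x)) \<le> norm (z - T m x)"
      unfolding S_def using norm_phi_op_le[OF W r t] by (intro always_eventually allI)
    show "(\<lambda>m. norm (z - T m x)) \<longlonglongrightarrow> 0"
      using tendsto_norm[OF tendsto_diff[OF tendsto_const[of z] z]] by simp
  qed
  from tendsto_diff[OF Slim[of z] this] have ST: "(\<lambda>m. T m (S m x)) \<longlonglongrightarrow> V t z"
    by (simp add: clin_diff[OF Sc] TS[OF x])
  \<comment> \<open>The same sequence, written as \<open>T m (S m x)\<close>, converges weakly on
    \<open>K\<close> to \<open>x\<close>, because \<open>V t\<close> preserves inner products; the
    two limits must agree.\<close>
  have "V t z = x"
  proof (rule subspace_eqI[OF K VK[OF zK] x])
    fix v assume "v \<in> K"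
    have "(\<lambda>m. v \<bullet> T m (S m x)) \<longlonglongrightarrow> v \<bullet> V t z" by (intro tendsto_intros ST)
    moreover have "(\<lambda>m. v \<bullet> T m (S m x)) \<longlonglongrightarrow> V t v \<bullet> V t x"
      unfolding T_inner by (intro tendsto_intros Slim)
    ultimately show "v \<bullet> V t z = v \<bullet> x"
      using LIMSEQ_unique isom_inner[OF V_isom[OF t]] by metis
  qed
  then show "x \<in> V t ` K" using zK by blast
qed

end

section \<open>Purity for c.n.u. tuples and assembly of the model\<close>

context isometric_tuple
begin

abbreviation C :: "nat \<Rightarrow> 'a \<Rightarrow> 'a" where "C j \<equiv> isometric_semigroup.cogen (V j)"

lemma C_isom: "j < n \<Longrightarrow> isom (C j)"
  by (rule isometric_semigroup.cogen_isom[OF semigroup])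

lemma C_V_commute: "i < n \<Longrightarrow> j < n \<Longrightarrow> t \<ge> 0 \<Longrightarrow> C i (V j t x) = V j t (C i x)"
  by (rule isometric_semigroup.cogen_commute[OF semigroup V_clin]) (auto intro: V_commute)

lemma C_commute: "i < n \<Longrightarrow> j < n \<Longrightarrow> C i (C j x) = C j (C i x)"
  by (rule isometric_semigroup.cogen_commute[OF semigroup isom_clin[OF C_isom]]) (auto intro: C_V_commute)

definition Wc :: "'a \<Rightarrow> 'a" where "Wc = Uprod C n"

lemma Wc_isom: "isom Wc" unfolding Wc_def by (rule Uprod_isom[OF C_isom])

lemma Wc_power_commute:
  assumes "\<And>i x. i < n \<Longrightarrow> B (C i x) = C i (B x)" shows "B ((Wc ^^ k) x) = (Wc ^^ k) (B x)"
proof (induction k)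
  case (Suc k)
  have "B (Wc y) = Wc (B y)" for y unfolding Wc_def by (rule Uprod_commute) (rule assms)
  then show ?case using Suc by simp
qed simp

definition Ku :: "'a set" where "Ku = (\<Inter>k\<in>UNIV. range (Wc ^^ k))"

lemma csubspace_Ku: "csubspace J Ku"
  unfolding Ku_def by (intro csubspace_INT csubspace_range_isom isom_funpow Wc_isom)

lemma C_image_Ku:
  assumes j: "j < n" shows "C j ` Ku = Ku"
  unfolding Ku_def
proof (rule image_INT_range[where l = 1 and S = "Uskip C j n"])
  show "\<And>x y. (Wc ^^ 1) x = (Wc ^^ 1) y \<Longrightarrow> x = y" by (rule isom_inj[OF isom_funpow[OF Wc_isom]])
  show "\<exists>m\<in>UNIV. \<forall>x. (Wc ^^ m) x = (Wc ^^ 1) ((Wc ^^ k) x)" for k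
    by (rule bexI[of _ "Suc k"]) simp_all
  show "(Wc ^^ 1) x = C j (Uskip C j n x)" for x
    using Uprod_Uskip[of n C j x, OF C_commute j] by (simp add: Wc_def)
  show "C j ((Wc ^^ k) x) = (Wc ^^ k) (C j x)" for k x by (rule Wc_power_commute) (rule C_commute[OF j])
  show "Uskip C j n ((Wc ^^ k) x) = (Wc ^^ k) (Uskip C j n x)" for k x
    by (rule Wc_power_commute, rule Uskip_commute[symmetric], rule C_commute)
qed simp

lemma V_image_Ku:
  assumes j: "j < n" and t: "t \<ge> 0" shows "V j t ` Ku = Ku"
proof
  show "V j t ` Ku \<subseteq> Ku"
    unfolding Ku_def
    by (rule image_subsetI, rule INT_range_invariant[rotated], assumption, rule Wc_power_commute)
      (rule C_V_commute[OF _ j t, symmetric])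
  show "Ku \<subseteq> V j t ` Ku"
    by (rule isometric_semigroup.unitary_cogen_imp_surjective[OF semigroup[OF j] csubspace_Ku C_image_Ku[OF j] t])
qed

lemma cnu_imp_Ku_trivial:
  assumes "cnu J UNIV n V" shows "Ku = {0}"
proof (rule ccontr)
  assume ne: "Ku \<noteq> {0}"
  note part = surjective_part[OF csubspace_Ku subset_UNIV UNIV_I V_image_Ku]
  have "\<exists>M. M \<noteq> {0} \<and> jointly_reducing J UNIV n V M \<and>
      (\<forall>j<n. semigroup_on J M (V j) \<and> (\<forall>t\<ge>0. unitary_on J M (V j t)))"
    by (rule exI[of _ Ku]) (intro conjI ne part)
  then show False using assms unfolding cnu_def by (elim conjE notE)
qed

theorem cnu_imp_model:
  assumes "cnu J UNIV n V" shows "unitarily_equiv_model J n V"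
proof -
  note W = Wc_isom
  have pure: "x = 0" if "\<And>k. x \<in> range (Wc ^^ k)" for x
  proof -
    have "x \<in> Ku" unfolding Ku_def using that by blast
    then show ?thesis using cnu_imp_Ku_trivial[OF assms] by blast
  qed
  have dvd: "divides_W Wc (C j)" if "j < n" for j
    unfolding Wc_def by (rule divides_A[OF C_isom C_commute that])
  have "BCL_triple J n (wandering Wc) (\<lambda>j. bclP Wc (C j)) (\<lambda>j. bclU Wc (C j))"
    unfolding Wc_def by (rule BCL_triple_of_factors[OF C_isom C_commute])
  moreover have "BCL_no_fixed n (wandering Wc) (\<lambda>j. bclP Wc (C j)) (\<lambda>j. bclU Wc (C j))"
    unfolding BCL_no_fixed_def
  proof (intro allI impI ballI, elim conjE)
    fix j x assume j: "j < n" and Px: "bclP Wc (C j) x = 0" and Ux: "bclU Wc (C j) x = x"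
    \<comment> \<open>A vector killed by the projection has no \<open>bclB\<close> part, so the
      unitary and the cogenerator agree on it, and the latter has no fixed vector.\<close>
    have "bclB Wc (C j) x = bclU Wc (C j) (bclP Wc (C j) x)" by (rule bclU_bclP[OF W dvd[OF j], symmetric])
    then have B0: "bclB Wc (C j) x = 0"
      unfolding Px by (simp add: clin_0[OF bclU_clin[OF W isom_clin[OF C_isom[OF j]]]])
    then have "bclA Wc (C j) x = x" using Ux by (simp add: bclU_def[OF W])
    then have "C j x = x" using apply_eq_bclA_bclB[OF W, of "C j" x] B0 by (simp add: clin_0[OF isom_clin[OF W]])
    then show "x = 0" by (rule isometric_semigroup.cogen_no_fixed[OF semigroup[OF j]])
  qed
  moreover have "unitary_onto_H2 J (wandering Wc) (Lam Wc)" by (rule Lam_unitary[OF W pure])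
  moreover have "\<forall>j<n. \<forall>t\<ge>0. \<forall>x. Lam Wc (V j t x) = model_op J (bclP Wc (C j)) (bclU Wc (C j)) t (Lam Wc x)"
  proof (intro allI impI)
    fix j t x assume j: "j < n" and t: "(t::real) \<ge> 0"
    show "Lam Wc (V j t x) = model_op J (bclP Wc (C j)) (bclU Wc (C j)) t (Lam Wc x)"
      by (rule Lam_model_op[OF W pure dvd[OF j] isometric_semigroup.phi_op_cogen_tendsto[OF semigroup[OF j] t] t])
  qed
  ultimately show ?thesis unfolding unitarily_equiv_model_def by blast
qed

end

theorem theorem2p7:
  fixes J :: "'a::{real_inner, polish_space} \<Rightarrow> 'a"
    and V :: "nat \<Rightarrow> real \<Rightarrow> 'a \<Rightarrow> 'a"
    and n :: nat
  assumes "complex_structure J"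
    and "n \<ge> 2"
    and "n_isometric_semigroup J UNIV n V"
  shows "(\<exists>!HH. csubspace J (fst HH) \<and> snd HH = ocompl J UNIV (fst HH) \<and>
            jointly_reducing J UNIV n V (fst HH) \<and> jointly_reducing J UNIV n V (snd HH) \<and>
            cnu J (fst HH) n V \<and> n_unitary_semigroup J (snd HH) n V)
       \<and> (cnu J UNIV n V \<longrightarrow> unitarily_equiv_model J n V)"
proof -
  interpret isometric_tuple J n V by standard (fact assms)+
  show ?thesis (is "(\<exists>!HH. ?P HH) \<and> _")
  proof (intro conjI impI)
    show "\<exists>!HH. ?P HH"
    proof (rule ex1I[of _ "(ocompl J UNIV Hu, Hu)"])
      fix HH assume HH: "?P HH"
      have "fst HH = ocompl J UNIV Hu" "snd HH = Hu"
        by (rule decomposition_unique[of "fst HH" "snd HH"]; use HH in blast)+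
      then show "HH = (ocompl J UNIV Hu, Hu)" by (simp add: prod_eq_iff)
    qed (use decomposition_exists in simp)
    show "unitarily_equiv_model J n V" if "cnu J UNIV n V" using cnu_imp_model[OF that] .
  qed
qed

end
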